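(* Let $(X,\sigma)$ be a metrizable multivariable dynamical system with $n$ maps. Every isometric covariant representation $(\pi,S)$ of $(X,\sigma)$, on a Hilbert space $\mathcal{H}$, has a dilation to a full isometric representation in the sense that there is a Hilbert space $\mathcal{K}$ containing $\mathcal{H}$, a $*$-representation $\rho$ of $\mathrm{C}_0(X)$ on $\mathcal{K}$ and isometries $T_1,\dots,T_n$ on $\mathcal{K}$ such that \begin{enumerate} \item $(\rho,T)$ is a full isometric representation of $(X,\sigma)$. \item $\mathcal{H}$ reduces $\rho$ and $\rho|_{\mathcal{H}}=\pi$, and \item $\mathcal{H}$ is semi-invariant for each $T_i$ and $P_{\mathcal{H}}T_i|_{\mathcal{H}}=S_i$. \end{enumerate}
   Context: A multivariable dynamical system $(X,\sigma)$ is a locally compact Hausdorff space $X$ together with $n\ge1$ proper continuous maps $\sigma_1,\dots,\sigma_n$ of $X$ into itself; it is metrizable if $X$ is metrizable. An isometric covariant representation $(\pi,S)$ on $\mathcal{H}$ consists of a $*$-representation $\pi$ of $\mathrm{C}_0(X)$ on $\mathcal{H}$ and isometries $S=(S_1,\dots,S_n)$ on $\mathcal{H}$ with $\pi(f)S_i=S_i\pi(f\circ\sigma_i)$ for all $f\in\mathrm{C}_0(X)$ and $1\le i\le n$. $E_\pi$ denotes the spectral measure on Borel subsets of $X$ associated to $\pi$ (so $\pi(f)=\int f\,dE_\pi$). An isometric covariant representation is a full isometric representation if $S_iS_i^*=E_\pi(\sigma_i(X))$ for $1\le i\le n$. A subspace is semi-invariant for an operator if it is the orthogonal difference of two nested invariant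 subspaces. $P_{\mathcal{H}}$ is the orthogonal projection onto $\mathcal{H}$.
   Formalization: The *-representations are taken to be nondegenerate; for a degenerate π (for example π = 0 on a nonzero H) no full dilation exists, since E_ρ(σ_i(X)) vanishes on the degenerate part of H. *)

theory Defs
  imports "HOL-Analysis.Analysis"
begin

section \<open>Complex Hilbert spaces\<close>

text \<open>
  The inner product is linear in the first argument.  Norm, metric and topology are those of the
  underlying real inner product \<open>Re \<langle>x, y\<rangle>\<close>, so that the real library applies.
\<close>

class chilbert = real_inner + complete_space +
  fixes scaleC :: "complex \<Rightarrow> 'a \<Rightarrow> 'a" (infixr \<open>*\<^sub>C\<close> 75)
    and cinner :: "'a \<Rightarrow> 'a \<Rightarrow> complex"
  assumes scaleC_add_right: "c *\<^sub>C (x + y) = c *\<^sub>C x + c *\<^sub>C y"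
    and scaleC_add_left: "(c + d) *\<^sub>C x = c *\<^sub>C x + d *\<^sub>C x"
    and scaleC_scaleC: "c *\<^sub>C (d *\<^sub>C x) = (c * d) *\<^sub>C x"
    and scaleC_of_real: "complex_of_real r *\<^sub>C x = r *\<^sub>R x"
    and cinner_commute: "cinner x y = cnj (cinner y x)"
    and cinner_add_left: "cinner (x + y) z = cinner x z + cinner y z"
    and cinner_scaleC_left: "cinner (c *\<^sub>C x) y = c * cinner x y"
    and Re_cinner: "Re (cinner x y) = inner x y"

instantiation complex :: chilbert
begin

definition scaleC_complex :: "complex \<Rightarrow> complex \<Rightarrow> complex" where
  "scaleC_complex c x = c * x"

definition cinner_complex :: "complex \<Rightarrow> complex \<Rightarrow> complex" where
  "cinner_complex x y = x * cnj y"

instance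
  by standard
    (simp_all add: scaleC_complex_def cinner_complex_def algebra_simps scaleR_conv_of_real
      inner_complex_def)

end

lemma cinner_scaleC_right: "cinner x (c *\<^sub>C y) = cnj c * cinner (x::'a::chilbert) y"
  by (metis cinner_commute cinner_scaleC_left complex_cnj_mult complex_cnj_cnj)

lemma cinner_self: "cinner x x = complex_of_real ((norm (x::'a::chilbert))\<^sup>2)"
proof -
  have "Im (cinner x x) = 0"
    using arg_cong[OF cinner_commute[of x x], of Im] by simp
  then show ?thesis
    by (simp add: complex_eq_iff Re_cinner power2_norm_eq_inner)
qed

lemma norm_scaleC: "norm (c *\<^sub>C x) = cmod c * norm (x::'a::chilbert)"
proof -
  have "complex_of_real ((norm (c *\<^sub>C x))\<^sup>2) = complex_of_real ((cmod c * norm x)\<^sup>2)"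
    unfolding cinner_self[symmetric] cinner_scaleC_left cinner_scaleC_right
    by (simp add: cinner_self power_mult_distrib complex_norm_square mult_ac
        flip: of_real_power)
  then have "(norm (c *\<^sub>C x))\<^sup>2 = (cmod c * norm x)\<^sup>2"
    by (simp only: of_real_eq_iff)
  then show ?thesis
    by (metis mult_nonneg_nonneg norm_ge_zero power2_eq_imp_eq)
qed

lemma norm_cinner_le: "cmod (cinner x y) \<le> norm (x::'a::chilbert) * norm y"
proof (cases "cinner x y = 0")
  case False
  define c where "c = cnj (sgn (cinner x y))"
  have c: "cmod c = 1"
    using False by (simp add: c_def norm_sgn)
  have "c * cinner x y = complex_of_real (cmod (cinner x y))"
    using False
    by (simp add: c_def sgn_eq mult.commute complex_norm_square[symmetric] power2_eq_square)
  then have "cmod (cinner x y) = Re (c * cinner x y)"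
    by simp
  also have "\<dots> = inner (c *\<^sub>C x) y"
    by (simp only: cinner_scaleC_left[symmetric] Re_cinner)
  also have "\<dots> \<le> norm (c *\<^sub>C x) * norm y"
    by (rule norm_cauchy_schwarz)
  finally show ?thesis
    by (simp add: norm_scaleC c)
qed simp

text \<open>
  Hilbert spaces are represented by their carrier: a closed complex-linear subspace of a type of
  class \<open>chilbert\<close> (for instance the whole type).  Operators on such a space are functions of which
  only the values on the carrier matter.
\<close>

definition closed_csubspace :: "'a::chilbert set \<Rightarrow> bool" where
  "closed_csubspace M \<longleftrightarrow>
     closed M \<and> 0 \<in> M \<and> (\<forall>x\<in>M. \<forall>y\<in>M. x + y \<in> M) \<and> (\<forall>c. \<forall>x\<in>M. c *\<^sub>C x \<in> M)"

definition clinear_on :: "'a::chilbert set \<Rightarrow> ('a \<Rightarrow> 'b::chilbert) \<Rightarrow> bool" where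
  "clinear_on H A \<longleftrightarrow>
     (\<forall>x\<in>H. \<forall>y\<in>H. A (x + y) = A x + A y) \<and> (\<forall>c. \<forall>x\<in>H. A (c *\<^sub>C x) = c *\<^sub>C A x)"

definition bounded_op :: "'a::chilbert set \<Rightarrow> ('a \<Rightarrow> 'a) \<Rightarrow> bool" where
  "bounded_op H A \<longleftrightarrow>
     A ` H \<subseteq> H \<and> clinear_on H A \<and> (\<exists>B. \<forall>x\<in>H. norm (A x) \<le> B * norm x)"

definition isometry :: "'a::chilbert set \<Rightarrow> 'b::chilbert set \<Rightarrow> ('a \<Rightarrow> 'b) \<Rightarrow> bool" where
  "isometry H K V \<longleftrightarrow> V ` H \<subseteq> K \<and> clinear_on H V \<and> (\<forall>x\<in>H. norm (V x) = norm x)"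

definition adjoint_on :: "'a::chilbert set \<Rightarrow> ('a \<Rightarrow> 'a) \<Rightarrow> 'a \<Rightarrow> 'a" where
  "adjoint_on H A y = (THE z. z \<in> H \<and> (\<forall>x\<in>H. cinner (A x) y = cinner x z))"

definition is_projection :: "'a::chilbert set \<Rightarrow> ('a \<Rightarrow> 'a) \<Rightarrow> bool" where
  "is_projection H P \<longleftrightarrow> bounded_op H P \<and> (\<forall>x\<in>H. P (P x) = P x) \<and>
     (\<forall>x\<in>H. \<forall>y\<in>H. cinner (P x) y = cinner x (P y))"

definition proj_onto :: "'a::chilbert set \<Rightarrow> 'a \<Rightarrow> 'a" where
  "proj_onto M x = (THE y. y \<in> M \<and> (\<forall>z\<in>M. cinner (x - y) z = 0))"

definition ortho_diff :: "'a::chilbert set \<Rightarrow> 'a set \<Rightarrow> 'a set" where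
  "ortho_diff M N = {x\<in>M. \<forall>y\<in>N. cinner x y = 0}"

definition semi_invariant :: "'a::chilbert set \<Rightarrow> ('a \<Rightarrow> 'a) \<Rightarrow> 'a set \<Rightarrow> bool" where
  "semi_invariant K A L \<longleftrightarrow>
     (\<exists>M N. closed_csubspace M \<and> closed_csubspace N \<and> N \<subseteq> M \<and> M \<subseteq> K \<and>
        A ` M \<subseteq> M \<and> A ` N \<subseteq> N \<and> L = ortho_diff M N)"

definition reduces :: "'a::chilbert set \<Rightarrow> ('a \<Rightarrow> 'a) \<Rightarrow> 'a set \<Rightarrow> bool" where
  "reduces K A L \<longleftrightarrow> A ` L \<subseteq> L \<and> A ` (ortho_diff K L) \<subseteq> ortho_diff K L"


section \<open>The Hilbert space of square-summable sequences\<close>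

text \<open>
  HOL cannot quantify existentially over types.  The Hilbert space of a dilation is therefore sought
  among the closed subspaces of the space of square-summable sequences in the given space.
\<close>

typedef (overloaded) 'a l2seq = "{x :: nat \<Rightarrow> 'a::chilbert. summable (\<lambda>n. (norm (x n))\<^sup>2)}"
  morphisms l2nth Abs_l2seq
  by (rule exI[of _ "\<lambda>_. 0"]) simp

setup_lifting type_definition_l2seq

lemma summable_l2nth: "summable (\<lambda>n. (norm (l2nth x n))\<^sup>2)"
  using l2nth[of x] by simp

lemma l2_summable_add:
  fixes x y :: "nat \<Rightarrow> 'a::chilbert"
  assumes "summable (\<lambda>n. (norm (x n))\<^sup>2)" "summable (\<lambda>n. (norm (y n))\<^sup>2)"
  shows "summable (\<lambda>n. (norm (x n + y n))\<^sup>2)"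
proof (rule summable_comparison_test')
  show "summable (\<lambda>n. 2 * (norm (x n))\<^sup>2 + 2 * (norm (y n))\<^sup>2)"
    by (intro summable_add summable_mult assms)
  show "norm ((norm (x n + y n))\<^sup>2) \<le> 2 * (norm (x n))\<^sup>2 + 2 * (norm (y n))\<^sup>2" for n
  proof -
    have "(norm (x n + y n))\<^sup>2 \<le> (norm (x n) + norm (y n))\<^sup>2"
      by (intro power_mono norm_triangle_ineq) simp
    also have "\<dots> \<le> 2 * (norm (x n))\<^sup>2 + 2 * (norm (y n))\<^sup>2"
      using zero_le_power2[of "norm (x n) - norm (y n)"] by (simp add: power2_sum power2_diff)
    finally show ?thesis
      by simp
  qed
qed

lemma l2_summable_scaleC:
  fixes x :: "nat \<Rightarrow> 'a::chilbert"
  assumes "summable (\<lambda>n. (norm (x n))\<^sup>2)"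
  shows "summable (\<lambda>n. (norm (c *\<^sub>C x n))\<^sup>2)"
  using summable_mult[OF assms, of "(cmod c)\<^sup>2"] by (simp add: norm_scaleC power_mult_distrib)

lemma l2_summable_cinner:
  fixes x y :: "nat \<Rightarrow> 'a::chilbert"
  assumes "summable (\<lambda>n. (norm (x n))\<^sup>2)" "summable (\<lambda>n. (norm (y n))\<^sup>2)"
  shows "summable (\<lambda>n. cinner (x n) (y n))"
proof (rule summable_comparison_test')
  show "summable (\<lambda>n. (norm (x n))\<^sup>2 + (norm (y n))\<^sup>2)"
    by (intro summable_add assms)
  show "norm (cinner (x n) (y n)) \<le> (norm (x n))\<^sup>2 + (norm (y n))\<^sup>2" for n
  proof -
    have "2 * (norm (x n) * norm (y n)) \<le> (norm (x n))\<^sup>2 + (norm (y n))\<^sup>2"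
      using zero_le_power2[of "norm (x n) - norm (y n)"] by (simp add: power2_diff)
    moreover have "0 \<le> norm (x n) * norm (y n)"
      by simp
    ultimately show ?thesis
      using norm_cinner_le[of "x n" "y n"] by linarith
  qed
qed

lemmas l2seq_summable = l2_summable_cinner[OF summable_l2nth summable_l2nth]

instantiation l2seq :: (chilbert) real_vector
begin

lift_definition zero_l2seq :: "'a l2seq" is "\<lambda>_. 0"
  by simp

lift_definition plus_l2seq :: "'a l2seq \<Rightarrow> 'a l2seq \<Rightarrow> 'a l2seq" is "\<lambda>x y n. x n + y n"
  by (simp add: l2_summable_add)

lift_definition uminus_l2seq :: "'a l2seq \<Rightarrow> 'a l2seq" is "\<lambda>x n. - x n"
  by simp

lift_definition minus_l2seq :: "'a l2seq \<Rightarrow> 'a l2seq \<Rightarrow> 'a l2seq" is "\<lambda>x y n. x n - y n"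
  subgoal for x y
    using l2_summable_add[of x "\<lambda>n. - y n"] by simp
  done

lift_definition scaleR_l2seq :: "real \<Rightarrow> 'a l2seq \<Rightarrow> 'a l2seq" is "\<lambda>r x n. r *\<^sub>R x n"
  subgoal for r x
    using l2_summable_scaleC[of x "complex_of_real r"] by (simp add: scaleC_of_real)
  done

instance
proof
  fix a b c :: "'a l2seq" and r s :: real
  show "a + b + c = a + (b + c)"
    by transfer (simp add: add.assoc)
  show "a + b = b + a"
    by transfer (simp add: add.commute)
  show "0 + a = a"
    by transfer simp
  show "- a + a = 0"
    by transfer simp
  show "a - b = a + - b"
    by transfer simp
  show "r *\<^sub>R (a + b) = r *\<^sub>R a + r *\<^sub>R b"
    by transfer (simp add: scaleR_add_right)
  show "(r + s) *\<^sub>R a = r *\<^sub>R a + s *\<^sub>R a"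
    by transfer (simp add: scaleR_add_left)
  show "r *\<^sub>R s *\<^sub>R a = (r * s) *\<^sub>R a"
    by transfer simp
  show "1 *\<^sub>R a = a"
    by transfer simp
qed

end

instantiation l2seq :: (chilbert) real_inner
begin

definition inner_l2seq :: "'a l2seq \<Rightarrow> 'a l2seq \<Rightarrow> real" where
  "inner_l2seq x y = (\<Sum>n. inner (l2nth x n) (l2nth y n))"

definition norm_l2seq :: "'a l2seq \<Rightarrow> real" where
  "norm_l2seq x = sqrt (inner x x)"

definition dist_l2seq :: "'a l2seq \<Rightarrow> 'a l2seq \<Rightarrow> real" where
  "dist_l2seq x y = norm (x - y)"

definition sgn_l2seq :: "'a l2seq \<Rightarrow> 'a l2seq" where
  "sgn_l2seq x = x /\<^sub>R norm x"

definition uniformity_l2seq :: "('a l2seq \<times> 'a l2seq) filter" where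
  "uniformity_l2seq = (INF e\<in>{0 <..}. principal {(x, y). dist x y < e})"

definition open_l2seq :: "'a l2seq set \<Rightarrow> bool" where
  "open_l2seq U \<longleftrightarrow> (\<forall>x\<in>U. \<forall>\<^sub>F (x', y) in uniformity. x' = x \<longrightarrow> y \<in> U)"

lemma summable_inner_l2nth:
  "summable (\<lambda>n. inner (l2nth (x::'a l2seq) n) (l2nth y n))"
  using summable_Re[OF l2seq_summable[of x y]] by (simp add: Re_cinner)

instance
proof
  fix x y z :: "'a l2seq" and r :: real
  show "dist x y = norm (x - y)" "sgn x = x /\<^sub>R norm x" "norm x = sqrt (inner x x)"
    by (simp_all only: dist_l2seq_def sgn_l2seq_def norm_l2seq_def)
  show "uniformity = (INF e\<in>{0 <..}. principal {(x::'a l2seq, y). dist x y < e})"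
    by (rule uniformity_l2seq_def)
  show "open U \<longleftrightarrow> (\<forall>x\<in>U. \<forall>\<^sub>F (x', y) in uniformity. x' = x \<longrightarrow> y \<in> U)" for U :: "'a l2seq set"
    by (rule open_l2seq_def)
  show "inner x y = inner y x"
    by (simp add: inner_l2seq_def inner_commute)
  show "inner (x + y) z = inner x z + inner y z"
    by (simp add: inner_l2seq_def plus_l2seq.rep_eq inner_add_left suminf_add
        summable_inner_l2nth)
  show "inner (r *\<^sub>R x) y = r * inner x y"
    by (simp add: inner_l2seq_def scaleR_l2seq.rep_eq suminf_mult summable_inner_l2nth)
  show "0 \<le> inner x x"
    by (simp add: inner_l2seq_def suminf_nonneg summable_inner_l2nth)
  have "inner x x = 0 \<longleftrightarrow> (\<forall>n. l2nth x n = 0)"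
    by (simp add: inner_l2seq_def suminf_eq_zero_iff summable_inner_l2nth)
  also have "\<dots> \<longleftrightarrow> x = 0"
    by (simp add: l2nth_inject[symmetric] zero_l2seq.rep_eq fun_eq_iff)
  finally show "inner x x = 0 \<longleftrightarrow> x = 0" .
qed

end

lemma norm_l2seq_sq: "(norm x)\<^sup>2 = (\<Sum>n. (norm (l2nth x n))\<^sup>2)"
  by (simp add: power2_norm_eq_inner inner_l2seq_def)

lemma sum_norm_l2nth_le: "(\<Sum>n<N. (norm (l2nth x n))\<^sup>2) \<le> (norm x)\<^sup>2"
  unfolding norm_l2seq_sq by (rule sum_le_suminf[OF summable_l2nth]) auto

lemma norm_l2nth_le: "norm (l2nth x n) \<le> norm x"
proof -
  have "(norm (l2nth x n))\<^sup>2 \<le> (\<Sum>k<Suc n. (norm (l2nth x k))\<^sup>2)"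
    by (rule member_le_sum) auto
  also have "\<dots> \<le> (norm x)\<^sup>2"
    by (rule sum_norm_l2nth_le)
  finally show ?thesis
    by (rule power2_le_imp_le) simp
qed

instance l2seq :: (chilbert) complete_space
proof
  fix X :: "nat \<Rightarrow> 'a l2seq"
  assume X: "Cauchy X"
  have "Cauchy (\<lambda>k. l2nth (X k) n)" for n
    unfolding Cauchy_def
  proof (intro allI impI)
    fix e :: real
    assume "e > 0"
    then obtain M where M: "\<And>j k. j \<ge> M \<Longrightarrow> k \<ge> M \<Longrightarrow> dist (X j) (X k) < e"
      using X unfolding Cauchy_def by metis
    have "dist (l2nth (X j) n) (l2nth (X k) n) \<le> dist (X j) (X k)" for j k
      using norm_l2nth_le[of "X j - X k" n] by (simp add: dist_norm minus_l2seq.rep_eq)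
    with M show "\<exists>M. \<forall>j\<ge>M. \<forall>k\<ge>M. dist (l2nth (X j) n) (l2nth (X k) n) < e"
      by (meson le_less_trans)
  qed
  then have "\<exists>l. (\<lambda>k. l2nth (X k) n) \<longlonglongrightarrow> l" for n
    using Cauchy_convergent convergent_def by blast
  then obtain L where L: "\<And>n. (\<lambda>k. l2nth (X k) n) \<longlonglongrightarrow> L n"
    by metis
  have tail: "\<exists>M. \<forall>j\<ge>M. \<forall>N. (\<Sum>n<N. (norm (l2nth (X j) n - L n))\<^sup>2) \<le> e\<^sup>2" if "e > 0" for e
  proof -
    obtain M where M: "\<And>j k. j \<ge> M \<Longrightarrow> k \<ge> M \<Longrightarrow> dist (X j) (X k) < e"
      using X \<open>e > 0\<close> unfolding Cauchy_def by metis
    have "(\<Sum>n<N. (norm (l2nth (X j) n - L n))\<^sup>2) \<le> e\<^sup>2" if "j \<ge> M" for j N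
    proof (rule LIMSEQ_le_const2)
      show "(\<lambda>k. \<Sum>n<N. (norm (l2nth (X j) n - l2nth (X k) n))\<^sup>2)
              \<longlonglongrightarrow> (\<Sum>n<N. (norm (l2nth (X j) n - L n))\<^sup>2)"
        by (intro tendsto_intros L)
      have "(\<Sum>n<N. (norm (l2nth (X j) n - l2nth (X k) n))\<^sup>2) \<le> e\<^sup>2" if "k \<ge> M" for k
      proof -
        have "(\<Sum>n<N. (norm (l2nth (X j) n - l2nth (X k) n))\<^sup>2) \<le> (norm (X j - X k))\<^sup>2"
          using sum_norm_l2nth_le[of "X j - X k" N] by (simp add: minus_l2seq.rep_eq)
        also have "\<dots> \<le> e\<^sup>2"
          using M[OF \<open>j \<ge> M\<close> \<open>k \<ge> M\<close>] by (intro power_mono) (auto simp: dist_norm)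
        finally show ?thesis .
      qed
      then show "\<exists>M. \<forall>k\<ge>M. (\<Sum>n<N. (norm (l2nth (X j) n - l2nth (X k) n))\<^sup>2) \<le> e\<^sup>2"
        by blast
    qed
    then show ?thesis
      by blast
  qed
  have diff: "summable (\<lambda>n. (norm (l2nth (X j) n - L n))\<^sup>2)"
    if "\<forall>N. (\<Sum>n<N. (norm (l2nth (X j) n - L n))\<^sup>2) \<le> e\<^sup>2" for j e
  proof (rule summableI_nonneg_bounded)
    show "(\<Sum>n<N. (norm (l2nth (X j) n - L n))\<^sup>2) \<le> e\<^sup>2" for N
      using that by blast
  qed simp
  obtain j where "\<forall>N. (\<Sum>n<N. (norm (l2nth (X j) n - L n))\<^sup>2) \<le> 1\<^sup>2"
    using tail[OF zero_less_one] by blast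
  from diff[OF this] have "summable (\<lambda>n. (norm (L n - l2nth (X j) n))\<^sup>2)"
    by (simp add: norm_minus_commute)
  from l2_summable_add[OF this summable_l2nth[of "X j"]]
  have sumL: "summable (\<lambda>n. (norm (L n))\<^sup>2)"
    by simp
  have nthL: "l2nth (Abs_l2seq L) = L"
    using sumL by (simp add: Abs_l2seq_inverse)
  have "X \<longlonglongrightarrow> Abs_l2seq L"
  proof (rule LIMSEQ_I)
    fix r :: real
    assume "r > 0"
    then obtain M where
      M: "\<And>j N. j \<ge> M \<Longrightarrow> (\<Sum>n<N. (norm (l2nth (X j) n - L n))\<^sup>2) \<le> (r / 2)\<^sup>2"
      using tail[OF half_gt_zero[OF \<open>r > 0\<close>]] by blast
    have "norm (X j - Abs_l2seq L) < r" if "j \<ge> M" for j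
    proof -
      have "(norm (X j - Abs_l2seq L))\<^sup>2 = (\<Sum>n. (norm (l2nth (X j) n - L n))\<^sup>2)"
        by (simp add: norm_l2seq_sq minus_l2seq.rep_eq nthL)
      also have "\<dots> \<le> (r / 2)\<^sup>2"
      proof (rule suminf_le_const)
        show "summable (\<lambda>n. (norm (l2nth (X j) n - L n))\<^sup>2)"
          by (rule diff, rule allI, rule M[OF that])
        show "(\<Sum>n<N. (norm (l2nth (X j) n - L n))\<^sup>2) \<le> (r / 2)\<^sup>2" for N
          by (rule M[OF that])
      qed
      finally have "norm (X j - Abs_l2seq L) \<le> r / 2"
        using \<open>r > 0\<close> by (rule power2_le_imp_le[OF _ less_imp_le[OF half_gt_zero]])
      then show ?thesis
        using \<open>r > 0\<close> by simp
    qed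
    then show "\<exists>no. \<forall>n\<ge>no. norm (X n - Abs_l2seq L) < r"
      by blast
  qed
  then show "convergent X"
    by (auto simp: convergent_def)
qed

instantiation l2seq :: (chilbert) chilbert
begin

lift_definition scaleC_l2seq :: "complex \<Rightarrow> 'a l2seq \<Rightarrow> 'a l2seq" is "\<lambda>c x n. c *\<^sub>C x n"
  by (simp add: l2_summable_scaleC)

definition cinner_l2seq :: "'a l2seq \<Rightarrow> 'a l2seq \<Rightarrow> complex" where
  "cinner_l2seq x y = (\<Sum>n. cinner (l2nth x n) (l2nth y n))"

instance
proof
  fix x y z :: "'a l2seq" and c d :: complex and r :: real
  show "c *\<^sub>C (x + y) = c *\<^sub>C x + c *\<^sub>C y"
    by transfer (simp add: scaleC_add_right)
  show "(c + d) *\<^sub>C x = c *\<^sub>C x + d *\<^sub>C x"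
    by transfer (simp add: scaleC_add_left)
  show "c *\<^sub>C (d *\<^sub>C x) = (c * d) *\<^sub>C x"
    by transfer (simp add: scaleC_scaleC)
  show "complex_of_real r *\<^sub>C x = r *\<^sub>R x"
    by transfer (simp add: scaleC_of_real)
  have "cinner x y = (\<Sum>n. cnj (cinner (l2nth y n) (l2nth x n)))"
    unfolding cinner_l2seq_def by (subst cinner_commute) (rule refl)
  also have "\<dots> = cnj (cinner y x)"
    unfolding cinner_l2seq_def
    by (rule bounded_linear.suminf[OF bounded_linear_cnj l2seq_summable, symmetric])
  finally show "cinner x y = cnj (cinner y x)" .
  show "cinner (x + y) z = cinner x z + cinner y z"
    by (simp add: cinner_l2seq_def plus_l2seq.rep_eq cinner_add_left suminf_add l2seq_summable)
  show "cinner (c *\<^sub>C x) y = c * cinner x y"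
    by (simp add: cinner_l2seq_def scaleC_l2seq.rep_eq cinner_scaleC_left suminf_mult
        l2seq_summable)
  have "Re (cinner x y) = (\<Sum>n. Re (cinner (l2nth x n) (l2nth y n)))"
    unfolding cinner_l2seq_def
    by (rule bounded_linear.suminf[OF bounded_linear_Re l2seq_summable])
  then show "Re (cinner x y) = inner x y"
    by (simp add: Re_cinner inner_l2seq_def)
qed

end


section \<open>Representations of \<open>C\<^sub>0(X)\<close> and their spectral measures\<close>

definition C0 :: "('x::topological_space \<Rightarrow> complex) set" where
  "C0 = {f. continuous_on UNIV f \<and> (\<forall>e>0. compact {x. e \<le> cmod (f x)})}"

text \<open>
  Representations are nondegenerate.  The real span suffices in the last clause, since the set
  spanned is closed under complex multiples.
\<close>

definition star_rep ::
  "'a::chilbert set \<Rightarrow> (('x::topological_space \<Rightarrow> complex) \<Rightarrow> 'a \<Rightarrow> 'a) \<Rightarrow> bool" where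
  "star_rep H \<pi> \<longleftrightarrow>
     (\<forall>f\<in>C0. bounded_op H (\<pi> f)) \<and>
     (\<forall>f\<in>C0. \<forall>g\<in>C0. \<forall>h\<in>H. \<pi> (\<lambda>x. f x + g x) h = \<pi> f h + \<pi> g h) \<and>
     (\<forall>c. \<forall>f\<in>C0. \<forall>h\<in>H. \<pi> (\<lambda>x. c * f x) h = c *\<^sub>C \<pi> f h) \<and>
     (\<forall>f\<in>C0. \<forall>g\<in>C0. \<forall>h\<in>H. \<pi> (\<lambda>x. f x * g x) h = \<pi> f (\<pi> g h)) \<and>
     (\<forall>f\<in>C0. \<forall>h\<in>H. \<pi> (\<lambda>x. cnj (f x)) h = adjoint_on H (\<pi> f) h) \<and>
     H \<subseteq> closure (span {\<pi> f h | f h. f \<in> C0 \<and> h \<in> H})"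

definition spectral_measure ::
  "'a::chilbert set \<Rightarrow> ('x::topological_space set \<Rightarrow> 'a \<Rightarrow> 'a) \<Rightarrow> bool" where
  "spectral_measure H E \<longleftrightarrow>
     (\<forall>A\<in>sets borel. is_projection H (E A)) \<and>
     (\<forall>h\<in>H. E UNIV h = h) \<and>
     (\<forall>A\<in>sets borel. \<forall>B\<in>sets borel. \<forall>h\<in>H. E (A \<inter> B) h = E A (E B h)) \<and>
     (\<forall>A :: nat \<Rightarrow> 'x set. range A \<subseteq> sets borel \<longrightarrow> disjoint_family A \<longrightarrow>
        (\<forall>h\<in>H. (\<lambda>k. E (A k) h) sums E (\<Union>k. A k) h))"

definition scalar_measure ::
  "('x::topological_space set \<Rightarrow> 'a::chilbert \<Rightarrow> 'a) \<Rightarrow> 'a \<Rightarrow> 'x measure" where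
  "scalar_measure E h = measure_of UNIV (sets borel) (\<lambda>A. ennreal (Re (cinner (E A h) h)))"

text \<open>
  \<open>E\<close> is the spectral measure \<open>E\<^sub>\<pi>\<close>: it is regular and \<open>\<pi>(f) = \<integral> f dE\<close>, the integral being
  understood weakly.  Testing against the diagonal forms \<open>\<langle>\<cdot> h, h\<rangle>\<close> determines the operator, by
  polarization.  The measures are finite, so inner regularity also gives outer regularity, and
  there is exactly one regular spectral measure (up to its values off \<open>H\<close> and off the Borel sets).
\<close>

definition spectral_measure_of_rep ::
  "'a::chilbert set \<Rightarrow> (('x::topological_space \<Rightarrow> complex) \<Rightarrow> 'a \<Rightarrow> 'a) \<Rightarrow>
     ('x set \<Rightarrow> 'a \<Rightarrow> 'a) \<Rightarrow> bool" where
  "spectral_measure_of_rep H \<pi> E \<longleftrightarrow>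
     spectral_measure H E \<and>
     (\<forall>h\<in>H. \<forall>A\<in>sets borel.
        emeasure (scalar_measure E h) A
          = (SUP K\<in>{K. K \<subseteq> A \<and> compact K}. emeasure (scalar_measure E h) K)) \<and>
     (\<forall>f\<in>C0. \<forall>h\<in>H. cinner (\<pi> f h) h = (\<integral>x. f x \<partial>scalar_measure E h))"


section \<open>Multivariable dynamical systems\<close>

text \<open>
  The space \<open>X\<close> is a type of class \<open>t2_space\<close>.  On a locally compact Hausdorff space a continuous
  map is proper in the sense of \<^const>\<open>proper_map\<close> iff preimages of compact sets are compact.
\<close>

definition dynamical_system :: "nat \<Rightarrow> (nat \<Rightarrow> 'x::t2_space \<Rightarrow> 'x) \<Rightarrow> bool" where
  "dynamical_system n \<sigma> \<longleftrightarrow>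
     locally_compact_space (euclidean :: 'x topology) \<and> 1 \<le> n \<and>
     (\<forall>i\<in>{1..n}. continuous_on UNIV (\<sigma> i) \<and> proper_map euclidean euclidean (\<sigma> i))"

definition isometric_covariant_rep ::
  "nat \<Rightarrow> (nat \<Rightarrow> 'x::t2_space \<Rightarrow> 'x) \<Rightarrow> 'a::chilbert set \<Rightarrow>
     (('x \<Rightarrow> complex) \<Rightarrow> 'a \<Rightarrow> 'a) \<Rightarrow> (nat \<Rightarrow> 'a \<Rightarrow> 'a) \<Rightarrow> bool" where
  "isometric_covariant_rep n \<sigma> H \<pi> S \<longleftrightarrow>
     star_rep H \<pi> \<and>
     (\<forall>i\<in>{1..n}. isometry H H (S i)) \<and>
     (\<forall>i\<in>{1..n}. \<forall>f\<in>C0. \<forall>h\<in>H. \<pi> f (S i h) = S i (\<pi> (f \<circ> \<sigma> i) h))"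

definition full_isometric_rep ::
  "nat \<Rightarrow> (nat \<Rightarrow> 'x::t2_space \<Rightarrow> 'x) \<Rightarrow> 'a::chilbert set \<Rightarrow>
     (('x \<Rightarrow> complex) \<Rightarrow> 'a \<Rightarrow> 'a) \<Rightarrow> (nat \<Rightarrow> 'a \<Rightarrow> 'a) \<Rightarrow> bool" where
  "full_isometric_rep n \<sigma> H \<pi> S \<longleftrightarrow>
     isometric_covariant_rep n \<sigma> H \<pi> S \<and>
     (\<exists>E. spectral_measure_of_rep H \<pi> E \<and>
        (\<forall>i\<in>{1..n}. \<forall>h\<in>H. S i (adjoint_on H (S i) h) = E (range (\<sigma> i)) h))"

end

theory Submission
  imports Defs
begin

text \<open>
  The dilation only has to enlarge the range of \<open>S\<^sub>i\<close> to the spectral subspace of \<open>\<sigma>\<^sub>i(X)\<close>, without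
  spoiling the isometry or the covariance relation.  What \<open>S\<^sub>i\<close> leaves uncovered is a subspace \<open>M\<close>
  reducing \<open>\<pi>\<close> on which \<open>\<pi>\<close> lives on \<open>\<sigma>\<^sub>i(X)\<close>.  If there is a representation \<open>\<pi>'\<close> on the same space
  \<open>M\<close> with \<open>\<pi>'(f \<circ> \<sigma>\<^sub>i) = \<pi>(f)\<close>, a \<^emph>\<open>lift\<close> of \<open>\<pi>\<close> along \<open>\<sigma>\<^sub>i\<close>, then one adds a copy of \<open>M\<close> carrying \<open>\<pi>'\<close>,
  and \<open>T\<^sub>i\<close> maps this copy identically onto \<open>M\<close>.  The other \<open>T\<^sub>j\<close> have to act on the new summand too:
  they push it forward to a further summand with the representation \<open>f \<mapsto> \<pi>'(f \<circ> \<sigma>\<^sub>j)\<close>.  New summands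
  are again uncovered by some of the isometries, so lifting and pushing forward go on forever.  The
  summands that arise are indexed by the reduced words of the free group on \<open>n\<close> generators whose last
  letter is a lift, together with the empty word for \<open>H\<close> itself, and away from the root \<open>H\<close> the
  isometry \<open>T\<^sub>i\<close> is left multiplication by the \<open>i\<close>-th generator.  Each summand is a subspace of \<open>H\<close>, so
  the orthogonal sum is found among the square-summable sequences in \<open>H\<close>.  Since \<open>H\<close> is invariant
  under every \<open>T\<^sub>i\<close>, the dilation is even an extension.

  Lifts exist by an extension argument for homomorphisms into complete Boolean algebras, in place of
  a measurable section of \<open>\<sigma>\<^sub>i\<close> (\<open>exists_lift\<close>).  To a set \<open>A \<subseteq> X\<close> one assigns the space of all vectors
  supported on the closure of \<open>\<sigma>\<^sub>i(A)\<close>.  This assignment is finitely subadditive with values in a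
  complete Boolean algebra of projections, and by Zorn's lemma there is a minimal subadditive one below
  it.  A minimal one cannot be cut along any set and is therefore a Boolean homomorphism on all
  subsets of \<open>X\<close> (\<open>exists_boolean_content\<close>).  Integrating bounded functions against it is the lift.

  Fullness refers to the spectral measure, whose existence has to be proved.  Let \<open>R(C)\<close> be the space
  of the vectors killed by \<open>\<pi>(f)\<close> for all \<open>f\<close> vanishing on \<open>C\<close>.  Put \<open>E(A)\<close> equal to the projection onto
  the closed union of the \<open>R(K)\<close> with \<open>K \<subseteq> A\<close> compact.  This is an inner content defined on all
  sets, and \<open>E(A) + E(-A) = 1\<close> singles out, as in Caratheodory's construction, a \<open>\<sigma>\<close>-algebra that
  contains the closed sets and on which \<open>E\<close> is countably additive (\<open>spectral_measure_of_rep_E\<close>).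
  In particular the range of \<open>E(C)\<close> is \<open>R(C)\<close> for closed \<open>C\<close>, and fullness turns into the algebraic
  statement that \<open>T\<^sub>i\<close> maps onto \<open>R(\<sigma>\<^sub>i(X))\<close> (\<open>T_image\<close>).
\<close>

section \<open>Complex inner products and orthogonal projections\<close>

lemma cinner_add_right: "cinner x (y + z) = cinner x y + cinner x (z::'a::chilbert)"
  by (metis cinner_add_left cinner_commute complex_cnj_add)

lemma cinner_zero_left [simp]: "cinner 0 (x::'a::chilbert) = 0"
  using cinner_add_left[of 0 0 x] by simp

lemma cinner_zero_right [simp]: "cinner (x::'a::chilbert) 0 = 0"
  using cinner_add_right[of x 0 0] by simp

lemma scaleC_minus1: "(-1) *\<^sub>C (x::'a::chilbert) = - x"
  using scaleC_of_real[of "-1" x] by simp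

lemma scaleC_one [simp]: "1 *\<^sub>C (x::'a::chilbert) = x"
  using scaleC_of_real[of 1 x] by simp

lemma scaleC_zero_left [simp]: "0 *\<^sub>C (x::'a::chilbert) = 0"
  using scaleC_of_real[of 0 x] by simp

lemma scaleC_zero_right [simp]: "c *\<^sub>C (0::'a::chilbert) = 0"
  using scaleC_add_right[of c 0 "0::'a"] by simp

lemma cinner_minus_left: "cinner (- x) y = - cinner (x::'a::chilbert) y"
  using cinner_scaleC_left[of "-1" x y] by (simp add: scaleC_minus1)

lemma cinner_minus_right: "cinner x (- y) = - cinner (x::'a::chilbert) y"
  using cinner_scaleC_right[of x "-1" y] by (simp add: scaleC_minus1)

lemma cinner_diff_left: "cinner (x - y) z = cinner x z - cinner y (z::'a::chilbert)"
  using cinner_add_left[of x "- y" z] by (simp add: cinner_minus_left)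

lemma cinner_diff_right: "cinner x (y - z) = cinner x y - cinner x (z::'a::chilbert)"
  using cinner_add_right[of x y "- z"] by (simp add: cinner_minus_right)

lemma scaleC_minus_right: "c *\<^sub>C (- x) = - (c *\<^sub>C (x::'a::chilbert))"
  using scaleC_add_right[of c x "- x"] by (simp add: eq_neg_iff_add_eq_0 add.commute)

lemma scaleC_diff_right: "c *\<^sub>C (x - y) = c *\<^sub>C x - c *\<^sub>C (y::'a::chilbert)"
  using scaleC_add_right[of c x "- y"] by (simp add: scaleC_minus_right)

lemma scaleC_diff_left: "(c - d) *\<^sub>C x = c *\<^sub>C x - d *\<^sub>C (x::'a::chilbert)"
proof -
  have "(c - d) *\<^sub>C x + d *\<^sub>C x = c *\<^sub>C x"
    by (simp flip: scaleC_add_left)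
  then show ?thesis by (simp add: eq_diff_eq)
qed

lemma scaleC_sum_right: "c *\<^sub>C (\<Sum>i\<in>I. f i) = (\<Sum>i\<in>I. c *\<^sub>C (f i :: 'a::chilbert))"
  by (induction I rule: infinite_finite_induct) (auto simp: scaleC_add_right)

lemma cinner_sum_left: "cinner (\<Sum>i\<in>I. f i) (y::'a::chilbert) = (\<Sum>i\<in>I. cinner (f i) y)"
  by (induction I rule: infinite_finite_induct) (auto simp: cinner_add_left)

lemma cinner_sum_right: "cinner (y::'a::chilbert) (\<Sum>i\<in>I. f i) = (\<Sum>i\<in>I. cinner y (f i))"
  by (induction I rule: infinite_finite_induct) (auto simp: cinner_add_right)

lemma cinner_self_eq_0 [simp]: "cinner x x = 0 \<longleftrightarrow> (x::'a::chilbert) = 0"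
  by (simp add: cinner_self)

lemma cinner_eq_0_sym: "cinner x y = 0 \<longleftrightarrow> cinner y (x::'a::chilbert) = 0"
  by (metis cinner_commute complex_cnj_zero_iff)

lemma bounded_linear_cinner_left: "bounded_linear (\<lambda>x. cinner x (y::'a::chilbert))"
proof (rule bounded_linear_intro[where K = "norm y"])
  fix r x
  show "cinner (r *\<^sub>R x) y = r *\<^sub>R cinner x y"
    using cinner_scaleC_left[of "complex_of_real r" x y]
    by (simp add: scaleC_of_real scaleR_conv_of_real)
qed (auto simp: cinner_add_left norm_cinner_le)

lemma bounded_linear_cinner_right: "bounded_linear (\<lambda>x. cinner (y::'a::chilbert) x)"
proof (rule bounded_linear_intro[where K = "norm y"])
  fix r x
  show "cinner y (r *\<^sub>R x) = r *\<^sub>R cinner y x"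
    using cinner_scaleC_right[of y "complex_of_real r" x]
    by (simp add: scaleC_of_real scaleR_conv_of_real)
  show "cmod (cinner y x) \<le> norm x * norm y"
    using norm_cinner_le[of y x] by (simp add: mult.commute)
qed (auto simp: cinner_add_right)

lemma bounded_linear_scaleC: "bounded_linear (\<lambda>x::'a::chilbert. c *\<^sub>C x)"
proof (rule bounded_linear_intro[where K = "cmod c"])
  fix r and x :: 'a
  show "c *\<^sub>C (r *\<^sub>R x) = r *\<^sub>R (c *\<^sub>C x)"
    by (simp only: scaleC_of_real[symmetric] scaleC_scaleC mult.commute)
qed (auto simp: scaleC_add_right norm_scaleC)

lemmas tendsto_cinner_left = bounded_linear.tendsto[OF bounded_linear_cinner_left]
lemmas tendsto_cinner_right = bounded_linear.tendsto[OF bounded_linear_cinner_right]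
lemmas tendsto_scaleC = bounded_linear.tendsto[OF bounded_linear_scaleC]

lemma norm_add_orthogonal_sq:
  assumes "cinner x (y::'a::chilbert) = 0"
  shows "(norm (x + y))\<^sup>2 = (norm x)\<^sup>2 + (norm y)\<^sup>2"
proof -
  have "inner x y = 0" using assms Re_cinner[of x y] by simp
  then show ?thesis
    by (simp add: power2_norm_eq_inner inner_add_left inner_add_right inner_commute)
qed

lemma norm_sum_orthogonal_sq:
  assumes "finite I" and "\<And>i j. i \<in> I \<Longrightarrow> j \<in> I \<Longrightarrow> i \<noteq> j \<Longrightarrow> cinner (f i) (f j :: 'a::chilbert) = 0"
  shows "(norm (\<Sum>i\<in>I. f i))\<^sup>2 = (\<Sum>i\<in>I. (norm (f i))\<^sup>2)"
  using assms
proof (induction I rule: finite_induct)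
  case (insert i I)
  have "cinner (f i) (\<Sum>i\<in>I. f i) = 0"
    unfolding cinner_sum_right using insert by (intro sum.neutral) auto
  then show ?case
    using insert by (simp add: norm_add_orthogonal_sq)
qed simp

lemma closed_csubspaceD:
  assumes "closed_csubspace M"
  shows "closed M" "0 \<in> M" "\<And>x y. x \<in> M \<Longrightarrow> y \<in> M \<Longrightarrow> x + y \<in> M"
    "\<And>c x. x \<in> M \<Longrightarrow> c *\<^sub>C x \<in> M" "\<And>r x. x \<in> M \<Longrightarrow> r *\<^sub>R x \<in> M"
    "\<And>x. x \<in> M \<Longrightarrow> - x \<in> M"
    "\<And>x y. x \<in> M \<Longrightarrow> y \<in> M \<Longrightarrow> x - y \<in> M"
proof -
  show "closed M" "0 \<in> M" and add: "\<And>x y. x \<in> M \<Longrightarrow> y \<in> M \<Longrightarrow> x + y \<in> M"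
    and sc: "\<And>c x. x \<in> M \<Longrightarrow> c *\<^sub>C x \<in> M"
    using assms by (auto simp: closed_csubspace_def)
  show "\<And>r x. x \<in> M \<Longrightarrow> r *\<^sub>R x \<in> M"
    using sc by (metis scaleC_of_real)
  show neg: "\<And>x. x \<in> M \<Longrightarrow> - x \<in> M"
    using sc by (metis scaleC_minus1)
  show "\<And>x y. x \<in> M \<Longrightarrow> y \<in> M \<Longrightarrow> x - y \<in> M"
    using add neg by (metis add_uminus_conv_diff)
qed

lemma closed_csubspace_sum:
  assumes "closed_csubspace M" "\<And>i. i \<in> I \<Longrightarrow> f i \<in> M"
  shows "(\<Sum>i\<in>I. f i) \<in> M"
  using assms(2) by (induction I rule: infinite_finite_induct)
    (auto intro: closed_csubspaceD[OF assms(1)])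

lemma closed_csubspace_limit:
  assumes "closed_csubspace M" "\<And>k. f k \<in> M" "f \<longlonglongrightarrow> l"
  shows "l \<in> M"
  using closed_sequentially closed_csubspaceD(1)[OF assms(1)] assms(2,3) by blast

lemma closed_csubspace_singleton_zero: "closed_csubspace {0}"
  by (auto simp: closed_csubspace_def)

lemma closed_csubspace_Inter:
  assumes "\<And>M. M \<in> \<M> \<Longrightarrow> closed_csubspace M"
  shows "closed_csubspace (\<Inter>\<M>)"
  using assms unfolding closed_csubspace_def by (auto intro!: closed_Inter)

lemma closed_csubspace_Int:
  "closed_csubspace M \<Longrightarrow> closed_csubspace N \<Longrightarrow> closed_csubspace (M \<inter> N)"
  using closed_csubspace_Inter[of "{M, N}"] by auto

text \<open>
  A minimizing sequence for the distance to \<open>M\<close> is Cauchy by the parallelogram law.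
\<close>
lemma exists_closest_point:
  assumes M: "closed_csubspace (M::'a::chilbert set)"
  shows "\<exists>y\<in>M. \<forall>z\<in>M. norm (x - y) \<le> norm (x - z)"
proof -
  define d where "d = (INF z\<in>M. (norm (x - z))\<^sup>2)"
  have ne: "M \<noteq> {}" using closed_csubspaceD(2)[OF M] by auto
  have bdd: "bdd_below ((\<lambda>z. (norm (x - z))\<^sup>2) ` M)" by (rule bdd_belowI[of _ 0]) auto
  have d_le: "d \<le> (norm (x - z))\<^sup>2" if "z \<in> M" for z
    unfolding d_def using bdd that by (rule cINF_lower)
  have "\<exists>z\<in>M. (norm (x - z))\<^sup>2 < d + inverse (real (Suc k))" for k
  proof -
    have "d < d + inverse (real (Suc k))" by simp
    then show ?thesis
      unfolding d_def by (rule cINF_less_iff[OF ne bdd, THEN iffD1])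
  qed
  then obtain y where yM: "\<And>k. y k \<in> M" and
    y: "\<And>k. (norm (x - y k))\<^sup>2 < d + inverse (real (Suc k))" by metis
  have par: "(norm (y j - y k))\<^sup>2 \<le> 2 * inverse (real (Suc j)) + 2 * inverse (real (Suc k))" for j k
  proof -
    define m where "m = (1/2) *\<^sub>R (y j + y k)"
    have "m \<in> M" unfolding m_def using closed_csubspaceD[OF M] yM by auto
    have "(norm (y j - y k))\<^sup>2 + 4 * (norm (x - m))\<^sup>2
        = 2 * (norm (x - y j))\<^sup>2 + 2 * (norm (x - y k))\<^sup>2"
      unfolding m_def power2_norm_eq_inner
      by (simp add: inner_diff_left inner_diff_right inner_add_left inner_add_right
          inner_commute algebra_simps)
    then show ?thesis
      using d_le[OF \<open>m \<in> M\<close>] y[of j] y[of k] by linarith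
  qed
  have "Cauchy y"
  proof (rule metric_CauchyI)
    fix e :: real assume "e > 0"
    then have "e\<^sup>2 / 4 > 0" by simp
    then obtain N where N: "inverse (real (Suc N)) < e\<^sup>2 / 4" using reals_Archimedean by blast
    have "dist (y j) (y k) < e" if "j \<ge> N" "k \<ge> N" for j k
    proof -
      have "inverse (real (Suc j)) \<le> inverse (real (Suc N))"
        "inverse (real (Suc k)) \<le> inverse (real (Suc N))" using that by (auto simp: field_simps)
      then have "(norm (y j - y k))\<^sup>2 < e\<^sup>2" using par[of j k] N by linarith
      then show ?thesis using \<open>e > 0\<close> by (simp add: dist_norm power2_less_imp_less)
    qed
    then show "\<exists>N. \<forall>m\<ge>N. \<forall>n\<ge>N. dist (y m) (y n) < e" by blast
  qed
  then obtain l where l: "y \<longlonglongrightarrow> l" using Cauchy_convergent convergent_def by blast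
  have lM: "l \<in> M" using closed_csubspace_limit[OF M yM l] .
  have "(\<lambda>k. (norm (x - y k))\<^sup>2) \<longlonglongrightarrow> (norm (x - l))\<^sup>2" by (intro tendsto_intros l)
  moreover have "(\<lambda>k. d + inverse (real (Suc k))) \<longlonglongrightarrow> d + 0"
    by (intro tendsto_intros LIMSEQ_inverse_real_of_nat)
  ultimately have "(norm (x - l))\<^sup>2 \<le> d + 0"
    by (rule LIMSEQ_le) (intro exI[of _ 0] allI impI less_imp_le y)
  then have "norm (x - l) \<le> norm (x - z)" if "z \<in> M" for z
    by (rule power2_le_imp_le[OF order_trans]) (use d_le[OF that] in auto)
  then show ?thesis using lM by blast
qed

text \<open>
  Minimality in the real direction \<open>z\<close> gives the real part of orthogonality, and in the direction
  \<open>\<i> z\<close> the imaginary part.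
\<close>
lemma exists_proj:
  assumes M: "closed_csubspace (M::'a::chilbert set)"
  shows "\<exists>y\<in>M. \<forall>z\<in>M. cinner (x - y) z = 0"
proof -
  obtain y where y: "y \<in> M" and min: "\<And>z. z \<in> M \<Longrightarrow> norm (x - y) \<le> norm (x - z)"
    using exists_closest_point[OF M] by blast
  have re: "inner (x - y) z = 0" if "z \<in> M" for z
  proof (cases "z = 0")
    case False
    define t where "t = inner (x - y) z / inner z z"
    have "y + t *\<^sub>R z \<in> M" using that y closed_csubspaceD[OF M] by auto
    then have "(norm (x - y))\<^sup>2 \<le> (norm (x - (y + t *\<^sub>R z)))\<^sup>2" using min by (intro power_mono) auto
    also have "\<dots> = (norm (x - y))\<^sup>2 - 2 * t * inner (x - y) z + t * t * inner z z"
      unfolding power2_norm_eq_inner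
      by (simp add: inner_diff_left inner_diff_right inner_add_left inner_add_right
          inner_commute algebra_simps)
    also have "\<dots> = (norm (x - y))\<^sup>2 - (inner (x - y) z)\<^sup>2 / inner z z"
      unfolding t_def using False by (simp add: field_simps power2_eq_square)
    finally have "(inner (x - y) z)\<^sup>2 / inner z z \<le> 0" by simp
    then show ?thesis using False
      by (smt (verit, best) divide_nonneg_pos divide_eq_0_iff inner_gt_zero_iff zero_eq_power2 zero_le_power2)
  qed simp
  have "cinner (x - y) z = 0" if "z \<in> M" for z
  proof (rule complex_eqI)
    show "Re (cinner (x - y) z) = Re 0" using re[OF that] by (simp add: Re_cinner)
    have "\<i> *\<^sub>C z \<in> M" using that closed_csubspaceD[OF M] by auto
    from re[OF this] have "Re (cinner (x - y) (\<i> *\<^sub>C z)) = 0" by (simp add: Re_cinner)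
    then show "Im (cinner (x - y) z) = Im 0" by (simp add: cinner_scaleC_right)
  qed
  with y show ?thesis by blast
qed

lemma proj_unique:
  assumes M: "closed_csubspace (M::'a::chilbert set)"
    and "y \<in> M" "\<And>z. z \<in> M \<Longrightarrow> cinner (x - y) z = 0"
  shows "proj_onto M x = y"
  unfolding proj_onto_def
proof (rule the_equality)
  fix y' assume y': "y' \<in> M \<and> (\<forall>z\<in>M. cinner (x - y') z = 0)"
  have d: "y - y' \<in> M" using y' assms closed_csubspaceD[OF M] by auto
  have "cinner (y - y') (y - y') = cinner (x - y') (y - y') - cinner (x - y) (y - y')"
    by (simp flip: cinner_diff_left)
  also have "\<dots> = 0" using d y' assms(3)[OF d] by auto
  finally show "y' = y" by simp
qed (use assms in auto)

lemma
  assumes M: "closed_csubspace (M::'a::chilbert set)"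
  shows proj_in: "proj_onto M x \<in> M"
    and proj_orth: "z \<in> M \<Longrightarrow> cinner (x - proj_onto M x) z = 0"
proof -
  obtain y where y: "y \<in> M" "\<And>z. z \<in> M \<Longrightarrow> cinner (x - y) z = 0"
    using exists_proj[OF M] by blast
  have "proj_onto M x = y" using proj_unique[OF M y] .
  then show "proj_onto M x \<in> M" "z \<in> M \<Longrightarrow> cinner (x - proj_onto M x) z = 0"
    using y by auto
qed

lemma proj_orth':
  assumes "closed_csubspace (M::'a::chilbert set)" "z \<in> M"
  shows "cinner z (x - proj_onto M x) = 0"
  using proj_orth[OF assms] cinner_eq_0_sym by blast

lemma proj_id: "closed_csubspace M \<Longrightarrow> x \<in> M \<Longrightarrow> proj_onto M x = x"
  by (rule proj_unique) auto

lemma proj_zero: "closed_csubspace M \<Longrightarrow> proj_onto M 0 = 0"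
  by (simp add: proj_id closed_csubspaceD)

lemma proj_eq_0:
  assumes "closed_csubspace M" "\<And>z. z \<in> M \<Longrightarrow> cinner x z = 0"
  shows "proj_onto M x = 0"
  by (rule proj_unique) (use assms closed_csubspaceD[OF assms(1)] in auto)

lemma proj_add:
  assumes M: "closed_csubspace M"
  shows "proj_onto M (x + y) = proj_onto M x + proj_onto M y"
proof (rule proj_unique[OF M])
  show "proj_onto M x + proj_onto M y \<in> M" using proj_in[OF M] closed_csubspaceD[OF M] by auto
  fix z assume "z \<in> M"
  have "x + y - (proj_onto M x + proj_onto M y) = (x - proj_onto M x) + (y - proj_onto M y)" by simp
  then show "cinner (x + y - (proj_onto M x + proj_onto M y)) z = 0"
    using proj_orth[OF M \<open>z \<in> M\<close>] by (simp only: cinner_add_left add_0)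
qed

lemma proj_scaleC:
  assumes M: "closed_csubspace M"
  shows "proj_onto M (c *\<^sub>C x) = c *\<^sub>C proj_onto M x"
proof (rule proj_unique[OF M])
  show "c *\<^sub>C proj_onto M x \<in> M" using proj_in[OF M] closed_csubspaceD[OF M] by auto
  fix z assume "z \<in> M"
  then show "cinner (c *\<^sub>C x - c *\<^sub>C proj_onto M x) z = 0"
    using proj_orth[OF M \<open>z \<in> M\<close>] by (simp add: cinner_scaleC_left flip: scaleC_diff_right)
qed

lemma proj_diff:
  assumes M: "closed_csubspace M"
  shows "proj_onto M (x - y) = proj_onto M x - proj_onto M y"
  using proj_add[OF M, of "x - y" y] by (simp add: eq_diff_eq)

lemma proj_sum:
  assumes M: "closed_csubspace M"
  shows "proj_onto M (\<Sum>i\<in>I. f i) = (\<Sum>i\<in>I. proj_onto M (f i))"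
  by (induction I rule: infinite_finite_induct) (auto simp: proj_add[OF M] proj_zero[OF M])

lemma proj_cinner:
  assumes M: "closed_csubspace M"
  shows "cinner (proj_onto M x) y = cinner (proj_onto M x) (proj_onto M y)"
    and "cinner x (proj_onto M y) = cinner (proj_onto M x) (proj_onto M y)"
  using proj_orth[OF M proj_in[OF M], of x y] proj_orth'[OF M proj_in[OF M], of x y]
  by (simp_all add: cinner_diff_left cinner_diff_right)

lemma proj_sym:
  "closed_csubspace M \<Longrightarrow> cinner (proj_onto M x) y = cinner x (proj_onto M y)"
  by (metis proj_cinner)

lemma proj_norm_sq:
  assumes M: "closed_csubspace M"
  shows "(norm x)\<^sup>2 = (norm (proj_onto M x))\<^sup>2 + (norm (x - proj_onto M x))\<^sup>2"
  using norm_add_orthogonal_sq[OF proj_orth'[OF M proj_in[OF M]], of x x] by simp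

lemma proj_norm_le: "closed_csubspace M \<Longrightarrow> norm (proj_onto M x) \<le> norm x"
  by (rule power2_le_imp_le, subst (2) proj_norm_sq) auto

lemma proj_closest:
  assumes M: "closed_csubspace M" "z \<in> M"
  shows "norm (x - proj_onto M x) \<le> norm (x - z)"
proof -
  have "proj_onto M (x - z) = proj_onto M x - z" using assms by (simp add: proj_diff proj_id)
  then have "x - z - proj_onto M (x - z) = x - proj_onto M x" by simp
  then have "norm (x - proj_onto M x) = norm (x - z - proj_onto M (x - z))" by (simp only:)
  also have "\<dots> \<le> norm (x - z)"
    by (rule power2_le_imp_le, subst (2) proj_norm_sq[OF M(1)]) auto
  finally show ?thesis .
qed

lemma proj_of_subset:
  assumes "closed_csubspace M" "closed_csubspace N" "N \<subseteq> M"
  shows "proj_onto N (proj_onto M x) = proj_onto N x"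
proof -
  have "proj_onto N (x - proj_onto M x) = 0"
    using assms(3) proj_orth[OF assms(1)] by (intro proj_eq_0[OF assms(2)]) auto
  then show ?thesis by (simp add: proj_diff[OF assms(2)])
qed

text \<open>
  Invariance of \<open>M\<close> under the self-adjoint projection onto \<open>N\<close> means \<open>P\<^sub>N P\<^sub>M = P\<^sub>M P\<^sub>N P\<^sub>M\<close>, and the
  right-hand side is self-adjoint.
\<close>
lemma proj_commute:
  assumes M: "closed_csubspace M" and N: "closed_csubspace N" and MN: "proj_onto N ` M \<subseteq> M"
  shows "proj_onto M (proj_onto N x) = proj_onto N (proj_onto M x)"
proof -
  let ?P = "proj_onto M" and ?Q = "proj_onto N"
  have 1: "?P (?Q (?P u)) = ?Q (?P u)" for u
    using MN proj_in[OF M] by (intro proj_id[OF M]) auto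
  have "cinner (?P (?Q x)) y = cinner (?Q (?P x)) y" for y
  proof -
    have "cinner (?P (?Q x)) y = cinner x (?P (?Q (?P y)))"
      by (simp add: proj_sym[OF M] proj_sym[OF N] 1)
    also have "\<dots> = cinner (?Q (?P x)) y"
      using 1[of x] by (simp flip: proj_sym[OF M] proj_sym[OF N])
    finally show ?thesis .
  qed
  then have "cinner (?P (?Q x) - ?Q (?P x)) y = 0" for y by (simp add: cinner_diff_left)
  then show ?thesis by (metis cinner_self_eq_0 right_minus_eq)
qed

lemma proj_Int:
  assumes M: "closed_csubspace M" and N: "closed_csubspace N" and MN: "proj_onto N ` M \<subseteq> M"
  shows "proj_onto (M \<inter> N) x = proj_onto N (proj_onto M x)"
proof (rule proj_unique[OF closed_csubspace_Int[OF M N]])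
  show "proj_onto N (proj_onto M x) \<in> M \<inter> N"
    using MN proj_in[OF M] proj_in[OF N] by auto
  fix z assume z: "z \<in> M \<inter> N"
  then show "cinner (x - proj_onto N (proj_onto M x)) z = 0"
    using proj_sym[OF M, of x z] proj_sym[OF N, of "proj_onto M x" z] proj_id[OF M, of z] proj_id[OF N, of z]
    by (simp add: cinner_diff_left)
qed

text \<open>
  The squared norms of the projections of \<open>x\<close> decrease, and their differences are the squared
  distances between the projections; hence these form a Cauchy sequence.
\<close>
lemma decreasing_proj_tendsto:
  assumes M: "\<And>k. closed_csubspace (M k)" and dec: "\<And>k. M (Suc k) \<subseteq> M k"
  shows "(\<lambda>k. proj_onto (M k) x) \<longlonglongrightarrow> proj_onto (\<Inter>k. M k) x"
proof -
  let ?p = "\<lambda>k. proj_onto (M k) x"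
  have mono: "M k \<subseteq> M j" if "j \<le> k" for j k
    using lift_Suc_antimono_le[of M, OF dec that] .
  have sq: "(norm (?p j - ?p k))\<^sup>2 = (norm (?p j))\<^sup>2 - (norm (?p k))\<^sup>2" if "j \<le> k" for j k
    using proj_norm_sq[OF M[of k], of "?p j"] proj_of_subset[OF M[of j] M[of k] mono[OF that]] by simp
  have "decseq (\<lambda>k. (norm (?p k))\<^sup>2)"
    unfolding decseq_def using sq by (metis diff_ge_0_iff_ge zero_le_power2)
  then have "Cauchy (\<lambda>k. (norm (?p k))\<^sup>2)"
    by (intro convergent_Cauchy)
      (metis decseq_convergent convergent_def zero_le_power2)
  have "Cauchy ?p"
  proof (rule metric_CauchyI)
    fix e :: real assume e: "e > 0"
    then obtain N where N: "\<And>j k. j \<ge> N \<Longrightarrow> k \<ge> N \<Longrightarrow> dist ((norm (?p j))\<^sup>2) ((norm (?p k))\<^sup>2) < e\<^sup>2"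
      using \<open>Cauchy (\<lambda>k. (norm (?p k))\<^sup>2)\<close> unfolding Cauchy_def by (metis zero_less_power)
    have *: "dist (?p j) (?p k) < e" if "j \<ge> N" "k \<ge> j" for j k
    proof -
      have "(norm (?p j - ?p k))\<^sup>2 < e\<^sup>2"
        using sq[OF \<open>k \<ge> j\<close>] N[of j k] that by (simp add: dist_real_def)
      then show ?thesis using e by (simp add: dist_norm power2_less_imp_less)
    qed
    then have "dist (?p j) (?p k) < e" if "j \<ge> N" "k \<ge> N" for j k
      using that by (metis dist_commute nle_le)
    then show "\<exists>N. \<forall>m\<ge>N. \<forall>n\<ge>N. dist (?p m) (?p n) < e" by blast
  qed
  then obtain l where l: "?p \<longlonglongrightarrow> l" using Cauchy_convergent convergent_def by blast
  have "l \<in> M j" for j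
  proof (rule closed_csubspace_limit[OF M])
    show "?p (k + j) \<in> M j" for k using mono[of j "k + j"] proj_in[OF M, of "k + j"] by auto
    show "(\<lambda>k. ?p (k + j)) \<longlonglongrightarrow> l" using l by (rule LIMSEQ_ignore_initial_segment)
  qed
  moreover have "cinner (x - l) z = 0" if "z \<in> (\<Inter>k. M k)" for z
  proof -
    have "(\<lambda>k. cinner (x - ?p k) z) \<longlonglongrightarrow> cinner (x - l) z"
      by (intro tendsto_cinner_left tendsto_intros l)
    moreover have "cinner (x - ?p k) z = 0" for k using that proj_orth[OF M] by auto
    ultimately show ?thesis by (simp add: LIMSEQ_const_iff)
  qed
  moreover have "closed_csubspace (\<Inter>k. M k)" using M by (intro closed_csubspace_Inter) auto
  ultimately have "proj_onto (\<Inter>k. M k) x = l" by (intro proj_unique) auto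
  with l show ?thesis by simp
qed

lemma closed_csubspace_ortho_diff:
  assumes "closed_csubspace M"
  shows "closed_csubspace (ortho_diff M N)"
proof -
  have "closed {x. cinner x y = 0}" for y :: 'a
    by (intro closed_Collect_eq continuous_intros
        bounded_linear.continuous_on[OF bounded_linear_cinner_left])
  then have "closed (\<Inter>y\<in>N. {x. cinner x y = 0})" by auto
  then have "closed (M \<inter> (\<Inter>y\<in>N. {x. cinner x y = 0}))"
    using closed_csubspaceD(1)[OF assms] by blast
  moreover have "M \<inter> (\<Inter>y\<in>N. {x. cinner x y = 0}) = ortho_diff M N"
    by (auto simp: ortho_diff_def)
  ultimately show ?thesis
    using closed_csubspaceD[OF assms]
    by (auto simp: closed_csubspace_def ortho_diff_def cinner_add_left cinner_scaleC_left)
qed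

text \<open>
  The vector is a multiple of any nonzero vector orthogonal to the kernel of the functional.
\<close>
lemma riesz_representation:
  assumes H: "closed_csubspace (H::'a::chilbert set)"
    and add: "\<And>x y. x \<in> H \<Longrightarrow> y \<in> H \<Longrightarrow> \<phi> (x + y) = \<phi> x + \<phi> y"
    and scale: "\<And>c x. x \<in> H \<Longrightarrow> \<phi> (c *\<^sub>C x) = c * \<phi> x"
    and bdd: "\<And>x. x \<in> H \<Longrightarrow> cmod (\<phi> x) \<le> B * norm x"
  shows "\<exists>z\<in>H. \<forall>x\<in>H. \<phi> x = cinner x z"
proof (cases "\<forall>x\<in>H. \<phi> x = 0")
  case True
  then show ?thesis using closed_csubspaceD(2)[OF H] by (intro bexI[of _ 0]) auto
next
  case False
  then obtain a where a: "a \<in> H" "\<phi> a \<noteq> 0" by blast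
  have diff: "\<phi> (x - y) = \<phi> x - \<phi> y" if "x \<in> H" "y \<in> H" for x y
    using add[of "x - y" y] that closed_csubspaceD(7)[OF H] by simp
  define N where "N = {x\<in>H. \<phi> x = 0}"
  have N: "closed_csubspace N"
  proof -
    have "closed N"
      unfolding closed_sequential_limits
    proof (intro allI impI, goal_cases)
      case (1 f l)
      then have lH: "l \<in> H" and fN: "\<And>k. f k \<in> N"
        using closed_csubspace_limit[OF H, of f l] by (auto simp: N_def)
      have "(\<lambda>k. B * norm (l - f k)) \<longlonglongrightarrow> B * norm (l - l)" using 1 by (intro tendsto_intros) auto
      moreover have "cmod (\<phi> l) \<le> B * norm (l - f k)" for k
        using bdd[of "l - f k"] fN[of k] lH closed_csubspaceD(7)[OF H] by (auto simp: N_def diff)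
      ultimately have "cmod (\<phi> l) \<le> B * norm (l - l)" by (intro LIMSEQ_le_const) auto
      then show ?case using lH by (simp add: N_def)
    qed
    moreover have "\<phi> 0 = 0" using diff[of 0 0] closed_csubspaceD[OF H] by simp
    ultimately show ?thesis
      using closed_csubspaceD[OF H] by (auto simp: closed_csubspace_def N_def add scale)
  qed
  define b where "b = a - proj_onto N a"
  have p: "proj_onto N a \<in> N" by (rule proj_in[OF N])
  then have bH: "b \<in> H" using a closed_csubspaceD(7)[OF H] by (auto simp: b_def N_def)
  have "\<phi> b = \<phi> a" using p a diff by (auto simp: b_def N_def)
  then have phib: "\<phi> b \<noteq> 0" using a by simp
  have "b \<noteq> 0" using phib diff[of 0 0] closed_csubspaceD(2)[OF H] by auto
  define z where "z = cnj (\<phi> b / cinner b b) *\<^sub>C b"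
  have "\<phi> x = cinner x z" if x: "x \<in> H" for x
  proof -
    define u where "u = x - (\<phi> x / \<phi> b) *\<^sub>C b"
    have "u \<in> N" using x bH phib closed_csubspaceD[OF H] by (auto simp: u_def N_def diff scale)
    then have "cinner u b = 0" unfolding b_def by (rule proj_orth'[OF N])
    then have "cinner x b = \<phi> x / \<phi> b * cinner b b"
      by (simp add: u_def cinner_diff_left cinner_scaleC_left)
    then show ?thesis using phib \<open>b \<noteq> 0\<close> by (simp add: z_def cinner_scaleC_right)
  qed
  moreover have "z \<in> H" using bH closed_csubspaceD[OF H] by (auto simp: z_def)
  ultimately show ?thesis by blast
qed

lemma adjoint_unique:
  assumes H: "closed_csubspace (H::'a::chilbert set)"
    and "z \<in> H" "\<And>x. x \<in> H \<Longrightarrow> cinner (A x) y = cinner x z"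
  shows "adjoint_on H A y = z"
  unfolding adjoint_on_def
proof (rule the_equality)
  fix z' assume z': "z' \<in> H \<and> (\<forall>x\<in>H. cinner (A x) y = cinner x z')"
  have d: "z' - z \<in> H" using z' assms closed_csubspaceD[OF H] by auto
  have "cinner (z' - z) (z' - z) = 0"
    using z' assms(3)[OF d] d by (simp add: cinner_diff_right)
  then show "z' = z" by simp
qed (use assms in auto)

lemma
  assumes H: "closed_csubspace (H::'a::chilbert set)" and A: "bounded_op H A" and y: "y \<in> H"
  shows adjoint_in: "adjoint_on H A y \<in> H"
    and adjoint_cinner: "x \<in> H \<Longrightarrow> cinner (A x) y = cinner x (adjoint_on H A y)"
proof -
  obtain B where B: "\<And>x. x \<in> H \<Longrightarrow> norm (A x) \<le> B * norm x"
    using A by (auto simp: bounded_op_def)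
  have "\<exists>z\<in>H. \<forall>x\<in>H. cinner (A x) y = cinner x z"
  proof (rule riesz_representation[OF H, where B = "B * norm y"])
    fix x assume "x \<in> H"
    then have "norm (A x) * norm y \<le> B * norm x * norm y" using B by (intro mult_right_mono) auto
    then show "cmod (cinner (A x) y) \<le> B * norm y * norm x"
      using norm_cinner_le[of "A x" y] by (simp add: mult_ac)
  qed (use A in \<open>auto simp: bounded_op_def clinear_on_def cinner_add_left cinner_scaleC_left\<close>)
  then obtain z where z: "z \<in> H" "\<And>x. x \<in> H \<Longrightarrow> cinner (A x) y = cinner x z" by blast
  have "adjoint_on H A y = z" using adjoint_unique[OF H z] .
  then show "adjoint_on H A y \<in> H" "x \<in> H \<Longrightarrow> cinner (A x) y = cinner x (adjoint_on H A y)"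
    using z by auto
qed

lemma isometry_imp_bounded_op: "isometry H H V \<Longrightarrow> bounded_op H V"
  unfolding isometry_def bounded_op_def by (auto intro!: exI[of _ 1])

text \<open>
  By polarization: the real part of the inner product is determined by the norm, and its imaginary
  part is the real part of the inner product with \<open>\<i> y\<close>.
\<close>
lemma isometry_cinner:
  assumes H: "closed_csubspace H" and V: "isometry H K V" and xy: "x \<in> H" "y \<in> H"
  shows "cinner (V x) (V y) = cinner x y"
proof -
  have re: "inner (V u) (V v) = inner u v" if "u \<in> H" "v \<in> H" for u v
  proof -
    have "V (u + v) = V u + V v" using V that by (auto simp: isometry_def clinear_on_def)
    moreover have "norm (V (u + v)) = norm (u + v)" "norm (V u) = norm u" "norm (V v) = norm v"
      using V that closed_csubspaceD[OF H] by (auto simp: isometry_def)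
    ultimately show ?thesis
      using dot_norm[of "V u" "V v"] dot_norm[of u v] by simp
  qed
  show ?thesis
  proof (rule complex_eqI)
    show "Re (cinner (V x) (V y)) = Re (cinner x y)" using re[OF xy] by (simp add: Re_cinner)
    have "inner (V x) (V (\<i> *\<^sub>C y)) = inner x (\<i> *\<^sub>C y)"
      using re xy closed_csubspaceD[OF H] by auto
    moreover have "V (\<i> *\<^sub>C y) = \<i> *\<^sub>C V y" using V xy by (auto simp: isometry_def clinear_on_def)
    ultimately have "Re (cinner (V x) (\<i> *\<^sub>C V y)) = Re (cinner x (\<i> *\<^sub>C y))" by (simp add: Re_cinner)
    then show "Im (cinner (V x) (V y)) = Im (cinner x y)" by (simp add: cinner_scaleC_right)
  qed
qed

text \<open>
  For an isometry \<open>V\<close>, the operator \<open>V V\<^sup>*\<close> is the projection onto the range.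
\<close>
lemma isometry_range_proj:
  assumes H: "closed_csubspace H" and V: "isometry H H V" and h: "h \<in> H" and that: "k \<in> H"
  shows "cinner (h - V (adjoint_on H V h)) (V k) = 0"
proof -
  have b: "bounded_op H V" using V by (rule isometry_imp_bounded_op)
  have a: "adjoint_on H V h \<in> H" by (rule adjoint_in[OF H b h])
  have "cinner (V k) h = cinner k (adjoint_on H V h)"
    by (rule adjoint_cinner[OF H b h that])
  moreover have "cinner (V k) (V (adjoint_on H V h)) = cinner k (adjoint_on H V h)"
    by (rule isometry_cinner[OF H V that a])
  ultimately have "cinner (V k) (h - V (adjoint_on H V h)) = 0" by (simp add: cinner_diff_right)
  then show ?thesis using cinner_eq_0_sym by blast
qed

lemma bounded_linear_proj:
  assumes M: "closed_csubspace M"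
  shows "bounded_linear (proj_onto M)"
proof (rule bounded_linear_intro[where K = 1])
  show "proj_onto M (r *\<^sub>R x) = r *\<^sub>R proj_onto M x" for r x
    using proj_scaleC[OF M, of "complex_of_real r" x] by (simp add: scaleC_of_real)
qed (auto simp: proj_add[OF M] proj_norm_le[OF M])

lemma closed_csubspace_closure:
  assumes "0 \<in> S" "\<And>x y. x \<in> S \<Longrightarrow> y \<in> S \<Longrightarrow> x + y \<in> S" "\<And>c x. x \<in> S \<Longrightarrow> c *\<^sub>C x \<in> S"
  shows "closed_csubspace (closure S)"
  unfolding closed_csubspace_def
proof (intro conjI ballI allI)
  show "0 \<in> closure S" using assms(1) closure_subset by blast
  fix x assume "x \<in> closure S"
  then obtain u where u: "\<And>k. u k \<in> S" "u \<longlonglongrightarrow> x" unfolding closure_sequential by blast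
  show "c *\<^sub>C x \<in> closure S" for c
    unfolding closure_sequential
    by (rule exI[of _ "\<lambda>k. c *\<^sub>C u k"]) (use u assms(3) in \<open>auto intro: tendsto_scaleC\<close>)
  fix y assume "y \<in> closure S"
  then obtain v where v: "\<And>k. v k \<in> S" "v \<longlonglongrightarrow> y" unfolding closure_sequential by blast
  show "x + y \<in> closure S"
    unfolding closure_sequential
    by (rule exI[of _ "\<lambda>k. u k + v k"]) (use u v assms(2) in \<open>auto intro: tendsto_add\<close>)
qed auto

section \<open>Functions vanishing at infinity\<close>

lemma C0_transfer:
  assumes f: "f \<in> C0" and g: "continuous_on UNIV g"
    and le: "\<And>e. e > 0 \<Longrightarrow> \<exists>d>0. \<forall>x. e \<le> cmod (g x) \<longrightarrow> d \<le> cmod (f x)"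
  shows "g \<in> (C0 :: ('x::t2_space \<Rightarrow> complex) set)"
proof -
  have "compact {x. e \<le> cmod (g x)}" if "e > 0" for e
  proof -
    obtain d where d: "d > 0" "\<And>x. e \<le> cmod (g x) \<Longrightarrow> d \<le> cmod (f x)" using le \<open>e > 0\<close> by blast
    have "compact {x. d \<le> cmod (f x)}" using f d by (auto simp: C0_def)
    moreover have "closed {x. e \<le> cmod (g x)}"
      by (intro closed_Collect_le continuous_intros g)
    ultimately have "compact ({x. d \<le> cmod (f x)} \<inter> {x. e \<le> cmod (g x)})"
      by (rule compact_Int_closed)
    moreover have "{x. d \<le> cmod (f x)} \<inter> {x. e \<le> cmod (g x)} = {x. e \<le> cmod (g x)}"
      using d by auto
    ultimately show ?thesis by simp
  qed
  then show ?thesis using g by (auto simp: C0_def)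
qed

lemma C0_continuous: "f \<in> C0 \<Longrightarrow> continuous_on UNIV f"
  by (simp add: C0_def)

lemma C0_dominated:
  assumes "f \<in> C0" "continuous_on UNIV g" "\<And>x. cmod (g x) \<le> B * cmod (f x)"
  shows "g \<in> (C0 :: ('x::t2_space \<Rightarrow> complex) set)"
proof (rule C0_transfer[OF assms(1,2)])
  fix e :: real assume e: "e > 0"
  define B' where "B' = max B 1"
  have "e / B' \<le> cmod (f x)" if "e \<le> cmod (g x)" for x
  proof -
    have "e \<le> B * cmod (f x)" using that assms(3) order_trans by blast
    also have "\<dots> \<le> B' * cmod (f x)" by (intro mult_right_mono) (auto simp: B'_def)
    finally show ?thesis by (simp add: B'_def pos_divide_le_eq mult.commute)
  qed
  moreover have "e / B' > 0" using e by (simp add: B'_def)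
  ultimately show "\<exists>d>0. \<forall>x. e \<le> cmod (g x) \<longrightarrow> d \<le> cmod (f x)" by blast
qed

lemma C0_scale: "f \<in> C0 \<Longrightarrow> (\<lambda>x. c * f x) \<in> (C0 :: ('x::t2_space \<Rightarrow> complex) set)"
  by (rule C0_dominated[where f=f and B="cmod c"])
    (auto intro: continuous_intros C0_continuous simp: norm_mult)

lemma C0_cnj: "f \<in> C0 \<Longrightarrow> (\<lambda>x. cnj (f x)) \<in> (C0 :: ('x::t2_space \<Rightarrow> complex) set)"
  by (rule C0_dominated[where f=f and B=1]) (auto intro: continuous_intros C0_continuous)

lemma C0_add:
  assumes f: "f \<in> C0" and g: "g \<in> C0"
  shows "(\<lambda>x. f x + g x) \<in> (C0 :: ('x::t2_space \<Rightarrow> complex) set)"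
proof -
  have "compact {x. e \<le> cmod (f x + g x)}" if "e > 0" for e
  proof -
    have "compact ({x. e/2 \<le> cmod (f x)} \<union> {x. e/2 \<le> cmod (g x)})"
      using f g half_gt_zero[OF that] unfolding C0_def by (intro compact_Un) blast+
    moreover have "closed {x. e \<le> cmod (f x + g x)}"
      by (intro closed_Collect_le continuous_intros C0_continuous f g)
    ultimately have "compact (({x. e/2 \<le> cmod (f x)} \<union> {x. e/2 \<le> cmod (g x)}) \<inter> {x. e \<le> cmod (f x + g x)})"
      by (rule compact_Int_closed)
    moreover have "e/2 \<le> cmod (f x) \<or> e/2 \<le> cmod (g x)" if "e \<le> cmod (f x + g x)" for x
      using that norm_triangle_ineq[of "f x" "g x"] by linarith
    then have "({x. e/2 \<le> cmod (f x)} \<union> {x. e/2 \<le> cmod (g x)}) \<inter> {x. e \<le> cmod (f x + g x)}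
        = {x. e \<le> cmod (f x + g x)}" by auto
    ultimately show ?thesis by simp
  qed
  then show ?thesis using f g by (auto simp: C0_def intro!: continuous_intros)
qed

lemma C0_diff:
  assumes "f \<in> C0" "g \<in> C0"
  shows "(\<lambda>x. f x - g x) \<in> (C0 :: ('x::t2_space \<Rightarrow> complex) set)"
  using C0_add[OF assms(1) C0_scale[OF assms(2), of "-1"]] by simp

lemma C0_zero: "(\<lambda>x. 0) \<in> (C0 :: ('x::t2_space \<Rightarrow> complex) set)"
  by (auto simp: C0_def intro: continuous_intros)

lemma C0_bounded:
  assumes f: "f \<in> (C0 :: ('x::t2_space \<Rightarrow> complex) set)"
  shows "\<exists>B\<ge>0. \<forall>x. cmod (f x) \<le> B"
proof -
  have "compact (f ` {x. 1 \<le> cmod (f x)})"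
    using f by (intro compact_continuous_image) (auto simp: C0_def intro: continuous_on_subset)
  then obtain B where B: "\<And>y. y \<in> f ` {x. 1 \<le> cmod (f x)} \<Longrightarrow> cmod y \<le> B"
    using compact_imp_bounded bounded_iff by metis
  have "cmod (f x) \<le> max B 1" for x
    using B[of "f x"] by (cases "1 \<le> cmod (f x)") auto
  then show ?thesis by (metis max.cobounded2 order_trans zero_le_one)
qed

lemma C0_mult_bounded:
  assumes "f \<in> C0" "continuous_on UNIV g" "\<And>x. cmod (g x) \<le> B"
  shows "(\<lambda>x. f x * g x) \<in> (C0 :: ('x::t2_space \<Rightarrow> complex) set)"
proof (rule C0_dominated[OF assms(1)])
  show "continuous_on UNIV (\<lambda>x. f x * g x)" by (intro continuous_intros C0_continuous assms)
  show "cmod (f x * g x) \<le> B * cmod (f x)" for x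
    using mult_left_mono[OF assms(3)[of x], of "cmod (f x)"] by (simp add: norm_mult mult.commute)
qed

lemma C0_mult:
  assumes "f \<in> C0" "g \<in> C0"
  shows "(\<lambda>x. f x * g x) \<in> (C0 :: ('x::t2_space \<Rightarrow> complex) set)"
  using C0_bounded[OF assms(2)] C0_mult_bounded[OF assms(1) C0_continuous[OF assms(2)]] by blast

text \<open>
  A continuous replacement for cutting \<open>f\<close> off where \<open>|f| < e\<close>.  It is supported in the compact set
  \<open>{|f| \<ge> e}\<close> and uniformly close to \<open>f\<close>.
\<close>
definition soft_threshold :: "real \<Rightarrow> ('x \<Rightarrow> complex) \<Rightarrow> 'x \<Rightarrow> complex" where
  "soft_threshold e f x = f x * complex_of_real (max 0 (cmod (f x) - e) / max (cmod (f x)) e)"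

lemma soft_threshold_C0:
  assumes "f \<in> (C0 :: ('x::t2_space \<Rightarrow> complex) set)" "e > 0"
  shows "soft_threshold e f \<in> C0"
  unfolding soft_threshold_def
proof (rule C0_mult_bounded[OF assms(1), where B = 1])
  have "max (cmod (f x)) e \<noteq> 0" for x using assms(2) by (auto simp: max_def)
  then show "continuous_on UNIV (\<lambda>x. complex_of_real (max 0 (cmod (f x) - e) / max (cmod (f x)) e))"
    by (intro continuous_intros C0_continuous assms) auto
  show "cmod (complex_of_real (max 0 (cmod (f x) - e) / max (cmod (f x)) e)) \<le> 1" for x
  proof -
    have "max (cmod (f x)) e > 0" using assms(2) by (auto simp: max_def)
    moreover have "max 0 (cmod (f x) - e) \<le> max (cmod (f x)) e" using assms(2) by auto
    moreover have "max 0 (cmod (f x) - e) \<ge> 0" by auto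
    ultimately show ?thesis by (simp add: norm_divide del: of_real_divide) 
  qed
qed

lemma soft_threshold_eq_0: "cmod (f x) < e \<Longrightarrow> soft_threshold e f x = 0"
  by (auto simp: soft_threshold_def)

lemma soft_threshold_close:
  assumes e: "e > 0"
  shows "cmod (f x - soft_threshold e f x) \<le> e"
proof (cases "cmod (f x) < e")
  case True
  then show ?thesis by (simp add: soft_threshold_eq_0)
next
  case False
  then have nz: "cmod (f x) > 0" using e by linarith
  have "f x - soft_threshold e f x = f x * complex_of_real (1 - (cmod (f x) - e) / cmod (f x))"
    using False by (simp add: soft_threshold_def max_def algebra_simps)
  also have "1 - (cmod (f x) - e) / cmod (f x) = e / cmod (f x)"
    using nz by (simp add: field_simps)
  finally show ?thesis using nz e by (simp add: norm_mult norm_divide)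
qed

section \<open>Vectors supported on a set\<close>

text \<open>
  A nondegenerate *-representation, with nondegeneracy expressed by the absence of a common kernel.
  In this form it passes to invariant subspaces at once, and continuity is a consequence.
\<close>
locale c0_rep =
  fixes H :: "'a::chilbert set" and \<pi> :: "('x::t2_space \<Rightarrow> complex) \<Rightarrow> 'a \<Rightarrow> 'a"
  assumes H: "closed_csubspace H"
    and mem: "f \<in> C0 \<Longrightarrow> h \<in> H \<Longrightarrow> \<pi> f h \<in> H"
    and add_vec: "f \<in> C0 \<Longrightarrow> h \<in> H \<Longrightarrow> k \<in> H \<Longrightarrow> \<pi> f (h + k) = \<pi> f h + \<pi> f k"
    and scale_vec: "f \<in> C0 \<Longrightarrow> h \<in> H \<Longrightarrow> \<pi> f (c *\<^sub>C h) = c *\<^sub>C \<pi> f h"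
    and add_fun: "f \<in> C0 \<Longrightarrow> g \<in> C0 \<Longrightarrow> h \<in> H \<Longrightarrow> \<pi> (\<lambda>x. f x + g x) h = \<pi> f h + \<pi> g h"
    and scale_fun: "f \<in> C0 \<Longrightarrow> h \<in> H \<Longrightarrow> \<pi> (\<lambda>x. c * f x) h = c *\<^sub>C \<pi> f h"
    and mult: "f \<in> C0 \<Longrightarrow> g \<in> C0 \<Longrightarrow> h \<in> H \<Longrightarrow> \<pi> (\<lambda>x. f x * g x) h = \<pi> f (\<pi> g h)"
    and adj: "f \<in> C0 \<Longrightarrow> h \<in> H \<Longrightarrow> k \<in> H \<Longrightarrow> cinner (\<pi> f h) k = cinner h (\<pi> (\<lambda>x. cnj (f x)) k)"
    and nondeg: "h \<in> H \<Longrightarrow> (\<And>f. f \<in> C0 \<Longrightarrow> \<pi> f h = 0) \<Longrightarrow> h = 0"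
begin

lemmas HD = closed_csubspaceD[OF H]

lemma diff_fun:
  assumes "f \<in> C0" "g \<in> C0" "h \<in> H"
  shows "\<pi> (\<lambda>x. f x - g x) h = \<pi> f h - \<pi> g h"
proof -
  have "\<pi> (\<lambda>x. f x + (-1) * g x) h = \<pi> f h + (-1) *\<^sub>C \<pi> g h"
    using assms C0_scale[OF assms(2), of "-1"] by (simp only: add_fun scale_fun)
  then show ?thesis by (simp add: scaleC_minus1)
qed

lemma diff_vec:
  assumes "f \<in> C0" "h \<in> H" "k \<in> H"
  shows "\<pi> f (h - k) = \<pi> f h - \<pi> f k"
proof -
  have "\<pi> f (h - k + k) = \<pi> f (h - k) + \<pi> f k" using assms HD by (intro add_vec) auto
  then show ?thesis by simp
qed

lemma zero_vec [simp]: "f \<in> C0 \<Longrightarrow> \<pi> f 0 = 0"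
  using diff_vec[of f 0 0] HD by simp

lemma zero_fun: "h \<in> H \<Longrightarrow> \<pi> (\<lambda>x. 0) h = 0"
  using scale_fun[OF C0_zero, of h 0] by simp

lemma commute: "f \<in> C0 \<Longrightarrow> g \<in> C0 \<Longrightarrow> h \<in> H \<Longrightarrow> \<pi> f (\<pi> g h) = \<pi> g (\<pi> f h)"
  by (simp flip: mult) (simp add: mult.commute)

text \<open>
  The vectors supported on \<open>C\<close>.  For closed \<open>C\<close> this is the range of the spectral projection of \<open>C\<close>.
\<close>
definition sspace :: "'x set \<Rightarrow> 'a set" where
  "sspace C = {h\<in>H. \<forall>f\<in>C0. (\<forall>x\<in>C. f x = 0) \<longrightarrow> \<pi> f h = 0}"

lemma sspaceD: "h \<in> sspace C \<Longrightarrow> f \<in> C0 \<Longrightarrow> (\<And>x. x \<in> C \<Longrightarrow> f x = 0) \<Longrightarrow> \<pi> f h = 0"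
  by (simp add: sspace_def)

lemma sspace_subset: "sspace C \<subseteq> H" by (auto simp: sspace_def)
lemma sspace_mono: "C \<subseteq> D \<Longrightarrow> sspace C \<subseteq> sspace D" by (auto simp: sspace_def)
lemma sspace_UNIV: "sspace UNIV = H"
proof -
  have "\<pi> f h = 0" if "h \<in> H" "\<forall>x. f x = 0" for f h
    using that zero_fun[of h] by (metis ext)
  then show ?thesis by (auto simp: sspace_def)
qed
lemma sspace_empty: "sspace {} = {0}"
  using nondeg HD by (auto simp: sspace_def)

lemma sspace_agree:
  assumes "h \<in> sspace C" "f \<in> C0" "g \<in> C0" "\<And>x. x \<in> C \<Longrightarrow> f x = g x"
  shows "\<pi> f h = \<pi> g h"
proof -
  have "\<pi> (\<lambda>x. f x - g x) h = 0" using assms C0_diff[OF assms(2,3)] by (auto simp: sspace_def)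
  then show ?thesis using assms diff_fun[of f g h] by (auto simp: sspace_def)
qed

lemma selfadjoint_real:
  assumes "(\<lambda>x. complex_of_real (k x)) \<in> C0" "h \<in> H" "h' \<in> H"
  shows "cinner (\<pi> (\<lambda>x. complex_of_real (k x)) h) h' = cinner h (\<pi> (\<lambda>x. complex_of_real (k x)) h')"
  using adj[OF assms] by simp

text \<open>
  If \<open>k \<le> t\<close> with \<open>t \<ge> 0\<close> then \<open>t - \<pi>(k)\<close> is the square of the self-adjoint operator
  \<open>\<surd>t - \<pi>(u)\<close>, where \<open>u = \<surd>t - \<surd>(t - k)\<close> vanishes at infinity.
\<close>
lemma quadratic_form_le:
  assumes k: "(\<lambda>x. complex_of_real (k x)) \<in> C0" and t: "t \<ge> 0" and le: "\<And>x. k x \<le> t"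
    and h: "h \<in> H"
  shows "Re (cinner (\<pi> (\<lambda>x. complex_of_real (k x)) h) h) \<le> t * (norm h)\<^sup>2"
proof -
  define u where "u x = sqrt t - sqrt (t - k x)" for x
  have ck: "continuous_on UNIV k"
    using continuous_on_Re[OF C0_continuous[OF k]] by simp
  have u: "(\<lambda>x. complex_of_real (u x)) \<in> C0"
  proof (rule C0_transfer[OF k])
    show "continuous_on UNIV (\<lambda>x. complex_of_real (u x))"
      unfolding u_def by (intro continuous_intros ck)
    fix e :: real assume e: "e > 0"
    have "e\<^sup>2 \<le> \<bar>k x\<bar>" if "e \<le> \<bar>u x\<bar>" for x
    proof -
      have s: "0 \<le> sqrt t" "0 \<le> sqrt (t - k x)" using t le[of x] by auto
      have "e\<^sup>2 \<le> \<bar>u x\<bar> * \<bar>u x\<bar>" unfolding power2_eq_square using that e by (intro mult_mono) auto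
      also have "\<dots> \<le> \<bar>u x\<bar> * \<bar>sqrt t + sqrt (t - k x)\<bar>"
      proof (rule mult_left_mono)
        show "\<bar>u x\<bar> \<le> \<bar>sqrt t + sqrt (t - k x)\<bar>" unfolding u_def using s by linarith
      qed simp
      also have "\<dots> = \<bar>(sqrt t - sqrt (t - k x)) * (sqrt t + sqrt (t - k x))\<bar>"
        by (simp add: u_def abs_mult)
      also have "(sqrt t - sqrt (t - k x)) * (sqrt t + sqrt (t - k x)) = k x"
        using t le[of x] by (simp add: algebra_simps)
      finally show ?thesis .
    qed
    then show "\<exists>d>0. \<forall>x. e \<le> cmod (complex_of_real (u x)) \<longrightarrow> d \<le> cmod (complex_of_real (k x))"
      using e by (intro exI[of _ "e\<^sup>2"]) auto
  qed
  let ?u = "\<lambda>x. complex_of_real (u x)" and ?k = "\<lambda>x. complex_of_real (k x)"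
  have keq: "?k = (\<lambda>x. complex_of_real (2 * sqrt t) * ?u x - ?u x * ?u x)"
  proof
    fix x
    have "(sqrt t - u x)\<^sup>2 = t - k x" using le[of x] by (simp add: u_def)
    then have "k x = 2 * sqrt t * u x - u x * u x"
      using t by (simp add: power2_diff) (simp add: power2_eq_square)
    then show "?k x = complex_of_real (2 * sqrt t) * ?u x - ?u x * ?u x"
      by (metis of_real_diff of_real_mult)
  qed
  have "\<pi> ?k h = complex_of_real (2 * sqrt t) *\<^sub>C \<pi> ?u h - \<pi> ?u (\<pi> ?u h)"
    unfolding keq using u h C0_scale[OF u] C0_mult[OF u u] by (simp only: diff_fun scale_fun mult)
  then have "cinner (\<pi> ?k h) h = complex_of_real (2 * sqrt t) * cinner (\<pi> ?u h) h - cinner (\<pi> ?u h) (\<pi> ?u h)"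
    using selfadjoint_real[OF u mem[OF u h] h] by (simp add: cinner_diff_left cinner_scaleC_left)
  then have 1: "Re (cinner (\<pi> ?k h) h) = 2 * sqrt t * inner (\<pi> ?u h) h - inner (\<pi> ?u h) (\<pi> ?u h)"
    using Re_complex_of_real by (simp add: Re_cinner)
  have "0 \<le> (norm (sqrt t *\<^sub>R h - \<pi> ?u h))\<^sup>2" by simp
  also have "\<dots> = (sqrt t * sqrt t) * inner h h - 2 * sqrt t * inner (\<pi> ?u h) h + inner (\<pi> ?u h) (\<pi> ?u h)"
    by (simp add: power2_norm_eq_inner inner_diff_left inner_diff_right inner_commute algebra_simps)
  finally show ?thesis using 1 t by (simp add: power2_norm_eq_inner)
qed

text \<open>
  For \<open>t \<ge> 0\<close> the function can be truncated at \<open>t\<close> without changing it on \<open>C\<close>.  For \<open>t < 0\<close> the set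
  \<open>C\<close> lies where \<open>|k| \<ge> -t\<close>, so a function \<open>w\<close> vanishing at infinity can be \<open>1\<close> on \<open>C\<close>; it acts as
  the identity on \<open>h\<close> and stands in for the constant function, which does not vanish at infinity.
\<close>
lemma quadratic_form_le_sspace:
  assumes k: "(\<lambda>x. complex_of_real (k x)) \<in> C0" and h: "h \<in> sspace C"
    and le: "\<And>x. x \<in> C \<Longrightarrow> k x \<le> t"
  shows "Re (cinner (\<pi> (\<lambda>x. complex_of_real (k x)) h) h) \<le> t * (norm h)\<^sup>2"
proof (cases "t \<ge> 0")
  have hH: "h \<in> H" using h sspace_subset by auto
  have ck: "continuous_on UNIV k"
    using continuous_on_Re[OF C0_continuous[OF k]] by simp
  {
    case True
    have m: "(\<lambda>x. complex_of_real (min (k x) t)) \<in> C0"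
      by (rule C0_dominated[OF k, where B = 1]) (use True in \<open>auto intro!: continuous_intros ck\<close>)
    have "\<pi> (\<lambda>x. complex_of_real (k x)) h = \<pi> (\<lambda>x. complex_of_real (min (k x) t)) h"
      by (rule sspace_agree[OF h k m]) (use le in \<open>auto simp: min_def\<close>)
    then show ?thesis using quadratic_form_le[OF m True _ hH] by simp
  next
    case False
    define s where "s = - t"
    have s: "s > 0" using False by (simp add: s_def)
    define q where "q x = max (- k x) 0" for x
    define w where "w x = min (q x) s / s" for x
    have cq: "continuous_on UNIV q" unfolding q_def by (intro continuous_intros ck)
    have q: "(\<lambda>x. complex_of_real (q x)) \<in> C0"
      by (rule C0_dominated[OF k, where B = 1]) (auto intro!: continuous_intros ck simp: q_def)
    have w0: "0 \<le> w x" "w x \<le> 1" "s * w x \<le> q x" for x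
      using s by (auto simp: w_def q_def min_def divide_simps)
    have w: "(\<lambda>x. complex_of_real (w x)) \<in> C0"
    proof (rule C0_dominated[OF q, where B = "1/s"])
      show "continuous_on UNIV (\<lambda>x. complex_of_real (w x))"
        unfolding w_def using s by (intro continuous_intros cq) auto
      show "cmod (complex_of_real (w x)) \<le> 1 / s * cmod (complex_of_real (q x))" for x
        using w0[of x] s by (auto simp: field_simps q_def)
    qed
    let ?w = "\<lambda>x. complex_of_real (w x)" and ?q = "\<lambda>x. complex_of_real (q x)"
    have w1: "w x = 1" if "x \<in> C" for x
      using le[OF that] s by (auto simp: w_def q_def s_def min_def)
    \<comment> \<open>\<open>f w\<close> and \<open>f\<close> agree on \<open>C\<close>, so every \<open>\<pi>(f)\<close> annihilates \<open>\<pi>(w) h - h\<close>.\<close>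
    have wh: "\<pi> ?w h = h"
    proof -
      have "\<pi> f (\<pi> ?w h - h) = 0" if f: "f \<in> C0" for f
      proof -
        have "\<pi> (\<lambda>x. f x * ?w x) h = \<pi> f h"
          by (rule sspace_agree[OF h C0_mult[OF f w] f]) (simp add: w1)
        then show ?thesis using f w hH mem by (simp add: mult diff_vec)
      qed
      moreover have "\<pi> ?w h - h \<in> H" using hH HD mem[OF w hH] by auto
      ultimately show ?thesis using nondeg by fastforce
    qed
    define g where "g x = s * (w x * w x) - q x" for x
    have geq: "(\<lambda>x. complex_of_real (g x)) = (\<lambda>x. complex_of_real s * (?w x * ?w x) - ?q x)"
      by (simp add: g_def fun_eq_iff)
    have g: "(\<lambda>x. complex_of_real (g x)) \<in> C0"
      unfolding geq by (intro C0_diff C0_scale C0_mult w q)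
    have "g x \<le> 0" for x
    proof -
      have "w x * w x \<le> w x" using w0[of x] by (simp add: mult_left_le)
      then have "s * (w x * w x) \<le> s * w x" using s by (simp add: mult_left_mono)
      then show ?thesis using w0(3)[of x] by (simp add: g_def)
    qed
    from quadratic_form_le[OF g order.refl this hH]
    have "Re (cinner (\<pi> (\<lambda>x. complex_of_real (g x)) h) h) \<le> 0" by simp
    moreover have "\<pi> (\<lambda>x. complex_of_real (g x)) h = complex_of_real s *\<^sub>C h - \<pi> ?q h"
      unfolding geq using w q hH C0_mult[OF w w] C0_scale[OF C0_mult[OF w w]]
      by (simp only: diff_fun scale_fun mult wh)
    ultimately have "s * (norm h)\<^sup>2 \<le> Re (cinner (\<pi> ?q h) h)"
      by (simp add: cinner_diff_left cinner_scaleC_left cinner_self flip: of_real_power of_real_mult)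
    moreover have "\<pi> ?q h = \<pi> (\<lambda>x. -1 * complex_of_real (k x)) h"
      by (rule sspace_agree[OF h q C0_scale[OF k]]) (use le s in \<open>force simp: q_def s_def max_def\<close>)
    ultimately show ?thesis using k hH
      by (simp only: scale_fun) (simp add: scaleC_minus1 cinner_minus_left s_def)
  }
qed

text \<open>
  On vectors supported on \<open>C\<close> the operator \<open>\<pi>(f)\<close> only depends on \<open>f\<close> on \<open>C\<close>, and as contractively
  as possible.  The case \<open>C = UNIV\<close>, \<open>c = 0\<close> is the automatic continuity of \<open>\<pi>\<close>.
\<close>
lemma local_estimate:
  assumes f: "f \<in> C0" and h: "h \<in> sspace C" and e: "e \<ge> 0"
    and close: "\<And>x. x \<in> C \<Longrightarrow> cmod (f x - c) \<le> e"
  shows "norm (\<pi> f h - c *\<^sub>C h) \<le> e * norm h"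
proof -
  have hH: "h \<in> H" using h sspace_subset by auto
  let ?a = "\<lambda>x. cnj c * f x" and ?b = "\<lambda>x. c * cnj (f x)"
  have a: "?a \<in> C0" and b: "?b \<in> C0" by (intro C0_scale C0_cnj f)+
  \<comment> \<open>This is \<open>|f - c|\<^sup>2 - |c|\<^sup>2\<close>, which unlike \<open>|f - c|\<^sup>2\<close> vanishes at infinity.\<close>
  define k where "k x = (cmod (f x))\<^sup>2 - 2 * Re (cnj c * f x)" for x
  have keq: "(\<lambda>x. complex_of_real (k x)) = (\<lambda>x. cnj (f x) * f x - (?a x + ?b x))"
    unfolding k_def cmod_power2 by (auto simp: complex_eq_iff fun_eq_iff power2_eq_square)
  have k: "(\<lambda>x. complex_of_real (k x)) \<in> C0"
    unfolding keq by (intro C0_diff C0_add C0_mult C0_cnj a b f)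
  have "k x \<le> e\<^sup>2 - (cmod c)\<^sup>2" if "x \<in> C" for x
  proof -
    have "(cmod (f x - c))\<^sup>2 \<le> e\<^sup>2" using close[OF that] by (intro power_mono) auto
    then show ?thesis by (simp add: k_def cmod_power2) (simp add: power2_eq_square algebra_simps)
  qed
  from quadratic_form_le_sspace[OF k h this]
  have 1: "Re (cinner (\<pi> (\<lambda>x. complex_of_real (k x)) h) h) \<le> (e\<^sup>2 - (cmod c)\<^sup>2) * (norm h)\<^sup>2" .
  have eq: "\<pi> (\<lambda>x. complex_of_real (k x)) h
      = \<pi> (\<lambda>x. cnj (f x)) (\<pi> f h) - (cnj c *\<^sub>C \<pi> f h + c *\<^sub>C \<pi> (\<lambda>x. cnj (f x)) h)"
    unfolding keq using f hH C0_cnj[OF f] a b C0_add[OF a b] C0_mult[OF C0_cnj[OF f] f]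
    by (simp only: diff_fun add_fun scale_fun mult)
  have A: "cinner (\<pi> (\<lambda>x. cnj (f x)) (\<pi> f h)) h = cinner (\<pi> f h) (\<pi> f h)"
    using adj[OF C0_cnj[OF f] mem[OF f hH] hH] by simp
  have B: "cinner (\<pi> (\<lambda>x. cnj (f x)) h) h = cinner h (\<pi> f h)"
    using adj[OF C0_cnj[OF f] hH hH] by simp
  have "complex_of_real ((norm (\<pi> f h - c *\<^sub>C h))\<^sup>2)
      = cinner (\<pi> (\<lambda>x. complex_of_real (k x)) h) h + complex_of_real ((cmod c)\<^sup>2 * (norm h)\<^sup>2)"
    unfolding cinner_self[symmetric] eq
    by (simp add: cinner_diff_left cinner_diff_right cinner_add_left cinner_scaleC_left
        cinner_scaleC_right A B cinner_self[of h] complex_norm_square[of c] algebra_simps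
        del: of_real_power flip: of_real_power)
  from arg_cong[OF this, of Re]
  have "(norm (\<pi> f h - c *\<^sub>C h))\<^sup>2 = Re (cinner (\<pi> (\<lambda>x. complex_of_real (k x)) h) h) + (cmod c)\<^sup>2 * (norm h)\<^sup>2"
    by (simp only: plus_complex.sel Re_complex_of_real)
  with 1 have "(norm (\<pi> f h - c *\<^sub>C h))\<^sup>2 \<le> (e * norm h)\<^sup>2"
    by (simp add: algebra_simps power_mult_distrib)
  then show ?thesis by (rule power2_le_imp_le) (simp add: e)
qed

lemma norm_le:
  assumes "f \<in> C0" "h \<in> H" "B \<ge> 0" "\<And>x. cmod (f x) \<le> B"
  shows "norm (\<pi> f h) \<le> B * norm h"
  using local_estimate[of f h UNIV B 0] assms sspace_UNIV by simp

lemma bounded_on_H: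
  assumes "f \<in> C0"
  shows "\<exists>B\<ge>0. \<forall>h\<in>H. norm (\<pi> f h) \<le> B * norm h"
  using C0_bounded[OF assms] norm_le[OF assms] by metis

lemma bounded_op: "f \<in> C0 \<Longrightarrow> bounded_op H (\<pi> f)"
  using bounded_on_H unfolding bounded_op_def clinear_on_def
  by (auto simp: mem add_vec scale_vec)

lemma tendsto_vec:
  assumes f: "f \<in> C0" and u: "\<And>k. u k \<in> H" and l: "u \<longlonglongrightarrow> l"
  shows "(\<lambda>k. \<pi> f (u k)) \<longlonglongrightarrow> \<pi> f l"
proof -
  have lH: "l \<in> H" using closed_csubspace_limit[OF H u l] .
  obtain B where B: "\<And>h. h \<in> H \<Longrightarrow> norm (\<pi> f h) \<le> B * norm h" using bounded_on_H[OF f] by blast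
  have "(\<lambda>k. B * norm (u k - l)) \<longlonglongrightarrow> B * norm (l - l)" by (intro tendsto_intros l)
  then have "(\<lambda>k. B * norm (u k - l)) \<longlonglongrightarrow> 0" by simp
  moreover
  have "norm (\<pi> f (u k) - \<pi> f l) \<le> B * norm (u k - l)" for k
    using B[of "u k - l"] u lH HD by (simp add: diff_vec[OF f])
  then have "\<forall>\<^sub>F k in sequentially. norm (\<pi> f (u k) - \<pi> f l) \<le> B * norm (u k - l)" by simp
  ultimately have "(\<lambda>k. \<pi> f (u k) - \<pi> f l) \<longlonglongrightarrow> 0"
    by (rule Lim_null_comparison[rotated])
  then show ?thesis by (simp add: LIM_zero_iff)
qed

lemma eq_0_if_soft_threshold_eq_0:
  assumes f: "f \<in> C0" and h: "h \<in> H" and z: "\<And>e. e > 0 \<Longrightarrow> \<pi> (soft_threshold e f) h = 0"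
  shows "\<pi> f h = 0"
proof -
  have "norm (\<pi> f h) \<le> e * norm h" if e: "e > 0" for e
  proof -
    have t: "soft_threshold e f \<in> C0" by (rule soft_threshold_C0[OF f e])
    have "\<pi> f h = \<pi> (\<lambda>x. f x - soft_threshold e f x) h" using z[OF e] by (simp add: diff_fun[OF f t h])
    then show ?thesis
      using norm_le[OF C0_diff[OF f t] h less_imp_le[OF e] soft_threshold_close[OF e]] by simp
  qed
  then have "\<forall>\<^sub>F e in at_right 0. norm (\<pi> f h) \<le> e * norm h"
    by (intro eventually_at_rightI[of 0 1]) auto
  moreover have "((\<lambda>e. e * norm h) \<longlongrightarrow> 0 * norm h) (at_right 0)" by (intro tendsto_intros)
  ultimately have "norm (\<pi> f h) \<le> 0 * norm h"
    using tendsto_lowerbound trivial_limit_at_right_real by blast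
  then show ?thesis by simp
qed

section \<open>Central subspaces\<close>

definition reducing :: "'a set \<Rightarrow> bool" where
  "reducing Q \<longleftrightarrow> closed_csubspace Q \<and> Q \<subseteq> H \<and> (\<forall>f\<in>C0. \<pi> f ` Q \<subseteq> Q)"

text \<open>
  The projections onto central subspaces commute with every projection in the commutant of \<open>\<pi>\<close>, so
  they lie in its bicommutant.  Since \<open>\<pi>\<close> is commutative, they lie in the commutant as well and
  commute with each other.  They form a complete Boolean algebra.
\<close>
definition central :: "'a set \<Rightarrow> bool" where
  "central M \<longleftrightarrow> reducing M \<and> (\<forall>Q. reducing Q \<longrightarrow> proj_onto Q ` M \<subseteq> M)"

lemma reducing_proj:
  assumes Q: "reducing Q" and f: "f \<in> C0" and h: "h \<in> H"
  shows "\<pi> f (proj_onto Q h) = proj_onto Q (\<pi> f h)"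
proof -
  have cQ: "closed_csubspace Q" and QH: "Q \<subseteq> H" and inv: "\<And>g z. g \<in> C0 \<Longrightarrow> z \<in> Q \<Longrightarrow> \<pi> g z \<in> Q"
    using Q by (auto simp: reducing_def)
  have pH: "proj_onto Q h \<in> H" using proj_in[OF cQ] QH by auto
  show ?thesis
  proof (rule proj_unique[OF cQ, symmetric])
    show "\<pi> f (proj_onto Q h) \<in> Q" using inv[OF f] proj_in[OF cQ] by auto
    fix z assume z: "z \<in> Q"
    have "cinner (\<pi> f h - \<pi> f (proj_onto Q h)) z = cinner (\<pi> f (h - proj_onto Q h)) z"
      by (simp add: diff_vec[OF f h pH])
    also have "\<dots> = cinner (h - proj_onto Q h) (\<pi> (\<lambda>x. cnj (f x)) z)"
      using h pH z QH HD by (intro adj f) auto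
    also have "\<dots> = 0" by (intro proj_orth[OF cQ] inv C0_cnj f z)
    finally show "cinner (\<pi> f h - \<pi> f (proj_onto Q h)) z = 0" .
  qed
qed

lemma orth_invariant:
  assumes Q: "reducing Q" and f: "f \<in> C0" and u: "u \<in> H" "\<And>z. z \<in> Q \<Longrightarrow> cinner u z = 0" and z: "z \<in> Q"
  shows "cinner (\<pi> f u) z = 0"
proof -
  have "\<pi> (\<lambda>x. cnj (f x)) z \<in> Q" "z \<in> H" using Q z C0_cnj[OF f] by (auto simp: reducing_def)
  then show ?thesis using adj[OF f u(1)] u(2) by simp
qed

lemma centralD:
  assumes "central M"
  shows "closed_csubspace M" "M \<subseteq> H" "reducing M" "\<And>Q. reducing Q \<Longrightarrow> proj_onto Q ` M \<subseteq> M"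
    "\<And>f h. f \<in> C0 \<Longrightarrow> h \<in> M \<Longrightarrow> \<pi> f h \<in> M"
  using assms by (auto simp: central_def reducing_def)

lemma central_proj_mem: "central M \<Longrightarrow> reducing Q \<Longrightarrow> h \<in> M \<Longrightarrow> proj_onto Q h \<in> M"
  using centralD(4) by blast

lemma central_commute:
  "central M \<Longrightarrow> reducing N \<Longrightarrow> proj_onto M (proj_onto N x) = proj_onto N (proj_onto M x)"
  by (intro proj_commute) (auto simp: central_def reducing_def)

lemma central_Inter:
  assumes "\<M> \<noteq> {}" "\<And>M. M \<in> \<M> \<Longrightarrow> central M"
  shows "central (\<Inter>\<M>)"
proof -
  have "closed_csubspace (\<Inter>\<M>)" using assms centralD(1) by (intro closed_csubspace_Inter) auto
  moreover have "\<Inter>\<M> \<subseteq> H" using assms centralD(2) by blast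
  ultimately show ?thesis
    unfolding central_def reducing_def
  proof (intro conjI ballI allI impI image_subsetI InterI)
    fix f :: "'x \<Rightarrow> complex" and h M assume "f \<in> C0" "h \<in> \<Inter>\<M>" "M \<in> \<M>"
    then show "\<pi> f h \<in> M" using centralD(5)[OF assms(2)] by auto
  next
    fix Q h M
    assume Q: "closed_csubspace Q \<and> Q \<subseteq> H \<and> (\<forall>f\<in>C0. \<pi> f ` Q \<subseteq> Q)" and "h \<in> \<Inter>\<M>" "M \<in> \<M>"
    then show "proj_onto Q h \<in> M"
      using central_proj_mem[OF assms(2), of M Q h] by (auto simp: reducing_def)
  qed
qed

lemma closed_csubspace_sspace: "closed_csubspace (sspace C)"
proof -
  have "closed (sspace C)"
    unfolding closed_sequential_limits
  proof (intro allI impI, goal_cases)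
    case (1 u l)
    then have uH: "\<And>k. u k \<in> H" using sspace_subset by auto
    have lH: "l \<in> H" using closed_csubspace_limit[OF H uH] 1 by auto
    have "\<pi> f l = 0" if f: "f \<in> C0" "\<forall>x\<in>C. f x = 0" for f
    proof -
      have "(\<lambda>k. \<pi> f (u k)) \<longlonglongrightarrow> \<pi> f l" using tendsto_vec[OF f(1) uH] 1 by auto
      moreover have "\<pi> f (u k) = 0" for k using 1 f by (auto simp: sspace_def)
      ultimately show ?thesis by (simp add: LIMSEQ_const_iff)
    qed
    then show ?case using lH by (auto simp: sspace_def)
  qed
  then show ?thesis
    using HD by (auto simp: closed_csubspace_def sspace_def add_vec scale_vec)
qed

lemma central_sspace: "central (sspace C)"
proof -
  have red: "reducing (sspace C)"
    using closed_csubspace_sspace sspace_subset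
    by (auto simp: reducing_def) (auto simp: sspace_def mem commute)
  have "proj_onto Q h \<in> sspace C" if Q: "reducing Q" and h: "h \<in> sspace C" for Q h
  proof -
    have hH: "h \<in> H" using h sspace_subset by auto
    have "proj_onto Q h \<in> H" using Q proj_in by (auto simp: reducing_def)
    then show ?thesis
      using h Q reducing_proj[OF Q _ hH] by (auto simp: sspace_def reducing_def proj_zero)
  qed
  then show ?thesis using red by (auto simp: central_def)
qed

text \<open>
  The statement is \<open>R(C \<union> D) \<le> R(C) \<or> R(D)\<close>.  If \<open>u\<close> is the part of \<open>h\<close> orthogonal to \<open>R(C)\<close> and
  \<open>g\<close> vanishes on \<open>D\<close>, then \<open>\<pi>(g) u\<close> is both orthogonal to \<open>R(C)\<close> and, because \<open>f g\<close> vanishes on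
  \<open>C \<union> D\<close> whenever \<open>f\<close> vanishes on \<open>C\<close>, contained in it.
\<close>
lemma sspace_Un:
  assumes h: "h \<in> sspace (C \<union> D)"
  shows "h - proj_onto (sspace C) h \<in> sspace D"
proof -
  note cC = closed_csubspace_sspace[of C]
  have hH: "h \<in> H" using h sspace_subset by auto
  have pH: "proj_onto (sspace C) h \<in> H" using proj_in[OF cC] sspace_subset by blast
  define u where "u = h - proj_onto (sspace C) h"
  have uH: "u \<in> H" using hH pH HD by (simp add: u_def)
  have "\<pi> g u = 0" if g: "g \<in> C0" "\<forall>x\<in>D. g x = 0" for g
  proof -
    have "\<pi> f (\<pi> g u) = 0" if f: "f \<in> C0" "\<forall>x\<in>C. f x = 0" for f
    proof -
      have fg: "(\<lambda>x. f x * g x) \<in> C0" by (intro C0_mult f g)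
      have "\<pi> (\<lambda>x. f x * g x) h = 0" using h fg f g by (auto simp: sspace_def)
      moreover have "\<pi> (\<lambda>x. f x * g x) (proj_onto (sspace C) h) = 0"
        using proj_in[OF cC, of h] fg f by (auto simp: sspace_def)
      ultimately have "\<pi> (\<lambda>x. f x * g x) u = 0" by (simp add: u_def diff_vec[OF fg hH pH])
      then show ?thesis by (simp only: mult[OF f(1) g(1) uH])
    qed
    then have "\<pi> g u \<in> sspace C" using mem[OF g(1) uH] by (auto simp: sspace_def)
    moreover have "cinner (\<pi> g u) z = 0" if "z \<in> sspace C" for z
      by (rule orth_invariant[OF centralD(3)[OF central_sspace] g(1) uH _ that])
        (simp add: u_def proj_orth[OF cC])
    ultimately show ?thesis using cinner_self_eq_0 by blast
  qed
  then show ?thesis using uH by (auto simp: sspace_def u_def)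
qed

end

section \<open>Grid approximation of complex functions\<close>

text \<open>The mesh of the grid is \<open>d\<close>.\<close>
definition grid_index :: "real \<Rightarrow> complex \<Rightarrow> int \<times> int" where
  "grid_index d z = (\<lfloor>Re z / d\<rfloor>, \<lfloor>Im z / d\<rfloor>)"

definition grid_point :: "real \<Rightarrow> int \<times> int \<Rightarrow> complex" where
  "grid_point d p = Complex (d * of_int (fst p)) (d * of_int (snd p))"

lemma grid_point_close:
  assumes d: "d > 0"
  shows "cmod (z - grid_point d (grid_index d z)) \<le> 2 * d"
proof -
  have *: "\<bar>x - d * of_int \<lfloor>x / d\<rfloor>\<bar> \<le> d" for x
  proof -
    have 1: "of_int \<lfloor>x / d\<rfloor> \<le> x / d" "x / d \<le> of_int \<lfloor>x / d\<rfloor> + 1" by linarith+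
    have 2: "d * of_int \<lfloor>x / d\<rfloor> \<le> d * (x / d)" by (rule mult_left_mono[OF 1(1)]) (use d in simp)
    have "d * (x / d) \<le> d * (of_int \<lfloor>x / d\<rfloor> + 1)" by (rule mult_left_mono[OF 1(2)]) (use d in simp)
    with 2 d show ?thesis by (simp add: algebra_simps)
  qed
  show ?thesis
    using cmod_le[of "z - grid_point d (grid_index d z)"] *[of "Re z"] *[of "Im z"]
    by (simp add: grid_point_def grid_index_def)
qed

lemma finite_range_grid_index:
  assumes d: "d > 0" and B: "\<And>x. cmod (f x) \<le> B"
  shows "finite (range (\<lambda>x. grid_index d (f x)))"
proof (rule finite_subset)
  let ?I = "{\<lfloor>- B / d\<rfloor>..\<lfloor>B / d\<rfloor>}"
  have "\<lfloor>y / d\<rfloor> \<in> ?I" if "\<bar>y\<bar> \<le> B" for y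
  proof -
    have "- B / d \<le> y / d" "y / d \<le> B / d" using that d by (intro divide_right_mono; simp)+
    then show ?thesis by (simp only: atLeastAtMost_iff floor_mono)
  qed
  moreover have "\<bar>Re (f x)\<bar> \<le> B" "\<bar>Im (f x)\<bar> \<le> B" for x
    using B[of x] abs_Re_le_cmod[of "f x"] abs_Im_le_cmod[of "f x"] by linarith+
  ultimately show "range (\<lambda>x. grid_index d (f x)) \<subseteq> ?I \<times> ?I"
    unfolding grid_index_def by blast
qed auto

section \<open>Projection-valued contents\<close>

text \<open>
  The common part of the spectral measure, where \<open>\<A>\<close> consists of the measurable sets, and of the
  Boolean homomorphisms on all subsets of a space from which lifts are built.  The last assumption
  says that the projections of \<open>A\<close> and of its complement add up to \<open>1\<close>.
\<close>
locale spectral_content = c0_rep H \<pi>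
  for H :: "'a::chilbert set" and \<pi> :: "('x::t2_space \<Rightarrow> complex) \<Rightarrow> 'a \<Rightarrow> 'a" +
  fixes F :: "'y set \<Rightarrow> 'a set" and \<A> :: "'y set set"
  assumes central_F: "central (F A)"
    and F_Int: "F (A \<inter> B) = F A \<inter> F B"
    and F_empty: "F {} = {0}"
    and F_complete: "A \<in> \<A> \<Longrightarrow> u \<in> H \<Longrightarrow> (\<And>z. z \<in> F A \<Longrightarrow> cinner u z = 0) \<Longrightarrow>
      (\<And>z. z \<in> F (- A) \<Longrightarrow> cinner u z = 0) \<Longrightarrow> u = 0"
begin

lemmas cF = centralD(1)[OF central_F]
lemmas F_subset_H = centralD(2)[OF central_F]

abbreviation P :: "'y set \<Rightarrow> 'a \<Rightarrow> 'a" where "P A \<equiv> proj_onto (F A)"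

lemma P_mem: "P A h \<in> H"
  using proj_in[OF cF] F_subset_H by blast

lemma P_Int: "P (A \<inter> B) h = P A (P B h)"
  using proj_Int[OF cF cF centralD(4)[OF central_F centralD(3)[OF central_F]], of B A h]
  by (simp add: F_Int Int_commute)

lemma P_empty: "P {} h = 0"
  using proj_in[OF cF, of "{}" h] by (simp add: F_empty)

lemma F_disjoint_orth:
  assumes "A \<inter> B = {}" "y \<in> F A" "z \<in> F B"
  shows "cinner y z = 0"
proof -
  have "P A z = P A (P B z)" using assms(3) by (simp add: proj_id[OF cF])
  also have "\<dots> = 0" using assms(1) by (simp add: P_empty flip: P_Int)
  finally have "P A z = 0" .
  then show ?thesis using proj_sym[OF cF, of A y z] assms(2) by (simp add: proj_id[OF cF])
qed

lemma P_Compl: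
  assumes A: "A \<in> \<A>" and h: "h \<in> H"
  shows "P A h + P (- A) h = h"
proof -
  define u where "u = h - P A h - P (- A) h"
  have uH: "u \<in> H" unfolding u_def by (intro HD(7) h P_mem)
  have "cinner u z = 0" if "z \<in> F A" for z
    using proj_orth[OF cF that, of h] F_disjoint_orth[OF _ proj_in[OF cF] that, of "- A" h]
    unfolding u_def by (simp add: cinner_diff_left)
  moreover have "cinner u z = 0" if "z \<in> F (- A)" for z
    using proj_orth[OF cF that, of h] F_disjoint_orth[OF _ proj_in[OF cF] that, of A h]
    unfolding u_def by (simp add: cinner_diff_left)
  ultimately have "u = 0" using F_complete[OF A uH] by blast
  then show ?thesis unfolding u_def by (simp add: algebra_simps)
qed

text \<open>
  Both sides have the same components along \<open>A\<close> and along \<open>-A\<close>, and these determine a vector.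
\<close>
lemma P_Un_disjoint:
  assumes A: "A \<in> \<A>" and AB: "A \<inter> B = {}"
  shows "P (A \<union> B) h = P A h + P B h"
proof -
  have "P A (P (A \<union> B) h) = P A h" by (simp flip: P_Int)
  moreover have "P (- A) (P (A \<union> B) h) = P B h"
  proof -
    have "- A \<inter> (A \<union> B) = B" using AB by auto
    then show ?thesis by (simp flip: P_Int)
  qed
  ultimately show ?thesis using P_Compl[OF A P_mem, of "A \<union> B" h] by simp
qed

lemma P_sum:
  assumes "finite I" "\<And>i. i \<in> I \<Longrightarrow> A i \<in> \<A>" "disjoint_family_on A I"
  shows "P (\<Union>i\<in>I. A i) h = (\<Sum>i\<in>I. P (A i) h)"
  using assms
proof (induction I rule: finite_induct)
  case empty
  show ?case by (simp add: P_empty)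
next
  case (insert i I)
  have "disjoint_family_on A I" using insert.prems(2) by (auto simp: disjoint_family_on_def)
  moreover have "A i \<inter> (\<Union>i\<in>I. A i) = {}"
    using insert.prems(2) insert.hyps(2) by (auto simp: disjoint_family_on_def)
  ultimately show ?case
    using insert P_Un_disjoint[of "A i" "\<Union>i\<in>I. A i" h] by simp
qed

lemma
  assumes fin: "finite (range t)" and cells: "\<And>i. t -` {i} \<in> \<A>" and h: "h \<in> H"
  shows sum_cells: "(\<Sum>i\<in>range t. P (t -` {i}) h) = h"
    and norm_sum_cells: "(\<Sum>i\<in>range t. (norm (P (t -` {i}) h))\<^sup>2) = (norm h)\<^sup>2"
proof -
  have "disjoint_family_on (\<lambda>i. t -` {i}) (range t)" unfolding disjoint_family_on_def by blast
  moreover have "(\<Union>i\<in>range t. t -` {i}) = UNIV" by auto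
  ultimately have 1: "(\<Sum>i\<in>range t. P (t -` {i}) h) = P UNIV h"
    using P_sum[of "range t" "\<lambda>i. t -` {i}" h] fin cells by simp
  define i where "i = t undefined"
  have "P (t -` {i}) h + P (- (t -` {i})) h = P UNIV h"
    using P_Un_disjoint[of "t -` {i}" "- (t -` {i})" h] cells[of i] by (simp add: Compl_partition)
  then have "P UNIV h = h" using P_Compl[of "t -` {i}" h] cells[of i] h by simp
  with 1 show sum: "(\<Sum>i\<in>range t. P (t -` {i}) h) = h" by simp
  have "(norm (\<Sum>i\<in>range t. P (t -` {i}) h))\<^sup>2 = (\<Sum>i\<in>range t. (norm (P (t -` {i}) h))\<^sup>2)"
    by (rule norm_sum_orthogonal_sq[OF fin F_disjoint_orth[OF _ proj_in[OF cF] proj_in[OF cF]]]) auto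
  then show "(\<Sum>i\<in>range t. (norm (P (t -` {i}) h))\<^sup>2) = (norm h)\<^sup>2" by (simp add: sum)
qed

end

section \<open>The spectral theorem\<close>

lemma urysohn_function:
  assumes X: "metrizable_space (euclidean :: 'x::t2_space topology)"
    and C: "closed (C :: 'x set)" "closed D" "C \<inter> D = {}"
  shows "\<exists>u :: 'x \<Rightarrow> real. continuous_on UNIV u \<and> (\<forall>x. 0 \<le> u x \<and> u x \<le> 1) \<and>
    (\<forall>x\<in>C. u x = 0) \<and> (\<forall>x\<in>D. u x = 1)"
proof -
  obtain u :: "'x \<Rightarrow> real" where u: "continuous_map euclidean (top_of_set {0..1}) u"
    "u ` C \<subseteq> {0}" "u ` D \<subseteq> {1}"
    using Urysohn_lemma[of "euclidean :: 'x topology" C D 0 1] metrizable_imp_normal_space[OF X] C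
    by (auto simp: disjnt_def)
  have "continuous_on UNIV u" "u ` UNIV \<subseteq> {0..1}"
    using u(1) by (auto simp: continuous_map_in_subtopology)
  then show ?thesis using u(2,3) by (intro exI[of _ u]) (auto simp: image_subset_iff)
qed

locale metrizable_c0_rep = c0_rep H \<pi>
  for H :: "'a::chilbert set" and \<pi> :: "('x::t2_space \<Rightarrow> complex) \<Rightarrow> 'a \<Rightarrow> 'a" +
  assumes metrizable: "metrizable_space (euclidean :: 'x topology)"
begin

text \<open>
  By Urysohn's lemma a function vanishing on \<open>C \<inter> D\<close> is, up to a small error, the sum of one vanishing on \<open>C\<close> and
  one vanishing on \<open>D\<close>.
\<close>
lemma sspace_Int:
  assumes C: "closed C" and D: "closed D"
  shows "sspace (C \<inter> D) = sspace C \<inter> sspace D"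
proof
  show "sspace C \<inter> sspace D \<subseteq> sspace (C \<inter> D)"
  proof
    fix h assume h: "h \<in> sspace C \<inter> sspace D"
    then have hH: "h \<in> H" using sspace_subset by auto
    have "\<pi> f h = 0" if f: "f \<in> C0" "\<forall>x\<in>C \<inter> D. f x = 0" for f
    proof (rule eq_0_if_soft_threshold_eq_0[OF f(1) hH])
      fix e :: real assume e: "e > 0"
      let ?g = "soft_threshold e f"
      have g: "?g \<in> C0" by (rule soft_threshold_C0[OF f(1) e])
      define S where "S = {x. e \<le> cmod (f x)}"
      have "closed S" unfolding S_def using f e by (auto simp: C0_def intro: compact_imp_closed)
      then have "closed (D \<inter> S)" using D by auto
      moreover have "C \<inter> (D \<inter> S) = {}" using f e by (auto simp: S_def)
      ultimately obtain u :: "'x \<Rightarrow> real" where u: "continuous_on UNIV u" "\<And>x. 0 \<le> u x" "\<And>x. u x \<le> 1"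
        "\<And>x. x \<in> C \<Longrightarrow> u x = 0" "\<And>x. x \<in> D \<inter> S \<Longrightarrow> u x = 1"
        using urysohn_function[OF metrizable C, of "D \<inter> S"] by metis
      have g1: "(\<lambda>x. ?g x * complex_of_real (u x)) \<in> C0"
        by (rule C0_mult_bounded[OF g, where B = 1]) (use u in \<open>auto intro!: continuous_intros\<close>)
      have g2: "(\<lambda>x. ?g x * complex_of_real (1 - u x)) \<in> C0"
        by (rule C0_mult_bounded[OF g, where B = 1])
          (use u in \<open>auto intro!: continuous_intros simp del: of_real_diff\<close>)
      have "\<pi> (\<lambda>x. ?g x * complex_of_real (u x)) h = 0"
        using h g1 u by (auto simp: sspace_def)
      moreover have "?g x * complex_of_real (1 - u x) = 0" if "x \<in> D" for x
        using u(5)[of x] that soft_threshold_eq_0[of f x e] by (cases "e \<le> cmod (f x)") (auto simp: S_def)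
      then have "\<pi> (\<lambda>x. ?g x * complex_of_real (1 - u x)) h = 0"
        using h by (intro sspaceD[where C = D, OF _ g2]) auto
      moreover have "?g = (\<lambda>x. ?g x * complex_of_real (u x) + ?g x * complex_of_real (1 - u x))"
        by (simp add: fun_eq_iff algebra_simps)
      ultimately show "\<pi> ?g h = 0"
        using add_fun[OF g1 g2 hH] by simp
    qed
    then show "h \<in> sspace (C \<inter> D)" using hH by (auto simp: sspace_def)
  qed
qed (auto intro: sspace_mono[THEN subsetD])

text \<open>
  A thresholded \<open>f\<close> vanishing on the intersection already vanishes on some \<open>K\<^sub>j\<close>, by compactness.
\<close>
lemma sspace_Inter_compact:
  assumes K: "\<And>j::nat. compact (K j)" and dec: "\<And>j. K (Suc j) \<subseteq> K j"
  shows "(\<Inter>j. sspace (K j)) \<subseteq> sspace (\<Inter>j. K j)"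
proof
  fix h assume h: "h \<in> (\<Inter>j. sspace (K j))"
  then have hH: "h \<in> H" using sspace_subset by blast
  have mono: "K k \<subseteq> K j" if "j \<le> k" for j k
    using lift_Suc_antimono_le[of K, OF dec that] .
  have "\<pi> f h = 0" if f: "f \<in> C0" "\<forall>x\<in>(\<Inter>j. K j). f x = 0" for f
  proof (rule eq_0_if_soft_threshold_eq_0[OF f(1) hH])
    fix e :: real assume e: "e > 0"
    define S where "S = {x. e \<le> cmod (f x)}"
    have S: "compact S" unfolding S_def using f e by (auto simp: C0_def)
    have "S \<inter> (\<Inter>j\<in>UNIV. K j) = {}" using f(2) e by (auto simp: S_def)
    then obtain J where J: "finite J" "S \<inter> (\<Inter>j\<in>J. K j) = {}"
      using compact_imp_fip_image[OF S, of UNIV K] K compact_imp_closed by blast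
    define m where "m = Max (insert 0 J)"
    have "j \<le> m" if "j \<in> J" for j using J(1) that by (simp add: m_def)
    then have "K m \<subseteq> (\<Inter>j\<in>J. K j)" using mono by blast
    then have "soft_threshold e f x = 0" if "x \<in> K m" for x
      using J(2) that by (intro soft_threshold_eq_0) (force simp: S_def not_le[symmetric])
    then show "\<pi> (soft_threshold e f) h = 0"
      using h soft_threshold_C0[OF f(1) e] by (auto simp: sspace_def)
  qed
  then show "h \<in> sspace (\<Inter>j. K j)" using hH by (auto simp: sspace_def)
qed

text \<open>The range of the spectral projection of \<open>A\<close>; inner regularity is built in.\<close>
definition espace :: "'x set \<Rightarrow> 'a set" where
  "espace A = closure (\<Union>{sspace K |K. compact K \<and> K \<subseteq> A})"

lemma sspace_subset_espace: "compact K \<Longrightarrow> K \<subseteq> A \<Longrightarrow> sspace K \<subseteq> espace A"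
  unfolding espace_def by (rule order_trans[OF _ closure_subset]) blast

lemma espace_approx:
  assumes "h \<in> espace A" "e > 0"
  obtains K where "compact K" "K \<subseteq> A" "norm (h - proj_onto (sspace K) h) < e"
proof -
  obtain k K where K: "compact K" "K \<subseteq> A" "k \<in> sspace K" "dist k h < e"
    using assms unfolding espace_def closure_approachable by blast
  have "norm (h - proj_onto (sspace K) h) \<le> norm (h - k)"
    by (rule proj_closest[OF closed_csubspace_sspace K(3)])
  then show ?thesis using K that[of K] by (simp add: dist_norm norm_minus_commute)
qed

lemma central_espace: "central (espace A)"
proof -
  let ?U = "\<Union>{sspace K |K. compact K \<and> K \<subseteq> A}"
  have add: "x + y \<in> ?U" if xy: "x \<in> ?U" "y \<in> ?U" for x y
  proof -
    obtain K L where KL: "compact K" "K \<subseteq> A" "x \<in> sspace K" "compact L" "L \<subseteq> A" "y \<in> sspace L"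
      using xy by blast
    have "x \<in> sspace (K \<union> L)" "y \<in> sspace (K \<union> L)" using KL(3,6) sspace_mono[OF Un_upper1[of K L]] sspace_mono[OF Un_upper2[of L K]] by blast+
    then have "x + y \<in> sspace (K \<union> L)" by (rule closed_csubspaceD(3)[OF closed_csubspace_sspace])
    moreover have "compact (K \<union> L)" "K \<union> L \<subseteq> A" using KL by auto
    ultimately show ?thesis by blast
  qed
  have "closed_csubspace (espace A)"
    unfolding espace_def
  proof (rule closed_csubspace_closure)
    have "0 \<in> sspace {}" by (simp add: sspace_empty)
    then show "0 \<in> ?U" using compact_empty by blast
    show "c *\<^sub>C x \<in> ?U" if "x \<in> ?U" for c x
      using that closed_csubspaceD(4)[OF closed_csubspace_sspace] by blast
  qed (rule add)
  moreover have UH: "?U \<subseteq> H" using sspace_subset by blast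
  then have "espace A \<subseteq> H" unfolding espace_def by (rule closure_minimal[OF _ HD(1)])
  moreover have "\<pi> f h \<in> espace A" if f: "f \<in> C0" and h: "h \<in> espace A" for f h
  proof -
    obtain u where u: "\<And>k. u k \<in> ?U" "u \<longlonglongrightarrow> h"
      using h unfolding espace_def closure_sequential by blast
    have "(\<lambda>k. \<pi> f (u k)) \<longlonglongrightarrow> \<pi> f h" using u UH by (intro tendsto_vec f) auto
    moreover have "\<pi> f (u k) \<in> ?U" for k using u(1)[of k] centralD(5)[OF central_sspace f] by blast
    ultimately show ?thesis
      unfolding espace_def closure_sequential by (intro exI[of _ "\<lambda>k. \<pi> f (u k)"]) blast
  qed
  moreover have "proj_onto Q h \<in> espace A" if Q: "reducing Q" and h: "h \<in> espace A" for Q h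
  proof -
    obtain u where u: "\<And>k. u k \<in> ?U" "u \<longlonglongrightarrow> h"
      using h unfolding espace_def closure_sequential by blast
    have "closed_csubspace Q" using Q by (simp add: reducing_def)
    then have "(\<lambda>k. proj_onto Q (u k)) \<longlonglongrightarrow> proj_onto Q h"
      using u(2) bounded_linear.tendsto[OF bounded_linear_proj] by blast
    moreover have "proj_onto Q (u k) \<in> ?U" for k
      using u(1)[of k] central_proj_mem[OF central_sspace Q] by blast
    ultimately show ?thesis
      unfolding espace_def closure_sequential by (intro exI[of _ "\<lambda>k. proj_onto Q (u k)"]) blast
  qed
  ultimately show ?thesis unfolding central_def reducing_def by blast
qed

lemmas closed_csubspace_espace = centralD(1)[OF central_espace]
lemmas espace_subset_H = centralD(2)[OF central_espace]

lemma espace_mono: "A \<subseteq> B \<Longrightarrow> espace A \<subseteq> espace B"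
  unfolding espace_def by (rule closure_mono) blast

text \<open>
  If \<open>u\<close> is orthogonal to the reducing space \<open>espace A\<close> then so is every \<open>\<pi>(f) u\<close>; what is also
  contained in that space vanishes.
\<close>
lemma orth_if_all_thresholds:
  assumes u: "u \<in> H" "\<And>z. z \<in> espace A \<Longrightarrow> cinner u z = 0" and f: "f \<in> C0"
    and "\<And>e. e > 0 \<Longrightarrow> \<pi> (soft_threshold e f) u \<in> espace A"
  shows "\<pi> f u = 0"
proof (rule eq_0_if_soft_threshold_eq_0[OF f u(1)])
  fix e :: real assume e: "e > 0"
  have "cinner (\<pi> (soft_threshold e f) u) z = 0" if "z \<in> espace A" for z
    by (rule orth_invariant[OF centralD(3)[OF central_espace] soft_threshold_C0[OF f e] u that])
  then show "\<pi> (soft_threshold e f) u = 0" using assms(4)[OF e] cinner_self_eq_0 by blast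
qed

text \<open>
  The part of \<open>h \<in> R(C)\<close> orthogonal to \<open>espace C\<close> is moved by thresholded functions into \<open>R(K)\<close> with
  \<open>K \<subseteq> C\<close> compact, hence annihilated by all functions.
\<close>
lemma espace_closed:
  assumes C: "closed C"
  shows "espace C = sspace C"
proof
  show "espace C \<subseteq> sspace C"
    unfolding espace_def
  proof (rule closure_minimal)
    show "\<Union>{sspace K |K. compact K \<and> K \<subseteq> C} \<subseteq> sspace C"
      using sspace_mono[of _ C] by (auto dest: subsetD)
  qed (rule closed_csubspaceD(1)[OF closed_csubspace_sspace])
  show "sspace C \<subseteq> espace C"
  proof
    fix h assume h: "h \<in> sspace C"
    define p where "p = proj_onto (espace C) h"
    have p: "p \<in> espace C" unfolding p_def by (rule proj_in[OF closed_csubspace_espace])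
    have u: "h - p \<in> sspace C"
      using closed_csubspaceD(7)[OF closed_csubspace_sspace h] p \<open>espace C \<subseteq> sspace C\<close> by auto
    have uH: "h - p \<in> H" using u sspace_subset by auto
    have "\<pi> f (h - p) = 0" if f: "f \<in> C0" for f
    proof (rule orth_if_all_thresholds[OF uH _ f])
      show "cinner (h - p) z = 0" if "z \<in> espace C" for z
        unfolding p_def by (rule proj_orth[OF closed_csubspace_espace that])
      fix e :: real assume e: "e > 0"
      let ?t = "soft_threshold e f" and ?S = "{x. e \<le> cmod (f x)}"
      have t: "?t \<in> C0" by (rule soft_threshold_C0[OF f e])
      have "\<pi> ?t (h - p) \<in> sspace (C \<inter> ?S)"
        unfolding sspace_def
      proof (intro CollectI conjI ballI impI)
        show "\<pi> ?t (h - p) \<in> H" by (rule mem[OF t uH])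
        fix g assume g: "g \<in> C0" "\<forall>x\<in>C \<inter> ?S. g x = 0"
        have "g x * ?t x = 0" if "x \<in> C" for x
          using g(2) that soft_threshold_eq_0[of f x e] by (cases "e \<le> cmod (f x)") auto
        then have "\<pi> (\<lambda>x. g x * ?t x) (h - p) = 0"
          by (rule sspaceD[OF u C0_mult[OF g(1) t]])
        then show "\<pi> g (\<pi> ?t (h - p)) = 0" by (simp only: mult[OF g(1) t uH])
      qed
      moreover have "compact (C \<inter> ?S)"
        using f e C by (auto simp: C0_def intro: closed_Int_compact)
      ultimately show "\<pi> ?t (h - p) \<in> espace C" using sspace_subset_espace[of "C \<inter> ?S" C] by auto
    qed
    then have "h - p = 0" using nondeg[OF uH] by blast
    then show "h \<in> espace C" using p by simp
  qed
qed

text \<open>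
  In terms of projections this is \<open>E(A) + E(-A) = 1\<close>, the analogue of Caratheodory's criterion.
\<close>
definition measurable_set :: "'x set \<Rightarrow> bool" where
  "measurable_set A \<longleftrightarrow> (\<forall>u\<in>H. (\<forall>z\<in>espace A. cinner u z = 0) \<longrightarrow> (\<forall>z\<in>espace (- A). cinner u z = 0) \<longrightarrow> u = 0)"

lemma measurable_closed:
  assumes C: "closed C"
  shows "measurable_set C"
  unfolding measurable_set_def
proof (intro ballI impI)
  fix u assume u: "u \<in> H" "\<forall>z\<in>espace C. cinner u z = 0" "\<forall>z\<in>espace (- C). cinner u z = 0"
  have "\<pi> f u = 0" if f: "f \<in> C0" "\<forall>x\<in>C. f x = 0" for f
  proof (rule orth_if_all_thresholds[OF u(1) _ f(1)])
    show "cinner u z = 0" if "z \<in> espace (- C)" for z using u(3) that by blast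
    fix e :: real assume e: "e > 0"
    let ?t = "soft_threshold e f" and ?S = "{x. e \<le> cmod (f x)}"
    have t: "?t \<in> C0" by (rule soft_threshold_C0[OF f(1) e])
    have "\<pi> ?t u \<in> sspace ?S"
      unfolding sspace_def
    proof (intro CollectI conjI ballI impI)
      show "\<pi> ?t u \<in> H" by (rule mem[OF t u(1)])
      fix g assume g: "g \<in> C0" "\<forall>x\<in>?S. g x = 0"
      have "g x * ?t x = 0" for x
        using g(2) soft_threshold_eq_0[of f x e] by (cases "e \<le> cmod (f x)") auto
      then have "(\<lambda>x. g x * ?t x) = (\<lambda>x. 0)" by blast
      then have "\<pi> (\<lambda>x. g x * ?t x) u = 0" by (simp only: zero_fun[OF u(1)])
      then show "\<pi> g (\<pi> ?t u) = 0" by (simp only: mult[OF g(1) t u(1)])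
    qed
    moreover have "compact ?S" using f e by (auto simp: C0_def)
    moreover have "?S \<subseteq> - C" using f e by auto
    ultimately show "\<pi> ?t u \<in> espace (- C)" using sspace_subset_espace[of ?S "- C"] by auto
  qed
  then have "u \<in> sspace C" using u(1) by (auto simp: sspace_def)
  then have "cinner u u = 0" using u(2) espace_closed[OF C] by blast
  then show "u = 0" by simp
qed

text \<open>
  Compact sets \<open>K\<^sub>j \<subseteq> B\<^sub>j\<close> that nearly carry \<open>h\<close>, with summable errors, have an intersection that
  nearly carries \<open>h\<close>.  The formula holds for arbitrary sets \<open>B\<^sub>j\<close>, and applied to complements it is the
  reason why measurability and additivity pass to countable unions.
\<close>
lemma espace_Inter:
  "(\<Inter>j::nat. espace (B j)) = espace (\<Inter>j. B j)"
proof
  show "espace (\<Inter>j. B j) \<subseteq> (\<Inter>j. espace (B j))"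
    by (intro INT_greatest espace_mono) auto
  show "(\<Inter>j. espace (B j)) \<subseteq> espace (\<Inter>j. B j)"
  proof
    fix h assume h: "h \<in> (\<Inter>j. espace (B j))"
    have "\<exists>y\<in>\<Union>{sspace K |K. compact K \<and> K \<subseteq> (\<Inter>j. B j)}. dist y h < e" if e: "e > 0" for e
    proof -
      \<comment> \<open>The errors sum up to \<open>e / 2\<close>.\<close>
      have "\<exists>K. compact K \<and> K \<subseteq> B j \<and> norm (h - proj_onto (sspace K) h) < e / 2 ^ (j + 2)" for j
      proof -
        have "h \<in> espace (B j)" "e / 2 ^ (j + 2) > 0" using h e by auto
        then show ?thesis by (rule espace_approx) blast
      qed
      then obtain K where K: "\<And>j. compact (K j)" "\<And>j. K j \<subseteq> B j"
        "\<And>j. norm (h - proj_onto (sspace (K j)) h) < e / 2 ^ (j + 2)" by metis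
      define L where "L m = (\<Inter>j\<le>m. K j)" for m
      have L_Suc: "L (Suc m) = L m \<inter> K (Suc m)" for m by (auto simp: L_def atMost_Suc)
      have L: "compact (L m)" for m
        by (induction m) (auto simp: L_Suc K compact_Int, simp add: L_def K)
      note cs = closed_csubspace_sspace
      have P: "proj_onto (sspace (L (Suc m))) x = proj_onto (sspace (K (Suc m))) (proj_onto (sspace (L m)) x)" for m x
        unfolding L_Suc sspace_Int[OF compact_imp_closed[OF L] compact_imp_closed[OF K(1)]]
        by (rule proj_Int[OF cs cs]) (rule centralD(4)[OF central_sspace centralD(3)[OF central_sspace]])
      have le: "norm (h - proj_onto (sspace (L m)) h) \<le> e / 2 - e / 2 ^ (m + 2)" for m
      proof (induction m)
        case 0
        have "L 0 = K 0" by (simp add: L_def)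
        then show ?case using K(3)[of 0] by simp
      next
        case (Suc m)
        let ?P = "proj_onto (sspace (K (Suc m)))" and ?Q = "proj_onto (sspace (L m))"
        have "h - ?P (?Q h) = (h - ?P h) + ?P (h - ?Q h)" by (simp add: proj_diff[OF cs])
        then have "norm (h - ?P (?Q h)) \<le> norm (h - ?P h) + norm (?P (h - ?Q h))"
          by (simp only: norm_triangle_ineq)
        also have "\<dots> \<le> norm (h - ?P h) + norm (h - ?Q h)" by (intro add_left_mono proj_norm_le cs)
        also have "\<dots> \<le> e / 2 ^ (Suc m + 2) + (e / 2 - e / 2 ^ (m + 2))"
          using K(3)[of "Suc m"] Suc.IH by linarith
        also have "\<dots> = e / 2 - e / 2 ^ (Suc m + 2)" by (simp add: field_simps)
        finally show ?case by (simp add: P)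
      qed
      define y where "y = proj_onto (\<Inter>m. sspace (L m)) h"
      have lim: "(\<lambda>m. proj_onto (sspace (L m)) h) \<longlonglongrightarrow> y"
        unfolding y_def by (rule decreasing_proj_tendsto[OF cs], rule sspace_mono) (simp add: L_Suc)
      have "norm (h - y) \<le> e / 2"
      proof (rule LIMSEQ_le_const2)
        show "(\<lambda>m. norm (h - proj_onto (sspace (L m)) h)) \<longlonglongrightarrow> norm (h - y)" by (intro tendsto_intros lim)
        have "norm (h - proj_onto (sspace (L m)) h) \<le> e / 2" for m
        proof -
          have "e / 2 ^ (m + 2) \<ge> 0" using e by simp
          then show ?thesis using le[of m] by linarith
        qed
        then show "\<exists>N. \<forall>m\<ge>N. norm (h - proj_onto (sspace (L m)) h) \<le> e / 2" by blast
      qed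
      then have "dist y h < e" using e by (simp add: dist_norm norm_minus_commute)
      moreover have "y \<in> sspace (\<Inter>m. L m)"
      proof -
        have "closed_csubspace (\<Inter>m. sspace (L m))" using cs by (intro closed_csubspace_Inter) auto
        then have "y \<in> (\<Inter>m. sspace (L m))" unfolding y_def by (rule proj_in)
        then show ?thesis using sspace_Inter_compact[of L] L L_Suc by blast
      qed
      moreover have "compact (\<Inter>m. L m)"
      proof -
        have "closed (\<Inter>m. L m)" using L compact_imp_closed by blast
        then have "compact (L 0 \<inter> (\<Inter>m. L m))" by (rule compact_Int_closed[OF L])
        moreover have "L 0 \<inter> (\<Inter>m. L m) = (\<Inter>m. L m)" by auto
        ultimately show ?thesis by simp
      qed
      moreover have "(\<Inter>m. L m) \<subseteq> (\<Inter>j. B j)" using K(2) by (fastforce simp: L_def)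
      ultimately show ?thesis by blast
    qed
    then show "h \<in> espace (\<Inter>j. B j)" unfolding espace_def closure_approachable by blast
  qed
qed

lemma espace_Int: "espace (A \<inter> B) = espace A \<inter> espace B"
proof -
  let ?B = "\<lambda>j::nat. if j = 0 then A else B"
  have "(\<Inter>j. ?B j) = A \<inter> B" "(\<Inter>j. espace (?B j)) = espace A \<inter> espace B"
    by (auto split: if_splits)
  then show ?thesis using espace_Inter[of ?B] by simp
qed

lemma measurable_Compl: "measurable_set A \<Longrightarrow> measurable_set (- A)"
  by (auto simp: measurable_set_def)

abbreviation E :: "'x set \<Rightarrow> 'a \<Rightarrow> 'a" where "E A \<equiv> proj_onto (espace A)"

lemma espace_empty: "espace {} = {0}"
  by (simp add: espace_closed sspace_empty)

sublocale E: spectral_content H \<pi> espace "Collect measurable_set"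
  by unfold_locales (use central_espace espace_Int espace_empty in \<open>auto simp: measurable_set_def\<close>)

text \<open>
  A vector orthogonal to the range for the union lies in the range for every \<open>- A\<^sub>j\<close>, hence, by the
  formula for countable intersections, in the range for the complement of the union.
\<close>
lemma measurable_Union:
  assumes A: "\<And>j::nat. measurable_set (A j)"
  shows "measurable_set (\<Union>j. A j)"
  unfolding measurable_set_def
proof (intro ballI impI)
  fix u assume u: "u \<in> H" "\<forall>z\<in>espace (\<Union>j. A j). cinner u z = 0" "\<forall>z\<in>espace (- (\<Union>j. A j)). cinner u z = 0"
  have "u \<in> espace (- A j)" for j
  proof -
    have "E (A j) u = 0"
      using u(2) espace_mono[of "A j" "\<Union>j. A j"] by (intro proj_eq_0[OF closed_csubspace_espace]) blast
    then have "u = E (- A j) u" using E.P_Compl[OF _ u(1), of "A j"] A by simp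
    then show ?thesis by (metis proj_in[OF closed_csubspace_espace])
  qed
  then have "u \<in> espace (\<Inter>j. - A j)" using espace_Inter[of "\<lambda>j. - A j"] by blast
  then show "u = 0" using u(3) by (metis Compl_UN cinner_self_eq_0)
qed

lemma measurable_borel: "A \<in> sets borel \<Longrightarrow> measurable_set A"
proof -
  assume "A \<in> sets borel"
  then have "A \<in> sigma_sets UNIV {S. open S}" by (simp add: borel_def)
  then show ?thesis
  proof (induction rule: sigma_sets.induct)
    case (Basic a)
    then have "measurable_set (- (- a))" by (intro measurable_Compl measurable_closed) auto
    then show ?case by simp
  next
    case Empty
    show ?case by (rule measurable_closed) simp
  next
    case (Compl a)
    then show ?case using measurable_Compl by (simp add: Compl_eq_Diff_UNIV)
  next
    case (Union a)
    then show ?case by (intro measurable_Union)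
  qed
qed

text \<open>
  The remainders of the series are the projections for a decreasing sequence of complements.
\<close>
lemma E_sums:
  assumes A: "range (A :: nat \<Rightarrow> 'x set) \<subseteq> sets borel" and dis: "disjoint_family A" and h: "h \<in> H"
  shows "(\<lambda>k. E (A k) h) sums E (\<Union>k. A k) h"
proof -
  define C where "C m = - (\<Union>k<m. A k)" for m
  have C: "(\<Union>k<m. A k) \<in> sets borel" for m using A by auto
  have "(\<lambda>m. E (C m) h) \<longlonglongrightarrow> proj_onto (\<Inter>m. espace (C m)) h"
    by (rule decreasing_proj_tendsto[OF closed_csubspace_espace])
      (auto simp: C_def less_Suc_eq intro!: espace_mono)
  also have "(\<Inter>m. espace (C m)) = espace (- (\<Union>k. A k))"
  proof -
    have "(\<Inter>m. C m) = - (\<Union>k. A k)" by (auto simp: C_def)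
    then show ?thesis by (simp add: espace_Inter)
  qed
  finally have "(\<lambda>m. h - E (C m) h) \<longlonglongrightarrow> h - E (- (\<Union>k. A k)) h" by (intro tendsto_intros)
  moreover have "h - E (- (\<Union>k. A k)) h = E (\<Union>k. A k) h"
    using E.P_Compl[OF _ h, of "\<Union>k. A k"] measurable_borel[of "\<Union>k. A k"] A by (simp add: algebra_simps)
  moreover have "h - E (C m) h = (\<Sum>k<m. E (A k) h)" for m
  proof -
    have "(\<Sum>k<m. E (A k) h) = E (\<Union>k<m. A k) h"
      using A dis measurable_borel by (intro E.P_sum[symmetric]) (auto intro: disjoint_family_on_mono)
    then show ?thesis
      using E.P_Compl[OF _ h, of "\<Union>k<m. A k"] measurable_borel[OF C, of m] unfolding C_def by (simp only: eq_diff_eq diff_eq_eq mem_Collect_eq)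
  qed
  ultimately show ?thesis by (simp add: sums_def)
qed

lemma is_projection_E: "is_projection H (E A)"
proof -
  have "E A h \<in> H" for h using proj_in[OF closed_csubspace_espace] espace_subset_H by blast
  then show ?thesis
    unfolding is_projection_def bounded_op_def clinear_on_def
    using proj_norm_le[OF closed_csubspace_espace, of A]
    by (auto simp: proj_add[OF closed_csubspace_espace] proj_scaleC[OF closed_csubspace_espace]
        proj_id[OF closed_csubspace_espace proj_in[OF closed_csubspace_espace]]
        proj_sym[OF closed_csubspace_espace] intro!: exI[of _ 1])
qed

lemma spectral_measure_E: "spectral_measure H E"
  unfolding spectral_measure_def
  using is_projection_E E.P_Int E_sums proj_id[OF H] espace_closed[of UNIV] sspace_UNIV by auto

lemma sets_scalar_measure: "sets (scalar_measure F h) = sets borel"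
  unfolding scalar_measure_def by (simp add: sets.sigma_sets_eq[of borel, simplified])

lemma space_scalar_measure: "space (scalar_measure F h) = UNIV"
  by (simp add: scalar_measure_def space_measure_of_conv)

lemma Re_cinner_E: "Re (cinner (E A h) h) = (norm (E A h))\<^sup>2"
  using proj_cinner(1)[OF closed_csubspace_espace, of A h h] by (simp add: cinner_self)

lemma emeasure_scalar_measure:
  assumes h: "h \<in> H" and A: "A \<in> sets borel"
  shows "emeasure (scalar_measure E h) A = ennreal ((norm (E A h))\<^sup>2)"
proof -
  have "countably_additive (sets (scalar_measure E h)) (\<lambda>A. ennreal (Re (cinner (E A h) h)))"
    unfolding countably_additive_def sets_scalar_measure
  proof (intro allI impI)
    fix B :: "nat \<Rightarrow> 'x set"
    assume B: "range B \<subseteq> sets borel" "disjoint_family B"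
    have "(\<lambda>k. cinner (E (B k) h) h) sums cinner (E (\<Union>k. B k) h) h"
      by (rule bounded_linear.sums[OF bounded_linear_cinner_left E_sums[OF B h]])
    then have "(\<lambda>k. Re (cinner (E (B k) h) h)) sums Re (cinner (E (\<Union>k. B k) h) h)"
      by (rule sums_Re)
    then show "(\<Sum>k. ennreal (Re (cinner (E (B k) h) h))) = ennreal (Re (cinner (E (\<Union>k. B k) h) h))"
      by (intro suminf_ennreal_eq) (simp_all only: Re_cinner_E zero_le_power2)
  qed
  moreover have "positive (sets (scalar_measure E h)) (\<lambda>A. ennreal (Re (cinner (E A h) h)))"
    by (simp add: positive_def E.P_empty)
  ultimately have "emeasure (scalar_measure E h) A = ennreal (Re (cinner (E A h) h))"
    using A by (intro emeasure_measure_of[OF scalar_measure_def]) (auto simp: sets_scalar_measure)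
  then show ?thesis by (simp only: Re_cinner_E)
qed

lemma scalar_measure_regular:
  assumes h: "h \<in> H" and A: "A \<in> sets borel"
  shows "emeasure (scalar_measure E h) A
    = (SUP K\<in>{K. K \<subseteq> A \<and> compact K}. emeasure (scalar_measure E h) K)"
proof (rule antisym)
  show "(SUP K\<in>{K. K \<subseteq> A \<and> compact K}. emeasure (scalar_measure E h) K) \<le> emeasure (scalar_measure E h) A"
    using A by (intro SUP_least emeasure_mono) (auto simp: sets_scalar_measure)
  let ?S = "SUP K\<in>{K. K \<subseteq> A \<and> compact K}. emeasure (scalar_measure E h) K"
  define a where "a = norm (E A h)"
  have le: "ennreal ((max 0 (a - e))\<^sup>2) \<le> ?S" if e: "e > 0" for e
  proof -
    obtain K where K: "compact K" "K \<subseteq> A" "norm (E A h - proj_onto (sspace K) (E A h)) < e"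
      using espace_approx[OF proj_in[OF closed_csubspace_espace] e] by blast
    have "proj_onto (sspace K) (E A h) = E K (E A h)"
      by (simp add: espace_closed[OF compact_imp_closed[OF K(1)]])
    also have "\<dots> = E K h" using K(2) by (simp add: Int_absorb2 flip: E.P_Int)
    finally have "a - e \<le> norm (E K h)"
      using K(3) norm_triangle_ineq2[of "E A h" "E K h"] by (simp add: a_def)
    then have "(max 0 (a - e))\<^sup>2 \<le> (norm (E K h))\<^sup>2" by (intro power_mono) auto
    then have "ennreal ((max 0 (a - e))\<^sup>2) \<le> emeasure (scalar_measure E h) K"
      using emeasure_scalar_measure[OF h borel_compact[OF K(1)]] by (simp add: ennreal_leI)
    also have "\<dots> \<le> ?S" using K by (intro SUP_upper) auto
    finally show ?thesis .
  qed
  have "((\<lambda>e. ennreal ((max 0 (a - e))\<^sup>2)) \<longlongrightarrow> ennreal ((max 0 (a - 0))\<^sup>2)) (at_right 0)"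
    by (intro tendsto_intros)
  moreover have "\<forall>\<^sub>F e in at_right 0. ennreal ((max 0 (a - e))\<^sup>2) \<le> ?S"
    using le by (intro eventually_at_rightI[of 0 1]) auto
  ultimately have "ennreal ((max 0 (a - 0))\<^sup>2) \<le> ?S"
    using tendsto_upperbound trivial_limit_at_right_real by blast
  moreover have "max 0 (a - 0) = a" by (simp add: a_def)
  ultimately show "emeasure (scalar_measure E h) A \<le> ?S"
    using emeasure_scalar_measure[OF h A] by (simp add: a_def)
qed

lemma local_estimate_espace:
  assumes f: "f \<in> C0" and h: "h \<in> espace A" and e: "e \<ge> 0"
    and close: "\<And>x. x \<in> A \<Longrightarrow> cmod (f x - c) \<le> e"
  shows "norm (\<pi> f h - c *\<^sub>C h) \<le> e * norm h"
proof -
  obtain u where u: "\<And>k::nat. u k \<in> \<Union>{sspace K |K. compact K \<and> K \<subseteq> A}" "u \<longlonglongrightarrow> h"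
    using h unfolding espace_def closure_sequential by blast
  have "u k \<in> H" for k using u(1)[of k] sspace_subset by blast
  then have 1: "(\<lambda>k. norm (\<pi> f (u k) - c *\<^sub>C u k)) \<longlonglongrightarrow> norm (\<pi> f h - c *\<^sub>C h)"
    using u(2) by (intro tendsto_norm tendsto_diff tendsto_vec f tendsto_scaleC)
  have 2: "(\<lambda>k. e * norm (u k)) \<longlonglongrightarrow> e * norm h" using u(2) by (intro tendsto_intros)
  have "norm (\<pi> f (u k) - c *\<^sub>C u k) \<le> e * norm (u k)" for k
  proof -
    obtain K where K: "K \<subseteq> A" "u k \<in> sspace K" using u(1)[of k] by blast
    show ?thesis by (rule local_estimate[OF f K(2) e]) (use K close in blast)
  qed
  then show ?thesis using LIMSEQ_le[OF 1 2] by blast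
qed

text \<open>
  Cut \<open>X\<close> into finitely many Borel cells on which \<open>f\<close> is almost constant.  On each cell both sides
  are close to that constant times the squared norm of the component of \<open>h\<close>.
\<close>
lemma cinner_eq_integral:
  assumes f: "f \<in> C0" and h: "h \<in> H"
  shows "cinner (\<pi> f h) h = (\<integral>x. f x \<partial>scalar_measure E h)"
proof -
  define M where "M = scalar_measure E h"
  have space[simp]: "space M = UNIV" and sets[simp]: "sets M = sets borel"
    by (simp_all add: M_def sets_scalar_measure space_scalar_measure)
  have emeas: "emeasure M A = ennreal ((norm (E A h))\<^sup>2)" if "A \<in> sets borel" for A
    unfolding M_def by (rule emeasure_scalar_measure[OF h that])
  have meas: "measure M A = (norm (E A h))\<^sup>2" if "A \<in> sets borel" for A
    unfolding measure_def emeas[OF that] by simp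
  have EU: "E UNIV h = h" using h by (simp add: espace_closed sspace_UNIV proj_id[OF H])
  interpret M: finite_measure M by (rule finite_measureI) (simp add: emeas)
  obtain B where B: "\<And>x. cmod (f x) \<le> B" using C0_bounded[OF f] by blast
  have fmeas: "f \<in> borel_measurable borel" using C0_continuous[OF f] by (rule borel_measurable_continuous_onI)
  then have fmeas': "f \<in> borel_measurable M" by (simp cong: measurable_cong_sets)
  have fint: "integrable M f" by (rule M.integrable_const_bound[where B=B]) (use B fmeas' in auto)
  have "cmod (cinner (\<pi> f h) h - (\<integral>x. f x \<partial>M)) \<le> d * (4 * (norm h)\<^sup>2)" if d: "d > 0" for d
  proof -
    define s where "s x = grid_index d (f x)" for x
    define P where "P = range s"
    have P: "finite P" unfolding P_def s_def by (rule finite_range_grid_index[OF d B])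
    define c where "c = grid_point d"
    have close: "cmod (f x - c (s x)) \<le> 2 * d" for x
      unfolding c_def s_def by (rule grid_point_close[OF d])
    define A where "A p = s -` {p}" for p
    have A: "A p \<in> sets borel" for p
    proof -
      have "A p = {x. \<lfloor>Re (f x) / d\<rfloor> = fst p \<and> \<lfloor>Im (f x) / d\<rfloor> = snd p}"
        by (auto simp: A_def s_def grid_index_def)
      also have "\<dots> \<in> sets borel" using fmeas by measurable
      finally show ?thesis .
    qed
    define k where "k p = E (A p) h" for p
    have kA: "k p \<in> espace (A p)" for p unfolding k_def by (rule proj_in[OF closed_csubspace_espace])
    have kH: "k p \<in> H" for p using kA espace_subset_H by blast
    have hsum: "h = (\<Sum>p\<in>P. k p)" and nsum: "(\<Sum>p\<in>P. (norm (k p))\<^sup>2) = (norm h)\<^sup>2"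
      using E.sum_cells[of s h] E.norm_sum_cells[of s h] P measurable_borel[OF A] h
      unfolding k_def P_def A_def by auto
    have pisum: "\<pi> f (\<Sum>p\<in>Q. k p) = (\<Sum>p\<in>Q. \<pi> f (k p))" if "finite Q" for Q
      using that by (induction Q) (auto simp: f add_vec kH closed_csubspace_sum[OF H])
    have "cinner (\<pi> f h) h = (\<Sum>p\<in>P. cinner (\<pi> f (k p)) h)"
      by (subst hsum) (simp add: pisum[OF P] cinner_sum_left)
    also have "\<dots> = (\<Sum>p\<in>P. cinner (\<pi> f (k p)) (k p))"
    proof (rule sum.cong[OF refl])
      fix p
      have "E (A p) (\<pi> f (k p)) = \<pi> f (k p)"
        by (rule proj_id[OF closed_csubspace_espace centralD(5)[OF central_espace f kA]])
      then show "cinner (\<pi> f (k p)) h = cinner (\<pi> f (k p)) (k p)"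
        using proj_sym[OF closed_csubspace_espace, of "A p" "\<pi> f (k p)" h] by (simp add: k_def)
    qed
    finally have 1: "cinner (\<pi> f h) h = (\<Sum>p\<in>P. cinner (\<pi> f (k p)) (k p))" .
    have cs: "(\<Sum>p\<in>P. indicator (A p) x *\<^sub>R c p) = c (s x)" for x
    proof -
      have "(\<Sum>p\<in>P. indicator (A p) x *\<^sub>R c p) = (\<Sum>p\<in>P. if p = s x then c p else 0)"
        by (intro sum.cong) (auto simp: A_def indicator_def)
      then show ?thesis using P by (simp add: P_def)
    qed
    have int: "integrable M (\<lambda>x. indicator (A p) x *\<^sub>R c p)" for p
      using A[of p] by (intro integrable_scaleR_left integrable_real_indicator) (auto simp: emeas)
    have gint: "integrable M (\<lambda>x. c (s x))"
      unfolding cs[symmetric] by (intro Bochner_Integration.integrable_sum int)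
    have val: "(\<integral>x. indicator (A p) x *\<^sub>R c p \<partial>M) = (norm (k p))\<^sup>2 *\<^sub>R c p" for p
    proof -
      have "integrable M (indicator (A p) :: 'x \<Rightarrow> real)"
        using A[of p] by (intro integrable_real_indicator) (auto simp: emeas)
      then show ?thesis using A[of p] by (simp add: meas k_def)
    qed
    have 2: "(\<integral>x. c (s x) \<partial>M) = (\<Sum>p\<in>P. (norm (k p))\<^sup>2 *\<^sub>R c p)"
      unfolding cs[symmetric] using int by (simp only: Bochner_Integration.integral_sum val)
    have "cmod (cinner (\<pi> f h) h - (\<Sum>p\<in>P. (norm (k p))\<^sup>2 *\<^sub>R c p))
        = cmod (\<Sum>p\<in>P. cinner (\<pi> f (k p) - c p *\<^sub>C k p) (k p))"
      unfolding 1 sum_subtractf[symmetric]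
      by (simp add: cinner_diff_left cinner_scaleC_left cinner_self scaleR_conv_of_real mult.commute)
    also have "\<dots> \<le> (\<Sum>p\<in>P. 2 * d * (norm (k p))\<^sup>2)"
    proof (rule sum_norm_le)
      fix p
      have "norm (\<pi> f (k p) - c p *\<^sub>C k p) \<le> 2 * d * norm (k p)"
      proof (rule local_estimate_espace[OF f kA])
        show "cmod (f x - c p) \<le> 2 * d" if "x \<in> A p" for x using close[of x] that by (simp add: A_def)
      qed (use d in simp)
      then have "norm (\<pi> f (k p) - c p *\<^sub>C k p) * norm (k p) \<le> 2 * d * norm (k p) * norm (k p)"
        by (intro mult_right_mono) auto
      then show "cmod (cinner (\<pi> f (k p) - c p *\<^sub>C k p) (k p)) \<le> 2 * d * (norm (k p))\<^sup>2"
        using norm_cinner_le[of "\<pi> f (k p) - c p *\<^sub>C k p" "k p"] by (simp add: power2_eq_square mult.assoc)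
    qed
    also have "\<dots> = 2 * d * (norm h)\<^sup>2" by (simp add: nsum flip: sum_distrib_left)
    finally have 3: "cmod (cinner (\<pi> f h) h - (\<integral>x. c (s x) \<partial>M)) \<le> 2 * d * (norm h)\<^sup>2"
      unfolding 2 .
    have "cmod ((\<integral>x. c (s x) \<partial>M) - (\<integral>x. f x \<partial>M)) = cmod (\<integral>x. c (s x) - f x \<partial>M)"
      using gint fint by simp
    also have "\<dots> \<le> (\<integral>x. cmod (c (s x) - f x) \<partial>M)" by (rule integral_norm_bound)
    also have "\<dots> \<le> (\<integral>x. 2 * d \<partial>M)"
    proof (rule integral_mono)
      show "integrable M (\<lambda>x. cmod (c (s x) - f x))"
        by (intro integrable_norm Bochner_Integration.integrable_diff gint fint)
      show "cmod (c (s x) - f x) \<le> 2 * d" for x using close[of x] by (simp add: norm_minus_commute)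
    qed simp
    also have "\<dots> = 2 * d * (norm h)\<^sup>2" by (simp add: meas EU)
    finally have 4: "cmod ((\<integral>x. c (s x) \<partial>M) - (\<integral>x. f x \<partial>M)) \<le> 2 * d * (norm h)\<^sup>2" .
    show ?thesis
      using norm_triangle_ineq[of "cinner (\<pi> f h) h - (\<integral>x. c (s x) \<partial>M)" "(\<integral>x. c (s x) \<partial>M) - (\<integral>x. f x \<partial>M)"] 3 4
      by simp
  qed
  then have "\<forall>\<^sub>F d in at_right 0. cmod (cinner (\<pi> f h) h - (\<integral>x. f x \<partial>M)) \<le> d * (4 * (norm h)\<^sup>2)"
    by (intro eventually_at_rightI[of 0 1]) auto
  moreover have "((\<lambda>d. d * (4 * (norm h)\<^sup>2)) \<longlongrightarrow> 0 * (4 * (norm h)\<^sup>2)) (at_right 0)"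
    by (intro tendsto_intros)
  ultimately have "cmod (cinner (\<pi> f h) h - (\<integral>x. f x \<partial>M)) \<le> 0 * (4 * (norm h)\<^sup>2)"
    using tendsto_lowerbound trivial_limit_at_right_real by blast
  then show ?thesis by (simp add: M_def)
qed

theorem spectral_measure_of_rep_E: "spectral_measure_of_rep H \<pi> E"
  unfolding spectral_measure_of_rep_def
  using spectral_measure_E scalar_measure_regular cinner_eq_integral by blast

end

section \<open>Boolean homomorphisms below a subadditive content\<close>

text \<open>
  With commuting projections both conditions say that \<open>h\<close> lies in \<open>M \<or> N\<close>.
\<close>
lemma orth_swap:
  assumes M: "closed_csubspace M" and N: "closed_csubspace N" and NM: "proj_onto N ` M \<subseteq> M"
    and h: "h - proj_onto N h \<in> M"
  shows "h - proj_onto M h \<in> N"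
proof -
  have "h - proj_onto N h = proj_onto M (h - proj_onto N h)" using h by (simp add: proj_id[OF M])
  also have "\<dots> = proj_onto M h - proj_onto N (proj_onto M h)"
    by (simp add: proj_diff[OF M] proj_commute[OF M N NM])
  finally have "h - proj_onto M h = proj_onto N h - proj_onto N (proj_onto M h)"
    by (simp add: algebra_simps)
  then show ?thesis using closed_csubspaceD(7)[OF N] proj_in[OF N] by metis
qed

context c0_rep
begin

text \<open>
  The last clause is \<open>p(A \<union> B) \<le> p(A) \<or> p(B)\<close>, expressed through the projection onto \<open>p(A)\<close>.
\<close>
definition subadditive_content :: "('y set \<Rightarrow> 'a set) \<Rightarrow> bool" where
  "subadditive_content p \<longleftrightarrow> (\<forall>A. central (p A)) \<and> p {} = {0} \<and> p UNIV = H \<and> mono p \<and>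
     (\<forall>A B. \<forall>h\<in>p (A \<union> B). h - proj_onto (p A) h \<in> p B)"

lemma subadditive_contentD:
  assumes "subadditive_content p"
  shows "central (p A)" "p {} = {0}" "p UNIV = H" "A \<subseteq> B \<Longrightarrow> p A \<subseteq> p B"
    "h \<in> p (A \<union> B) \<Longrightarrow> h - proj_onto (p A) h \<in> p B"
  using assms by (auto simp: subadditive_content_def dest: monoD)

lemma proj_reducing_mem:
  assumes "central M" "reducing N" "h \<in> M"
  shows "h - proj_onto N h \<in> M"
  using closed_csubspaceD(7)[OF centralD(1)[OF assms(1)] assms(3) central_proj_mem[OF assms]] .

text \<open>
  The point is the distributive law \<open>(\<Inter>\<^sub>p p(A)) \<or> (\<Inter>\<^sub>q q(B)) = \<Inter>\<^sub>p \<Inter>\<^sub>q (p(A) \<or> q(B))\<close> of the Boolean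
  algebra, where \<open>p\<close> and \<open>q\<close> range over the chain: if \<open>r\<close> is the smaller of \<open>p\<close> and \<open>q\<close> then
  \<open>r(A \<union> B) \<le> r(A) \<or> r(B) \<le> p(A) \<or> q(B)\<close>.
\<close>
lemma subadditive_content_chain_Inf:
  assumes C: "\<And>p. p \<in> C \<Longrightarrow> subadditive_content p" and ne: "C \<noteq> {}"
    and chain: "\<And>p q. p \<in> C \<Longrightarrow> q \<in> C \<Longrightarrow> p \<le> q \<or> q \<le> p"
  shows "subadditive_content (\<lambda>A. \<Inter>p\<in>C. p A)"
  unfolding subadditive_content_def
proof (intro conjI allI ballI)
  have cen: "central (\<Inter>p\<in>C. p A)" for A
    using ne subadditive_contentD(1)[OF C] by (intro central_Inter) auto
  then show "\<And>A. central (\<Inter>p\<in>C. p A)" .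
  show "(\<Inter>p\<in>C. p {}) = {0}" using ne subadditive_contentD(2)[OF C] by auto
  show "(\<Inter>p\<in>C. p UNIV) = H" using ne subadditive_contentD(3)[OF C] by auto
  show "mono (\<lambda>A. \<Inter>p\<in>C. p A)"
  proof (rule monoI)
    fix A B :: "'b set" assume "A \<subseteq> B"
    then have "p A \<subseteq> p B" if "p \<in> C" for p by (rule subadditive_contentD(4)[OF C[OF that]])
    then show "(\<Inter>p\<in>C. p A) \<subseteq> (\<Inter>p\<in>C. p B)" by blast
  qed
  fix A B h assume h: "h \<in> (\<Inter>p\<in>C. p (A \<union> B))"
  have 1: "h - proj_onto (p A) h \<in> q B" if p: "p \<in> C" and q: "q \<in> C" for p q
    using chain[OF p q]
  proof
    assume "p \<le> q"
    then have "p B \<subseteq> q B" by (simp add: le_fun_def)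
    moreover have "h - proj_onto (p A) h \<in> p B"
      by (rule subadditive_contentD(5)[OF C[OF p]]) (use h p in auto)
    ultimately show ?thesis by auto
  next
    assume "q \<le> p"
    then have sub: "q A \<subseteq> p A" by (simp add: le_fun_def)
    note cp = subadditive_contentD(1)[OF C[OF p], of A] and cq = subadditive_contentD(1)[OF C[OF q]]
    define v where "v = h - proj_onto (q A) h"
    have v: "v \<in> q B" unfolding v_def by (rule subadditive_contentD(5)[OF C[OF q]]) (use h q in auto)
    have "proj_onto (p A) (proj_onto (q A) h) = proj_onto (q A) h"
      using proj_in[OF centralD(1)[OF cq], of A h] sub by (intro proj_id[OF centralD(1)[OF cp]]) auto
    then have "h - proj_onto (p A) h = v - proj_onto (p A) v"
      by (simp add: v_def proj_diff[OF centralD(1)[OF cp]])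
    then show ?thesis using proj_reducing_mem[OF cq centralD(3)[OF cp] v] by simp
  qed
  let ?M = "\<Inter>p\<in>C. p A" and ?N = "\<Inter>p\<in>C. p B"
  have "h - proj_onto (p A) h \<in> ?N" if "p \<in> C" for p using 1[OF that] by blast
  then have "h - proj_onto ?N h \<in> p A" if "p \<in> C" for p
    using that cen[of B] subadditive_contentD(1)[OF C[OF that], of A]
    by (intro orth_swap[of ?N "p A" h] centralD(1,3,4)) auto
  then have "h - proj_onto ?N h \<in> ?M" by blast
  then show "h - proj_onto ?M h \<in> ?N"
    by (intro orth_swap[of ?M ?N h] centralD(1)[OF cen] centralD(4)[OF cen centralD(3)[OF cen]])
qed

text \<open>
  Cutting a content at \<open>A\<close>: below \<open>p A\<close> only the part inside \<open>A\<close> is kept.  In the language of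
  projections this is \<open>p(B \<inter> A) \<or> (p(B) \<and> p(A)\<^sup>\<bottom>)\<close>.
\<close>
definition cut_content :: "('y set \<Rightarrow> 'a set) \<Rightarrow> 'y set \<Rightarrow> 'y set \<Rightarrow> 'a set" where
  "cut_content p A B = {h \<in> p B. proj_onto (p A) h \<in> p (B \<inter> A)}"

text \<open>
  Subadditivity rests on the formula \<open>P(B \<inter> A) + P(B) (1 - P(A))\<close> for the projection onto the cut
  content of \<open>B\<close>, where \<open>P\<close> denotes the projections of the content \<open>p\<close>: the two terms are
  subadditive in \<open>B\<close> separately.
\<close>
lemma subadditive_content_cut:
  assumes p: "subadditive_content p"
  shows "subadditive_content (cut_content p A)"
proof -
  note cen = subadditive_contentD(1)[OF p]
  note cs = centralD(1)[OF cen] and red = centralD(3)[OF cen]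
  note mono = subadditive_contentD(4)[OF p] and sub = subadditive_contentD(5)[OF p]
  let ?e = "proj_onto (p A)"
  have "central (cut_content p A B)" for B
  proof -
    have "closed (cut_content p A B)"
      unfolding closed_sequential_limits
    proof (intro allI impI, goal_cases)
      case (1 u l)
      then have "l \<in> p B" using closed_csubspace_limit[OF cs, of u B l] by (auto simp: cut_content_def)
      moreover have "(\<lambda>k. ?e (u k)) \<longlonglongrightarrow> ?e l"
        using 1 bounded_linear.tendsto[OF bounded_linear_proj[OF cs]] by blast
      then have "?e l \<in> p (B \<inter> A)"
        using 1 closed_csubspace_limit[OF cs, of "\<lambda>k. ?e (u k)"] by (auto simp: cut_content_def)
      ultimately show ?case by (simp add: cut_content_def)
    qed
    then have "closed_csubspace (cut_content p A B)"
      unfolding closed_csubspace_def cut_content_def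
      using closed_csubspaceD(2,3,4)[OF cs] by (auto simp: proj_zero[OF cs] proj_add[OF cs] proj_scaleC[OF cs])
    moreover have "cut_content p A B \<subseteq> H" using centralD(2)[OF cen] by (auto simp: cut_content_def)
    moreover have "\<pi> f h \<in> cut_content p A B" if f: "f \<in> C0" and h: "h \<in> cut_content p A B" for f h
    proof -
      have hH: "h \<in> H" using h centralD(2)[OF cen] by (auto simp: cut_content_def)
      show ?thesis
        using h centralD(5)[OF cen f] by (simp add: cut_content_def flip: reducing_proj[OF red f hH])
    qed
    moreover have "proj_onto Q h \<in> cut_content p A B" if Q: "reducing Q" and h: "h \<in> cut_content p A B" for Q h
      using h central_proj_mem[OF cen Q] by (simp add: cut_content_def central_commute[OF cen Q])
    ultimately show ?thesis unfolding central_def reducing_def by blast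
  qed
  moreover have "cut_content p A {} = {0}"
    by (auto simp: cut_content_def subadditive_contentD(2)[OF p] proj_zero[OF cs])
  moreover have "cut_content p A UNIV = H"
    using proj_in[OF cs, of A] by (auto simp: cut_content_def subadditive_contentD(3)[OF p])
  moreover have "mono (cut_content p A)"
  proof (rule monoI)
    fix B C :: "'b set" assume "B \<subseteq> C"
    then show "cut_content p A B \<subseteq> cut_content p A C"
      using mono[of B C] mono[of "B \<inter> A" "C \<inter> A"] unfolding cut_content_def by blast
  qed
  moreover have "h - proj_onto (cut_content p A B) h \<in> cut_content p A C" if h: "h \<in> cut_content p A (B \<union> C)" for B C h
  proof -
    note csc = centralD(1)[OF \<open>\<And>B. central (cut_content p A B)\<close>]
    let ?g = "proj_onto (p (B \<inter> A))" and ?b = "proj_onto (p B)"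
    have ge: "?g (?e x) = ?g x" for x by (rule proj_of_subset[OF cs cs mono]) simp
    have eg: "?e (?g x) = ?g x" for x
      using proj_in[OF cs, of "B \<inter> A" x] mono[of "B \<inter> A" A] by (intro proj_id[OF cs]) auto
    have be: "?e (?b x) = ?b (?e x)" for x by (rule central_commute[OF cen red])
    have ee: "?e (?e x) = ?e x" for x by (rule proj_id[OF cs proj_in[OF cs]])
    define y where "y = ?g h + ?b (h - ?e h)"
    have py: "proj_onto (cut_content p A B) h = y"
    proof (rule proj_unique[OF csc])
      have "y \<in> p B"
        unfolding y_def using proj_in[OF cs, of "B \<inter> A" h] mono[of "B \<inter> A" B]
        by (intro closed_csubspaceD(3)[OF cs] proj_in[OF cs]) auto
      moreover have "?e y = ?g h"
        unfolding y_def by (simp add: proj_add[OF cs] eg be proj_diff[OF cs] ee proj_zero[OF cs])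
      ultimately show "y \<in> cut_content p A B" using proj_in[OF cs, of "B \<inter> A" h] by (simp add: cut_content_def)
      fix z assume "z \<in> cut_content p A B"
      then have z: "?b z = z" "?g z = ?e z"
        using ge[of z] proj_id[OF cs, of z B] proj_id[OF cs, of "?e z" "B \<inter> A"] by (auto simp: cut_content_def)
      have "cinner y z = cinner h (?g z) + cinner (h - ?e h) (?b z)"
        by (simp add: y_def cinner_add_left proj_sym[OF cs])
      also have "\<dots> = cinner h z" by (simp add: z cinner_diff_left proj_sym[OF cs])
      finally show "cinner (h - y) z = 0" by (simp add: cinner_diff_left)
    qed
    define a b where "a = ?e h - ?g (?e h)" and "b = (h - ?e h) - ?b (h - ?e h)"
    have hy: "h - y = a + b" by (simp add: a_def b_def y_def ge)
    have a: "a \<in> p (C \<inter> A)"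
      unfolding a_def using h by (intro sub) (auto simp: cut_content_def Int_Un_distrib2)
    have b: "b \<in> p C"
      unfolding b_def
    proof (rule sub)
      have "h \<in> p (B \<union> C)" using h by (simp add: cut_content_def)
      then show "h - ?e h \<in> p (B \<union> C)" by (rule proj_reducing_mem[OF cen red])
    qed
    have "?e (a + b) = a"
      by (simp add: a_def b_def proj_add[OF cs] proj_diff[OF cs] eg be ee)
    moreover have "a + b \<in> p C" using a b mono[of "C \<inter> A" C] by (intro closed_csubspaceD(3)[OF cs]) auto
    ultimately show ?thesis using a unfolding py hy by (simp add: cut_content_def)
  qed
  ultimately show ?thesis unfolding subadditive_content_def by blast
qed

text \<open>
  A minimal subadditive content equals all its cuts.  Cutting at \<open>A\<close> and evaluating at \<open>-A\<close> shows
  that \<open>F A\<close> and \<open>F (-A)\<close> are orthogonal, and this makes \<open>F\<close> a Boolean homomorphism.  This is the Boolean prime ideal theorem with values in an algebra of projections.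
\<close>
lemma exists_boolean_content:
  assumes p0: "subadditive_content p0"
  shows "\<exists>F. (\<forall>A. F A \<subseteq> p0 A) \<and> spectral_content H \<pi> F UNIV"
proof -
  define \<P> where "\<P> = {p. subadditive_content p \<and> p \<le> p0}"
  have "\<exists>m\<in>\<P>. \<forall>a\<in>\<P>. a \<le> m \<longrightarrow> a = m"
  proof (rule predicate_Zorn)
    show "partial_order_on \<P> (relation_of (\<lambda>p q. q \<le> p) \<P>)"
      by (rule partial_order_on_relation_ofI) auto
    fix C assume C: "C \<in> Chains (relation_of (\<lambda>p q. q \<le> p) \<P>)"
    then have CP: "\<And>p. p \<in> C \<Longrightarrow> p \<in> \<P>" and ch: "\<And>p q. p \<in> C \<Longrightarrow> q \<in> C \<Longrightarrow> p \<le> q \<or> q \<le> p"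
      by (auto simp: Chains_def relation_of_def)
    show "\<exists>u\<in>\<P>. \<forall>a\<in>C. u \<le> a"
    proof (cases "C = {}")
      case True
      then show ?thesis using p0 by (auto simp: \<P>_def)
    next
      case False
      let ?u = "\<lambda>A. \<Inter>p\<in>C. p A"
      have le: "?u \<le> a" if "a \<in> C" for a using that by (auto simp: le_fun_def)
      have "subadditive_content ?u"
        using CP ch False by (intro subadditive_content_chain_Inf) (auto simp: \<P>_def)
      moreover obtain a where "a \<in> C" using False by blast
      then have "?u \<le> p0" using le[of a] CP[of a] by (auto simp: \<P>_def intro: order_trans)
      ultimately show ?thesis using le by (intro bexI[of _ ?u]) (auto simp: \<P>_def)
    qed
  qed
  then obtain F where F: "subadditive_content F" "F \<le> p0"
    and min: "\<And>p. subadditive_content p \<Longrightarrow> p \<le> F \<Longrightarrow> p = F"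
    by (auto simp: \<P>_def intro: order_trans)
  note cen = subadditive_contentD(1)[OF F(1)]
  note cs = centralD(1)[OF cen]
  have cut: "cut_content F A = F" for A
    by (rule min[OF subadditive_content_cut[OF F(1)]]) (auto simp: cut_content_def le_fun_def)
  have dis: "proj_onto (F A) h = 0" if "h \<in> F (- A)" for A h
  proof -
    have "h \<in> cut_content F A (- A)" using that by (simp add: cut)
    then show ?thesis by (simp add: cut_content_def subadditive_contentD(2)[OF F(1)])
  qed
  have "spectral_content H \<pi> F UNIV"
  proof unfold_locales
    show "central (F A)" for A by (rule cen)
    show "F {} = {0}" by (rule subadditive_contentD(2)[OF F(1)])
    show "F (A \<inter> B) = F A \<inter> F B" for A B
    proof
      show "F (A \<inter> B) \<subseteq> F A \<inter> F B" using subadditive_contentD(4)[OF F(1)] by (meson Int_greatest Int_lower1 Int_lower2)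
      show "F A \<inter> F B \<subseteq> F (A \<inter> B)"
      proof
        fix h assume h: "h \<in> F A \<inter> F B"
        define u where "u = h - proj_onto (F (A \<inter> B)) h"
        have "(A \<inter> B) \<union> (A - B) = A" by blast
        then have "u \<in> F (A - B)" unfolding u_def using subadditive_contentD(5)[OF F(1)] h by auto
        then have "u \<in> F (- B)" using subadditive_contentD(4)[OF F(1), of "A - B" "- B"] by auto
        then have "proj_onto (F B) u = 0" by (rule dis)
        moreover have "u \<in> F B"
          unfolding u_def using h proj_reducing_mem[OF cen centralD(3)[OF cen]] by blast
        ultimately have "u = 0" by (simp add: proj_id[OF cs])
        then show "h \<in> F (A \<inter> B)" unfolding u_def using proj_in[OF cs, of "A \<inter> B" h] by simp
      qed
    qed
    fix A u
    assume u: "u \<in> H" "\<And>z. z \<in> F A \<Longrightarrow> cinner u z = 0" "\<And>z. z \<in> F (- A) \<Longrightarrow> cinner u z = 0"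
    have "proj_onto (F A) u = 0" by (rule proj_eq_0[OF cs u(2)])
    then have "u \<in> F (- A)"
      using subadditive_contentD(5)[OF F(1), of u A "- A"] u(1) subadditive_contentD(3)[OF F(1)]
      by (simp add: Compl_partition)
    then show "u = 0" using u(3) cinner_self_eq_0 by blast
  qed
  then show ?thesis using F(2) by (auto simp: le_fun_def)
qed

end

section \<open>Integration of bounded functions against a Boolean homomorphism\<close>

definition grid_approx :: "('y \<Rightarrow> complex) \<Rightarrow> nat \<Rightarrow> 'y \<Rightarrow> complex" where
  "grid_approx f k y = grid_point (inverse (real (Suc k))) (grid_index (inverse (real (Suc k))) (f y))"

lemma grid_approx_close: "cmod (f y - grid_approx f k y) \<le> 2 * inverse (real (Suc k))"
  unfolding grid_approx_def by (rule grid_point_close) simp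

lemma grid_approx_bound:
  assumes "\<And>y. cmod (f y) \<le> B"
  shows "cmod (grid_approx f k y) \<le> B + 2"
proof -
  have "cmod (grid_approx f k y) \<le> cmod (f y) + cmod (f y - grid_approx f k y)"
    by (rule norm_triangle_sub[of "grid_approx f k y" "f y", unfolded norm_minus_commute[of "grid_approx f k y"]])
  moreover have "inverse (real (Suc k)) \<le> 1" by (simp add: field_simps)
  ultimately show ?thesis using grid_approx_close[of f y k] assms[of y] by linarith
qed

lemma finite_range_grid_approx:
  assumes "\<And>y. cmod (f y) \<le> B"
  shows "finite (range (grid_approx f k))"
proof -
  have "range (grid_approx f k) = grid_point (inverse (real (Suc k))) `
      range (\<lambda>y. grid_index (inverse (real (Suc k))) (f y))"
    by (auto simp: grid_approx_def)
  then show ?thesis using finite_range_grid_index[of "inverse (real (Suc k))" f B] assms by simp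
qed

lemma finite_range_Pair: "finite (range s) \<Longrightarrow> finite (range t) \<Longrightarrow> finite (range (\<lambda>y. (s y, t y)))"
  by (rule finite_subset[of _ "range s \<times> range t"]) auto

locale boolean_content = spectral_content H \<pi> F UNIV
  for H :: "'a::chilbert set" and \<pi> :: "('x::t2_space \<Rightarrow> complex) \<Rightarrow> 'a \<Rightarrow> 'a"
    and F :: "'y set \<Rightarrow> 'a set"
begin

definition simple_integral :: "('y \<Rightarrow> complex) \<Rightarrow> 'a \<Rightarrow> 'a" where
  "simple_integral s h = (\<Sum>z\<in>range s. z *\<^sub>C P (s -` {z}) h)"

text \<open>
  The value may be computed on any finite partition on which \<open>s\<close> is constant.  Two functions are
  handled on the partition by their pair of values.
\<close>
lemma simple_integral_comp:
  assumes t: "finite (range t)"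
  shows "simple_integral (\<lambda>y. \<phi> (t y)) h = (\<Sum>i\<in>range t. \<phi> i *\<^sub>C P (t -` {i}) h)"
proof -
  let ?s = "\<lambda>y. \<phi> (t y)"
  have "(\<Sum>i\<in>range t. \<phi> i *\<^sub>C P (t -` {i}) h)
      = (\<Sum>z\<in>\<phi> ` range t. \<Sum>i\<in>{i\<in>range t. \<phi> i = z}. \<phi> i *\<^sub>C P (t -` {i}) h)"
    by (rule sum.image_gen[OF t])
  also have "\<phi> ` range t = range ?s" by auto
  also have "(\<Sum>z\<in>range ?s. \<Sum>i\<in>{i\<in>range t. \<phi> i = z}. \<phi> i *\<^sub>C P (t -` {i}) h) = simple_integral ?s h"
    unfolding simple_integral_def
  proof (rule sum.cong[OF refl])
    fix z
    let ?I = "{i\<in>range t. \<phi> i = z}"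
    have "disjoint_family_on (\<lambda>i. t -` {i}) ?I" unfolding disjoint_family_on_def by blast
    then have "P (\<Union>i\<in>?I. t -` {i}) h = (\<Sum>i\<in>?I. P (t -` {i}) h)"
      using t by (intro P_sum) auto
    moreover have "(\<Union>i\<in>?I. t -` {i}) = ?s -` {z}" by auto
    ultimately show "(\<Sum>i\<in>?I. \<phi> i *\<^sub>C P (t -` {i}) h) = z *\<^sub>C P (?s -` {z}) h"
      by (simp add: scaleC_sum_right)
  qed
  finally show ?thesis by simp
qed

lemma simple_integral_mem: "simple_integral s h \<in> H"
  unfolding simple_integral_def by (intro closed_csubspace_sum[OF H] HD(4) P_mem)

lemma simple_integral_add_vec: "simple_integral s (h + k) = simple_integral s h + simple_integral s k"
  by (simp add: simple_integral_def proj_add[OF cF] scaleC_add_right sum.distrib)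

lemma simple_integral_scale_vec: "simple_integral s (c *\<^sub>C h) = c *\<^sub>C simple_integral s h"
  by (simp add: simple_integral_def proj_scaleC[OF cF] scaleC_sum_right scaleC_scaleC mult.commute)

lemma simple_integral_diff_vec: "simple_integral s (h - k) = simple_integral s h - simple_integral s k"
  by (simp add: simple_integral_def proj_diff[OF cF] scaleC_diff_right sum_subtractf)

lemma
  assumes s: "finite (range s)" and t: "finite (range t)"
  shows simple_integral_add: "simple_integral (\<lambda>y. s y + t y) h = simple_integral s h + simple_integral t h"
    and simple_integral_diff: "simple_integral (\<lambda>y. s y - t y) h = simple_integral s h - simple_integral t h"
    and simple_integral_mult: "simple_integral (\<lambda>y. s y * t y) h = simple_integral s (simple_integral t h)"
proof -
  let ?r = "\<lambda>y. (s y, t y)"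
  let ?P = "\<lambda>i. P (?r -` {i})"
  have r: "finite (range ?r)" using finite_range_Pair[OF s t] .
  note * = simple_integral_comp[OF r, of fst] simple_integral_comp[OF r, of snd]
    simple_integral_comp[OF r, of "\<lambda>i. fst i + snd i"] simple_integral_comp[OF r, of "\<lambda>i. fst i - snd i"]
    simple_integral_comp[OF r, of "\<lambda>i. fst i * snd i"]
  show "simple_integral (\<lambda>y. s y + t y) h = simple_integral s h + simple_integral t h"
    using *(1-3)[of h] by (simp add: scaleC_add_left sum.distrib)
  show "simple_integral (\<lambda>y. s y - t y) h = simple_integral s h - simple_integral t h"
    using *(1,2,4)[of h] by (simp add: scaleC_diff_left sum_subtractf)
  have PP: "?P i (?P j x) = (if i = j then ?P i x else 0)" for i j x
  proof -
    have "?r -` {i} \<inter> ?r -` {j} = (if i = j then ?r -` {i} else {})" by auto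
    then have "?P i (?P j x) = P (if i = j then ?r -` {i} else {}) x"
      by (simp only: P_Int[symmetric])
    then show ?thesis by (simp add: P_empty)
  qed
  have "simple_integral s (simple_integral t h)
      = (\<Sum>i\<in>range ?r. fst i *\<^sub>C ?P i (\<Sum>j\<in>range ?r. snd j *\<^sub>C ?P j h))"
    using *(1)[of "simple_integral t h"] *(2)[of h] by simp
  also have "\<dots> = (\<Sum>i\<in>range ?r. \<Sum>j\<in>range ?r. if i = j then (fst i * snd i) *\<^sub>C ?P i h else 0)"
    by (simp add: proj_sum[OF cF] proj_scaleC[OF cF] scaleC_sum_right scaleC_scaleC PP if_distrib cong: if_cong sum.cong)
  also have "\<dots> = (\<Sum>i\<in>range ?r. (fst i * snd i) *\<^sub>C ?P i h)"
    using r by (intro sum.cong) auto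
  finally show "simple_integral (\<lambda>y. s y * t y) h = simple_integral s (simple_integral t h)"
    using *(5)[of h] by simp
qed

lemma simple_integral_scale:
  assumes s: "finite (range s)"
  shows "simple_integral (\<lambda>y. c * s y) h = c *\<^sub>C simple_integral s h"
  using simple_integral_comp[OF s, of "\<lambda>z. c * z" h]
  by (simp add: simple_integral_def scaleC_sum_right scaleC_scaleC)

lemma simple_integral_adj:
  assumes s: "finite (range s)"
  shows "cinner (simple_integral s h) k = cinner h (simple_integral (\<lambda>y. cnj (s y)) k)"
  using simple_integral_comp[OF s, of cnj k]
  by (simp add: simple_integral_def cinner_sum_left cinner_sum_right cinner_scaleC_left cinner_scaleC_right
      proj_sym[OF cF])

lemma simple_integral_norm_le:
  assumes s: "finite (range s)" and B: "\<And>y. cmod (s y) \<le> B" and h: "h \<in> H"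
  shows "norm (simple_integral s h) \<le> B * norm h"
proof -
  have B0: "B \<ge> 0" using B[of undefined] norm_ge_zero order_trans by blast
  have "(norm (simple_integral s h))\<^sup>2 = (\<Sum>z\<in>range s. (norm (z *\<^sub>C P (s -` {z}) h))\<^sup>2)"
    unfolding simple_integral_def
    by (rule norm_sum_orthogonal_sq[OF s F_disjoint_orth[OF _ closed_csubspaceD(4)[OF cF proj_in[OF cF]]
            closed_csubspaceD(4)[OF cF proj_in[OF cF]]]]) auto
  also have "\<dots> \<le> (\<Sum>z\<in>range s. B\<^sup>2 * (norm (P (s -` {z}) h))\<^sup>2)"
    using B by (intro sum_mono) (auto simp: norm_scaleC power_mult_distrib intro!: mult_right_mono power_mono)
  also have "\<dots> = (B * norm h)\<^sup>2"
    using norm_sum_cells[OF s _ h] by (simp add: power_mult_distrib flip: sum_distrib_left)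
  finally show ?thesis by (rule power2_le_imp_le) (simp add: B0)
qed

definition integral :: "('y \<Rightarrow> complex) \<Rightarrow> 'a \<Rightarrow> 'a" where
  "integral f h = lim (\<lambda>k. simple_integral (grid_approx f k) h)"

text \<open>
  The grid in the definition of the integral is immaterial: all uniform approximations by simple
  functions give the same limit.  The algebraic rules for the integral follow from those for simple
  functions by choosing the approximation that suits the rule.
\<close>
lemma simple_integral_tendsto:
  assumes B: "\<And>y. cmod (f y) \<le> B" and s: "\<And>k. finite (range (s k))"
    and close: "\<And>k y. cmod (f y - s k y) \<le> e k" and e: "e \<longlonglongrightarrow> 0" and h: "h \<in> H"
  shows "(\<lambda>k. simple_integral (s k) h) \<longlonglongrightarrow> integral f h"
proof -
  let ?d = "\<lambda>k. inverse (real (Suc k))"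
  note g = finite_range_grid_approx[OF B]
  have *: "norm (simple_integral u h - simple_integral v h) \<le> (a + b) * norm h"
    if "finite (range u)" "finite (range v)" "\<And>y. cmod (f y - u y) \<le> a" "\<And>y. cmod (f y - v y) \<le> b" for u v a b
  proof -
    have "cmod (u y - v y) \<le> a + b" for y
      using norm_triangle_ineq4[of "f y - v y" "f y - u y"] that(3,4)[of y] by simp
    moreover have "finite (range (\<lambda>y. u y - v y))"
      using finite_imageI[OF finite_range_Pair[OF that(1,2)], of "\<lambda>(a, b). a - b"] by (simp add: image_image)
    ultimately show ?thesis
      using simple_integral_norm_le[of "\<lambda>y. u y - v y" "a + b" h] h by (simp add: simple_integral_diff that)
  qed
  have "Cauchy (\<lambda>k. simple_integral (grid_approx f k) h)"
  proof (rule metric_CauchyI)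
    fix r :: real assume r: "r > 0"
    have "(\<lambda>k. (2 * ?d k + 2 * ?d k) * norm h) \<longlonglongrightarrow> (2 * 0 + 2 * 0) * norm h"
      by (intro tendsto_intros LIMSEQ_inverse_real_of_nat)
    then have "\<forall>\<^sub>F k in sequentially. (2 * ?d k + 2 * ?d k) * norm h < r"
      by (rule order_tendstoD(2)) (use r in simp)
    then obtain N where N: "(2 * ?d N + 2 * ?d N) * norm h < r"
      unfolding eventually_sequentially by blast
    have "dist (simple_integral (grid_approx f m) h) (simple_integral (grid_approx f n) h) < r"
      if "m \<ge> N" "n \<ge> N" for m n
    proof -
      have "?d m \<le> ?d N" "?d n \<le> ?d N" using that by (auto simp: field_simps)
      then have "(2 * ?d m + 2 * ?d n) * norm h \<le> (2 * ?d N + 2 * ?d N) * norm h"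
        by (intro mult_right_mono add_mono mult_left_mono) simp_all
      then show ?thesis
        using *[OF g g grid_approx_close grid_approx_close, of m n] N by (simp add: dist_norm)
    qed
    then show "\<exists>N. \<forall>m\<ge>N. \<forall>n\<ge>N. dist (simple_integral (grid_approx f m) h) (simple_integral (grid_approx f n) h) < r"
      by blast
  qed
  then have lim: "(\<lambda>k. simple_integral (grid_approx f k) h) \<longlonglongrightarrow> integral f h"
    unfolding integral_def using Cauchy_convergent convergent_LIMSEQ_iff by blast
  have "(\<lambda>k. (e k + 2 * ?d k) * norm h) \<longlonglongrightarrow> (0 + 2 * 0) * norm h"
    by (intro tendsto_intros LIMSEQ_inverse_real_of_nat e)
  then have "(\<lambda>k. (e k + 2 * ?d k) * norm h) \<longlonglongrightarrow> 0" by simp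
  moreover have "\<forall>\<^sub>F k in sequentially. norm (simple_integral (s k) h - simple_integral (grid_approx f k) h)
      \<le> (e k + 2 * ?d k) * norm h"
    using *[OF s g close grid_approx_close] by simp
  ultimately have "(\<lambda>k. simple_integral (s k) h - simple_integral (grid_approx f k) h) \<longlonglongrightarrow> 0"
    by (rule Lim_null_comparison[rotated])
  from tendsto_add[OF this lim] show ?thesis by simp
qed

lemma grid_approx_tendsto:
  assumes B: "\<And>y. cmod (f y) \<le> B" and h: "h \<in> H"
  shows "(\<lambda>k. simple_integral (grid_approx f k) h) \<longlonglongrightarrow> integral f h"
proof (rule simple_integral_tendsto[OF B finite_range_grid_approx[OF B] grid_approx_close _ h])
  show "(\<lambda>k. 2 * inverse (real (Suc k))) \<longlonglongrightarrow> 0"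
    using tendsto_mult_left[OF LIMSEQ_inverse_real_of_nat, of 2] by simp
qed

lemma integral_mem: "(\<And>y. cmod (f y) \<le> B) \<Longrightarrow> h \<in> H \<Longrightarrow> integral f h \<in> H"
  using closed_csubspace_limit[OF H simple_integral_mem grid_approx_tendsto] by blast

lemma integral_add_vec:
  assumes B: "\<And>y. cmod (f y) \<le> B" and h: "h \<in> H" and k: "k \<in> H"
  shows "integral f (h + k) = integral f h + integral f k"
  using LIMSEQ_unique[OF grid_approx_tendsto[OF B HD(3)[OF h k]]]
    tendsto_add[OF grid_approx_tendsto[OF B h] grid_approx_tendsto[OF B k]]
  by (simp add: simple_integral_add_vec)

lemma integral_scale_vec:
  assumes B: "\<And>y. cmod (f y) \<le> B" and h: "h \<in> H"
  shows "integral f (c *\<^sub>C h) = c *\<^sub>C integral f h"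
  using LIMSEQ_unique[OF grid_approx_tendsto[OF B HD(4)[OF h]]]
    tendsto_scaleC[OF grid_approx_tendsto[OF B h]]
  by (simp add: simple_integral_scale_vec)

lemma integral_add:
  assumes f: "\<And>y. cmod (f y) \<le> B" and g: "\<And>y. cmod (g y) \<le> C" and h: "h \<in> H"
  shows "integral (\<lambda>y. f y + g y) h = integral f h + integral g h"
proof (rule LIMSEQ_unique)
  let ?s = "\<lambda>k y. grid_approx f k y + grid_approx g k y"
  note ff = finite_range_grid_approx[OF f] and fg = finite_range_grid_approx[OF g]
  show "(\<lambda>k. simple_integral (?s k) h) \<longlonglongrightarrow> integral (\<lambda>y. f y + g y) h"
  proof (rule simple_integral_tendsto[OF _ _ _ _ h])
    show "cmod (f y + g y) \<le> B + C" for y using norm_triangle_ineq[of "f y" "g y"] f[of y] g[of y] by linarith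
    show "finite (range (?s k))" for k
      using finite_imageI[OF finite_range_Pair[OF ff fg], of "\<lambda>(a, b). a + b"] by (simp add: image_image)
    show "cmod (f y + g y - ?s k y) \<le> 4 * inverse (real (Suc k))" for k y
      using norm_triangle_ineq[of "f y - grid_approx f k y" "g y - grid_approx g k y"]
        grid_approx_close[of f y k] grid_approx_close[of g y k] by (simp add: algebra_simps)
    show "(\<lambda>k. 4 * inverse (real (Suc k))) \<longlonglongrightarrow> 0"
      using tendsto_mult_left[OF LIMSEQ_inverse_real_of_nat, of 4] by simp
  qed
  show "(\<lambda>k. simple_integral (?s k) h) \<longlonglongrightarrow> integral f h + integral g h"
    unfolding simple_integral_add[OF ff fg]
    by (intro tendsto_add grid_approx_tendsto[OF f h] grid_approx_tendsto[OF g h])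
qed

lemma integral_scale:
  assumes f: "\<And>y. cmod (f y) \<le> B" and h: "h \<in> H"
  shows "integral (\<lambda>y. c * f y) h = c *\<^sub>C integral f h"
proof (rule LIMSEQ_unique)
  let ?s = "\<lambda>k y. c * grid_approx f k y"
  note ff = finite_range_grid_approx[OF f]
  show "(\<lambda>k. simple_integral (?s k) h) \<longlonglongrightarrow> integral (\<lambda>y. c * f y) h"
  proof (rule simple_integral_tendsto[OF _ _ _ _ h])
    show "cmod (c * f y) \<le> cmod c * B" for y using f[of y] by (simp add: norm_mult mult_left_mono)
    show "finite (range (?s k))" for k
      using finite_imageI[OF ff, of "\<lambda>a. c * a"] by (simp add: image_image)
    show "cmod (c * f y - ?s k y) \<le> cmod c * (2 * inverse (real (Suc k)))" for k y
      using mult_left_mono[OF grid_approx_close[of f y k] norm_ge_zero[of c]]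
      by (simp add: norm_mult flip: right_diff_distrib)
    show "(\<lambda>k. cmod c * (2 * inverse (real (Suc k)))) \<longlonglongrightarrow> 0"
      using tendsto_mult_left[OF LIMSEQ_inverse_real_of_nat, of "cmod c * 2"] by (simp add: mult.assoc)
  qed
  show "(\<lambda>k. simple_integral (?s k) h) \<longlonglongrightarrow> c *\<^sub>C integral f h"
    unfolding simple_integral_scale[OF ff] by (rule tendsto_scaleC[OF grid_approx_tendsto[OF f h]])
qed

lemma integral_mult:
  assumes f: "\<And>y. cmod (f y) \<le> B" and g: "\<And>y. cmod (g y) \<le> C" and h: "h \<in> H"
  shows "integral (\<lambda>y. f y * g y) h = integral f (integral g h)"
proof (rule LIMSEQ_unique)
  let ?f = "grid_approx f" and ?g = "grid_approx g" and ?d = "\<lambda>k. inverse (real (Suc k))"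
  let ?s = "\<lambda>k y. ?f k y * ?g k y"
  note ff = finite_range_grid_approx[OF f] and fg = finite_range_grid_approx[OF g]
  have B0: "B \<ge> 0" and C0: "C \<ge> 0" using f[of undefined] g[of undefined] norm_ge_zero order_trans by blast+
  show "(\<lambda>k. simple_integral (?s k) h) \<longlonglongrightarrow> integral (\<lambda>y. f y * g y) h"
  proof (rule simple_integral_tendsto[OF _ _ _ _ h])
    show "cmod (f y * g y) \<le> B * C" for y using f[of y] g[of y] B0 by (simp add: norm_mult mult_mono)
    show "finite (range (?s k))" for k
      using finite_imageI[OF finite_range_Pair[OF ff fg], of "\<lambda>(a, b). a * b"] by (simp add: image_image)
    show "cmod (f y * g y - ?s k y) \<le> B * (2 * ?d k) + 2 * ?d k * (C + 2)" for k y
    proof -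
      have "f y * g y - ?s k y = f y * (g y - ?g k y) + (f y - ?f k y) * ?g k y" by (simp add: algebra_simps)
      also have "cmod \<dots> \<le> cmod (f y * (g y - ?g k y)) + cmod ((f y - ?f k y) * ?g k y)"
        by (rule norm_triangle_ineq)
      also have "\<dots> \<le> B * (2 * ?d k) + 2 * ?d k * (C + 2)"
        unfolding norm_mult
        using f[of y] grid_approx_close[of g y k] grid_approx_close[of f y k] grid_approx_bound[of g C k y] g B0
        by (intro add_mono mult_mono) auto
      finally show ?thesis .
    qed
    have "(\<lambda>k. B * (2 * ?d k) + 2 * ?d k * (C + 2)) \<longlonglongrightarrow> B * (2 * 0) + 2 * 0 * (C + 2)"
      by (intro tendsto_intros LIMSEQ_inverse_real_of_nat)
    then show "(\<lambda>k. B * (2 * ?d k) + 2 * ?d k * (C + 2)) \<longlonglongrightarrow> 0" by simp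
  qed
  have gH: "integral g h \<in> H" by (rule integral_mem[OF g h])
  let ?r = "\<lambda>k. simple_integral (?g k) h - integral g h"
  have "(\<lambda>k. norm (?r k)) \<longlonglongrightarrow> norm (integral g h - integral g h)"
    by (intro tendsto_intros grid_approx_tendsto[OF g h])
  from tendsto_mult_left[OF this, of "B + 2"]
  have "(\<lambda>k. (B + 2) * norm (?r k)) \<longlonglongrightarrow> 0" by simp
  moreover have "\<forall>\<^sub>F k in sequentially. norm (simple_integral (?f k) (?r k)) \<le> (B + 2) * norm (?r k)"
    using simple_integral_norm_le[OF ff grid_approx_bound[where f = f, OF f] HD(7)[OF simple_integral_mem gH]]
    by (intro always_eventually allI) blast
  ultimately have "(\<lambda>k. simple_integral (?f k) (?r k)) \<longlonglongrightarrow> 0"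
    by (rule Lim_null_comparison[rotated])
  from tendsto_add[OF this grid_approx_tendsto[where f = f, OF f gH]]
  show "(\<lambda>k. simple_integral (?s k) h) \<longlonglongrightarrow> integral f (integral g h)"
    by (simp add: simple_integral_mult[OF ff fg] simple_integral_diff_vec)
qed

lemma integral_adj:
  assumes f: "\<And>y. cmod (f y) \<le> B" and h: "h \<in> H" and k: "k \<in> H"
  shows "cinner (integral f h) k = cinner h (integral (\<lambda>y. cnj (f y)) k)"
proof (rule LIMSEQ_unique)
  let ?d = "\<lambda>k. inverse (real (Suc k))"
  note ff = finite_range_grid_approx[OF f]
  show "(\<lambda>j. cinner (simple_integral (grid_approx f j) h) k) \<longlonglongrightarrow> cinner (integral f h) k"
    by (rule tendsto_cinner_left[OF grid_approx_tendsto[OF f h]])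
  have "(\<lambda>j. simple_integral (\<lambda>y. cnj (grid_approx f j y)) k) \<longlonglongrightarrow> integral (\<lambda>y. cnj (f y)) k"
  proof (rule simple_integral_tendsto[OF _ _ _ _ k])
    show "cmod (cnj (f y)) \<le> B" for y using f[of y] by simp
    show "finite (range (\<lambda>y. cnj (grid_approx f j y)))" for j
      using finite_imageI[OF ff, of cnj] by (simp add: image_image)
    show "cmod (cnj (f y) - cnj (grid_approx f j y)) \<le> 2 * ?d j" for j y
      using grid_approx_close[of f y j] by (simp flip: complex_cnj_diff)
    show "(\<lambda>k. 2 * ?d k) \<longlonglongrightarrow> 0"
      using tendsto_mult_left[OF LIMSEQ_inverse_real_of_nat, of 2] by simp
  qed
  from tendsto_cinner_right[OF this]
  show "(\<lambda>j. cinner (simple_integral (grid_approx f j) h) k) \<longlonglongrightarrow> cinner h (integral (\<lambda>y. cnj (f y)) k)"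
    unfolding simple_integral_adj[OF ff] .
qed

text \<open>
  On the cell \<open>A\<close> where \<open>f \<circ> \<sigma>\<close> is close to \<open>z\<close>, the function \<open>f\<close> is close to \<open>z\<close> on \<open>\<sigma>(A)\<close> and on its
  closure, which supports the vectors of \<open>F A\<close>.
\<close>
lemma integral_comp_eq:
  assumes f: "f \<in> C0" and sub: "\<And>A. F A \<subseteq> sspace (closure (\<sigma> ` A))" and h: "h \<in> H"
  shows "integral (\<lambda>y. f (\<sigma> y)) h = \<pi> f h"
proof (rule LIMSEQ_unique)
  let ?g = "\<lambda>y. f (\<sigma> y)" and ?d = "\<lambda>k. inverse (real (Suc k))"
  obtain B where B: "\<And>x. cmod (f x) \<le> B" using C0_bounded[OF f] by blast
  show "(\<lambda>k. simple_integral (grid_approx ?g k) h) \<longlonglongrightarrow> integral ?g h"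
    by (rule grid_approx_tendsto[OF B h])
  have le: "norm (simple_integral (grid_approx ?g k) h - \<pi> f h) \<le> 2 * ?d k * norm h" for k
  proof -
    define t where "t = grid_approx ?g k"
    have t: "finite (range t)" unfolding t_def by (rule finite_range_grid_approx[OF B])
    define v where "v z = P (t -` {z}) h" for z
    have vF: "v z \<in> F (t -` {z})" for z unfolding v_def by (rule proj_in[OF cF])
    have vH: "v z \<in> H" for z unfolding v_def by (rule P_mem)
    have est: "norm (\<pi> f (v z) - z *\<^sub>C v z) \<le> 2 * ?d k * norm (v z)" for z
    proof (rule local_estimate[OF f])
      show "v z \<in> sspace (closure (\<sigma> ` (t -` {z})))" using vF sub by blast
      have "closed {x. cmod (f x - z) \<le> 2 * ?d k}"
        by (intro closed_Collect_le continuous_intros C0_continuous f)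
      moreover have "\<sigma> ` (t -` {z}) \<subseteq> {x. cmod (f x - z) \<le> 2 * ?d k}"
        using grid_approx_close[where f = ?g and k = k] by (auto simp: t_def)
      ultimately show "cmod (f x - z) \<le> 2 * ?d k" if "x \<in> closure (\<sigma> ` (t -` {z}))" for x
        using closure_minimal that by blast
    qed simp
    have "\<pi> f (\<Sum>z\<in>Q. v z) = (\<Sum>z\<in>Q. \<pi> f (v z))" if "finite Q" for Q
      using that by (induction Q) (auto simp: f add_vec vH closed_csubspace_sum[OF H])
    from this[OF t] have pih: "\<pi> f h = (\<Sum>z\<in>range t. \<pi> f (v z))"
      unfolding v_def using sum_cells[OF t _ h] by simp
    let ?w = "\<lambda>z. z *\<^sub>C v z - \<pi> f (v z)"
    have wF: "?w z \<in> F (t -` {z})" for z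
      by (intro closed_csubspaceD(4,7)[OF cF] vF centralD(5)[OF central_F f])
    have "simple_integral t h - \<pi> f h = (\<Sum>z\<in>range t. ?w z)"
      by (simp add: pih simple_integral_def v_def sum_subtractf)
    then have "(norm (simple_integral t h - \<pi> f h))\<^sup>2 = (\<Sum>z\<in>range t. (norm (?w z))\<^sup>2)"
      by (simp only:) (rule norm_sum_orthogonal_sq[OF t F_disjoint_orth[OF _ wF wF]], auto)
    also have "\<dots> \<le> (\<Sum>z\<in>range t. (2 * ?d k)\<^sup>2 * (norm (v z))\<^sup>2)"
    proof (rule sum_mono)
      fix z
      have "(norm (?w z))\<^sup>2 \<le> (2 * ?d k * norm (v z))\<^sup>2"
        using est[of z] by (intro power_mono) (auto simp: norm_minus_commute)
      then show "(norm (?w z))\<^sup>2 \<le> (2 * ?d k)\<^sup>2 * (norm (v z))\<^sup>2" by (simp add: power_mult_distrib)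
    qed
    also have "\<dots> = (2 * ?d k * norm h)\<^sup>2"
      using norm_sum_cells[OF t _ h] by (simp add: v_def power_mult_distrib flip: sum_distrib_left)
    finally show ?thesis unfolding t_def by (rule power2_le_imp_le) simp
  qed
  have "(\<lambda>k. 2 * ?d k * norm h) \<longlonglongrightarrow> 2 * 0 * norm h"
    by (intro tendsto_intros LIMSEQ_inverse_real_of_nat)
  then have "(\<lambda>k. 2 * ?d k * norm h) \<longlonglongrightarrow> 0" by simp
  then have "(\<lambda>k. simple_integral (grid_approx ?g k) h - \<pi> f h) \<longlonglongrightarrow> 0"
    by (rule Lim_null_comparison[rotated]) (use le in simp)
  then show "(\<lambda>k. simple_integral (grid_approx ?g k) h) \<longlonglongrightarrow> \<pi> f h" by (rule LIM_zero_cancel)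
qed

end

section \<open>Lifting, restricting and pushing forward representations\<close>

context c0_rep
begin

text \<open>
  The lift is integration against a Boolean homomorphism \<open>F\<close> such that the vectors of \<open>F A\<close> are
  supported on the closure of \<open>\<sigma>(A)\<close>.  The corresponding upper bound for \<open>F\<close> is a subadditive content
  because \<open>\<pi>\<close> lives on the image of \<open>\<sigma>\<close>, so that the whole of \<open>H\<close> is assigned to the whole space.
\<close>
lemma exists_lift:
  fixes \<sigma> :: "'y::t2_space \<Rightarrow> 'x"
  assumes full: "sspace (range \<sigma>) = H" and C0: "\<And>f. f \<in> C0 \<Longrightarrow> (\<lambda>y. f (\<sigma> y)) \<in> C0"
  shows "\<exists>\<rho>. c0_rep H \<rho> \<and> (\<forall>f\<in>C0. \<forall>h\<in>H. \<rho> (\<lambda>y. f (\<sigma> y)) h = \<pi> f h)"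
proof -
  define p0 where "p0 A = sspace (closure (\<sigma> ` A))" for A
  have "subadditive_content p0"
    unfolding subadditive_content_def
  proof (intro conjI allI ballI)
    show "central (p0 A)" for A unfolding p0_def by (rule central_sspace)
    show "p0 {} = {0}" by (simp add: p0_def sspace_empty)
    show "p0 UNIV = H"
      using full sspace_mono[OF closure_subset[of "range \<sigma>"]] sspace_subset[of "closure (range \<sigma>)"]
      by (simp add: p0_def)
    show "mono p0" unfolding p0_def by (intro monoI sspace_mono closure_mono image_mono)
    show "h - proj_onto (p0 A) h \<in> p0 B" if "h \<in> p0 (A \<union> B)" for A B h
      using that unfolding p0_def image_Un closure_Un by (rule sspace_Un)
  qed
  then obtain F where F: "\<And>A. F A \<subseteq> p0 A" "spectral_content H \<pi> F UNIV"
    using exists_boolean_content by blast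
  interpret F: boolean_content H \<pi> F unfolding boolean_content_def by (rule F(2))
  have comp: "F.integral (\<lambda>y. f (\<sigma> y)) h = \<pi> f h" if "f \<in> C0" "h \<in> H" for f h
    using that F(1) by (intro F.integral_comp_eq) (auto simp: p0_def)
  have "c0_rep H F.integral"
  proof
    fix f g :: "'y \<Rightarrow> complex" and h k c assume f: "f \<in> C0" and h: "h \<in> H"
    obtain B where B: "\<And>y. cmod (f y) \<le> B" using C0_bounded[OF f] by blast
    show "F.integral f h \<in> H" by (rule F.integral_mem[OF B h])
    show "F.integral f (c *\<^sub>C h) = c *\<^sub>C F.integral f h" by (rule F.integral_scale_vec[OF B h])
    show "F.integral (\<lambda>x. c * f x) h = c *\<^sub>C F.integral f h" by (rule F.integral_scale[OF B h])
    {
      assume k: "k \<in> H"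
      show "F.integral f (h + k) = F.integral f h + F.integral f k"
        by (rule F.integral_add_vec[OF B h k])
      show "cinner (F.integral f h) k = cinner h (F.integral (\<lambda>x. cnj (f x)) k)"
        by (rule F.integral_adj[OF B h k])
    next
      assume g: "g \<in> C0"
      obtain C where C: "\<And>y. cmod (g y) \<le> C" using C0_bounded[OF g] by blast
      show "F.integral (\<lambda>x. f x + g x) h = F.integral f h + F.integral g h"
        by (rule F.integral_add[OF B C h])
      show "F.integral (\<lambda>x. f x * g x) h = F.integral f (F.integral g h)"
        by (rule F.integral_mult[OF B C h])
    }
  next
    fix h assume h: "h \<in> H" "\<And>f :: 'y \<Rightarrow> complex. f \<in> C0 \<Longrightarrow> F.integral f h = 0"
    have "\<pi> f h = 0" if "f \<in> C0" for f
      using comp[OF that h(1)] h(2)[OF C0[OF that]] by simp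
    then show "h = 0" using nondeg[OF h(1)] by blast
  qed (rule H)
  then show ?thesis using comp by blast
qed

lemma restriction:
  assumes "reducing Q"
  shows "c0_rep Q \<pi>"
proof -
  have Q: "closed_csubspace Q" "Q \<subseteq> H" "\<And>f h. f \<in> C0 \<Longrightarrow> h \<in> Q \<Longrightarrow> \<pi> f h \<in> Q"
    using assms by (auto simp: reducing_def)
  show ?thesis
    by unfold_locales
      (rule Q add_vec scale_vec add_fun scale_fun mult adj nondeg; blast dest: subsetD[OF Q(2)])+
qed

end

lemma C0_comp_proper:
  fixes \<sigma> :: "'y::t2_space \<Rightarrow> 'x::t2_space"
  assumes f: "f \<in> C0" and c: "continuous_on UNIV \<sigma>" and p: "proper_map euclidean euclidean \<sigma>"
  shows "(\<lambda>y. f (\<sigma> y)) \<in> C0"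
proof -
  have "continuous_on UNIV (\<lambda>y. f (\<sigma> y))"
    by (rule continuous_on_compose2[OF C0_continuous[OF f] c]) auto
  moreover have "compact {y. e \<le> cmod (f (\<sigma> y))}" if "e > 0" for e
  proof -
    have "compact {x. e \<le> cmod (f x)}" using f that by (auto simp: C0_def)
    then show ?thesis using p unfolding proper_map_alt by fastforce
  qed
  ultimately show ?thesis by (simp add: C0_def)
qed

lemma exists_C0_eq_1_on_compact:
  fixes K :: "'x::t2_space set"
  assumes lc: "locally_compact_space (euclidean :: 'x topology)"
    and met: "metrizable_space (euclidean :: 'x topology)" and K: "compact K"
  shows "\<exists>f\<in>C0. \<forall>x\<in>K. f x = 1"
proof -
  obtain U L where U: "open U" "compact L" "K \<subseteq> U" "U \<subseteq> L"
    using lc K locally_compact_space_compact_closed_compact[of "euclidean :: 'x topology"]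
    metrizable_imp_Hausdorff_space[OF met] by auto
  obtain u :: "'x \<Rightarrow> real" where u: "continuous_on UNIV u" "\<And>x. x \<in> - U \<Longrightarrow> u x = 0" "\<And>x. x \<in> K \<Longrightarrow> u x = 1"
  proof -
    have "closed (- U)" "closed K" "- U \<inter> K = {}" using U K compact_imp_closed by auto
    from urysohn_function[OF met this] show ?thesis using that by blast
  qed
  have "compact {x. e \<le> cmod (complex_of_real (u x))}" if "e > 0" for e
  proof -
    have "closed {x. e \<le> cmod (complex_of_real (u x))}"
      by (intro closed_Collect_le continuous_intros u)
    then have "compact (L \<inter> {x. e \<le> cmod (complex_of_real (u x))})" by (rule compact_Int_closed[OF U(2)])
    moreover have "{x. e \<le> cmod (complex_of_real (u x))} \<subseteq> L" using u(2) U(4) that by force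
    ultimately show ?thesis by (simp add: Int_absorb1)
  qed
  then have "(\<lambda>x. complex_of_real (u x)) \<in> C0" using u(1) by (auto simp: C0_def intro!: continuous_intros)
  then show ?thesis using u(3) by (intro bexI[of _ "\<lambda>x. complex_of_real (u x)"]) auto
qed

context c0_rep
begin

text \<open>
  Properness keeps \<open>f \<circ> \<sigma>\<close> in \<open>C\<^sub>0\<close>.  Nondegeneracy survives because a compactly supported \<open>g\<close> satisfies
  \<open>g = g (f \<circ> \<sigma>)\<close> as soon as \<open>f = 1\<close> on the image of its support.
\<close>
lemma pushforward:
  fixes \<sigma> :: "'x \<Rightarrow> 'y::t2_space"
  assumes lc: "locally_compact_space (euclidean :: 'y topology)"
    and met: "metrizable_space (euclidean :: 'y topology)"
    and c: "continuous_on UNIV \<sigma>" and p: "proper_map euclidean euclidean \<sigma>"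
  shows "c0_rep H (\<lambda>f. \<pi> (\<lambda>x. f (\<sigma> x)))"
proof -
  note C = C0_comp_proper[OF _ c p]
  have nd: "h = 0" if h: "h \<in> H" and z: "\<And>f. f \<in> C0 \<Longrightarrow> \<pi> (\<lambda>x. f (\<sigma> x)) h = 0" for h
  proof (rule nondeg[OF h])
    fix g assume g: "g \<in> (C0 :: ('x \<Rightarrow> complex) set)"
    show "\<pi> g h = 0"
    proof (rule eq_0_if_soft_threshold_eq_0[OF g h])
      fix e :: real assume e: "e > 0"
      let ?t = "soft_threshold e g"
      have t: "?t \<in> C0" by (rule soft_threshold_C0[OF g e])
      have "compact (\<sigma> ` {x. e \<le> cmod (g x)})"
        using g e by (intro compact_continuous_image continuous_on_subset[OF c]) (auto simp: C0_def)
      from exists_C0_eq_1_on_compact[OF lc met this]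
      obtain f where f: "f \<in> C0" "\<forall>y\<in>\<sigma> ` {x. e \<le> cmod (g x)}. f y = 1" ..
      have "?t = (\<lambda>x. ?t x * f (\<sigma> x))"
        using f(2) soft_threshold_eq_0[of g _ e] by (auto simp: fun_eq_iff not_le[symmetric])
      then have "\<pi> ?t h = \<pi> ?t (\<pi> (\<lambda>x. f (\<sigma> x)) h)"
        using mult[OF t C[OF f(1)] h] by metis
      then show "\<pi> ?t h = 0" using z[OF f(1)] t by (simp only: zero_vec)
    qed
  qed
  show ?thesis
    by unfold_locales
      (rule H mem add_vec scale_vec add_fun scale_fun mult adj nd; (rule C)?; assumption | blast)+
qed

text \<open>
  The orthogonal complement of the span of all \<open>\<pi>(f) h\<close> is annihilated by every \<open>\<pi>(f)\<close>.
\<close>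
lemma star_rep: "star_rep H \<pi>"
proof -
  have adjoint: "\<pi> (\<lambda>x. cnj (f x)) h = adjoint_on H (\<pi> f) h" if "f \<in> C0" "h \<in> H" for f h
    using that by (intro adjoint_unique[symmetric] H mem C0_cnj adj)
  let ?S = "{\<pi> f h |f h. f \<in> C0 \<and> h \<in> H}"
  let ?Y = "closure (span ?S)"
  have "closed_csubspace ?Y"
  proof (rule closed_csubspace_closure)
    show "c *\<^sub>C x \<in> span ?S" if "x \<in> span ?S" for c x
      using that
    proof (induction rule: span_induct_alt)
      case base
      show ?case by (simp add: span_zero)
    next
      case (step r x y)
      obtain f h where x: "x = \<pi> f h" "f \<in> C0" "h \<in> H" using step by blast
      then have "c *\<^sub>C x \<in> ?S" using HD(4)[of h c] scale_vec[of f h c] by force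
      then have "r *\<^sub>R (c *\<^sub>C x) + c *\<^sub>C y \<in> span ?S"
        using step by (intro span_add span_scale) (auto intro: span_base)
      then show ?case
        by (simp add: scaleC_add_right linear_scale[OF bounded_linear.linear[OF bounded_linear_scaleC]])
    qed
  qed (auto intro: span_zero span_add)
  have "?Y \<subseteq> H"
    by (intro closure_minimal span_minimal HD(1)) (auto simp: subspace_def mem HD)
  have "H \<subseteq> ?Y"
  proof
    fix h assume h: "h \<in> H"
    define u where "u = h - proj_onto ?Y h"
    have pY: "proj_onto ?Y h \<in> ?Y" by (rule proj_in[OF \<open>closed_csubspace ?Y\<close>])
    then have uH: "u \<in> H" unfolding u_def using h \<open>?Y \<subseteq> H\<close> by (intro HD(7)) auto
    have "u = 0"
    proof (rule nondeg[OF uH])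
      fix f :: "'x \<Rightarrow> complex" assume f: "f \<in> C0"
      define v where "v = \<pi> f u"
      have v: "v \<in> H" unfolding v_def by (rule mem[OF f uH])
      have "\<pi> (\<lambda>x. cnj (f x)) v \<in> ?S" using C0_cnj[OF f] v by blast
      then have "\<pi> (\<lambda>x. cnj (f x)) v \<in> span ?S" by (rule span_base)
      then have "\<pi> (\<lambda>x. cnj (f x)) v \<in> ?Y" by (rule subsetD[OF closure_subset])
      then have "cinner u (\<pi> (\<lambda>x. cnj (f x)) v) = 0"
        unfolding u_def by (rule proj_orth[OF \<open>closed_csubspace ?Y\<close>])
      then have "cinner v v = 0" using adj[OF f uH v] by (simp add: v_def)
      then show "\<pi> f u = 0" by (simp add: v_def)
    qed
    then show "h \<in> ?Y" using pY by (simp add: u_def)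
  qed
  then show ?thesis
    unfolding star_rep_def using bounded_op adjoint by (simp add: add_fun scale_fun mult)
qed

end

lemma c0_rep_if_star_rep:
  assumes H: "closed_csubspace H" and \<pi>: "star_rep H \<pi>"
  shows "c0_rep H \<pi>"
proof -
  have b: "\<And>f. f \<in> C0 \<Longrightarrow> bounded_op H (\<pi> f)"
    and mult: "\<And>f g h. f \<in> C0 \<Longrightarrow> g \<in> C0 \<Longrightarrow> h \<in> H \<Longrightarrow> \<pi> (\<lambda>x. f x * g x) h = \<pi> f (\<pi> g h)"
    and add: "\<And>f g h. f \<in> C0 \<Longrightarrow> g \<in> C0 \<Longrightarrow> h \<in> H \<Longrightarrow> \<pi> (\<lambda>x. f x + g x) h = \<pi> f h + \<pi> g h"
    and scale: "\<And>c f h. f \<in> C0 \<Longrightarrow> h \<in> H \<Longrightarrow> \<pi> (\<lambda>x. c * f x) h = c *\<^sub>C \<pi> f h"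
    and ad: "\<And>f h. f \<in> C0 \<Longrightarrow> h \<in> H \<Longrightarrow> \<pi> (\<lambda>x. cnj (f x)) h = adjoint_on H (\<pi> f) h"
    and dense: "H \<subseteq> closure (span {\<pi> f h |f h. f \<in> C0 \<and> h \<in> H})"
    using \<pi> by (auto simp: star_rep_def)
  have mem: "\<pi> f h \<in> H" if "f \<in> C0" "h \<in> H" for f h
    using b[OF that(1)] that by (auto simp: bounded_op_def)
  have adj: "cinner (\<pi> f h) k = cinner h (\<pi> (\<lambda>x. cnj (f x)) k)" if "f \<in> C0" "h \<in> H" "k \<in> H" for f h k
    using adjoint_cinner[OF H b[OF that(1)] that(3,2)] ad[OF that(1,3)] by simp
  have nondeg: "h = 0" if h: "h \<in> H" and z: "\<And>f. f \<in> C0 \<Longrightarrow> \<pi> f h = 0" for h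
  proof -
    let ?Z = "{x. cinner x h = 0}"
    have "closed ?Z"
      by (intro closed_Collect_eq continuous_intros bounded_linear.continuous_on[OF bounded_linear_cinner_left])
    moreover have "subspace ?Z"
    proof -
      have "cinner (r *\<^sub>R x) h = r *\<^sub>R cinner x h" for r x
        by (rule linear_scale[OF bounded_linear.linear[OF bounded_linear_cinner_left]])
      then show ?thesis by (simp add: subspace_def cinner_add_left)
    qed
    moreover have "{\<pi> f h |f h. f \<in> C0 \<and> h \<in> H} \<subseteq> ?Z"
    proof (intro subsetI CollectI)
      fix x assume "x \<in> {\<pi> f h |f h. f \<in> C0 \<and> h \<in> H}"
      then obtain f k where x: "x = \<pi> f k" "f \<in> C0" "k \<in> H" by blast
      then show "cinner x h = 0" using adj[OF x(2,3) h] z[OF C0_cnj[OF x(2)]] by simp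
    qed
    ultimately have "closure (span {\<pi> f h |f h. f \<in> C0 \<and> h \<in> H}) \<subseteq> ?Z"
      by (intro closure_minimal span_minimal)
    then have "cinner h h = 0" using dense h by blast
    then show ?thesis by simp
  qed
  have lin: "\<pi> f (h + k) = \<pi> f h + \<pi> f k" "\<pi> f (c *\<^sub>C h) = c *\<^sub>C \<pi> f h"
    if "f \<in> C0" "h \<in> H" "k \<in> H" for f h k c
    using b[OF that(1)] that by (auto simp: bounded_op_def clinear_on_def)
  show ?thesis
    by unfold_locales (rule H mem lin add scale mult adj nondeg; assumption | blast)+
qed

section \<open>Square-summable families indexed by words\<close>

type_synonym word = "(bool \<times> nat) list"

text \<open>
  A bijection of the words with \<open>\<nat>\<close>, so that the coordinates of a sequence are indexed by words.
\<close>
definition word_code :: "word \<Rightarrow> nat" where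
  "word_code = to_nat_on UNIV"

lemma bij_word_code: "bij word_code"
  unfolding word_code_def by (rule to_nat_on_infinite) (auto simp: infinite_UNIV_listI)

definition coord :: "'a::chilbert l2seq \<Rightarrow> word \<Rightarrow> 'a" where
  "coord x w = l2nth x (word_code w)"

definition family :: "(word \<Rightarrow> 'a::chilbert) \<Rightarrow> 'a l2seq" where
  "family \<phi> = Abs_l2seq (\<lambda>m. \<phi> (inv word_code m))"

lemma l2nth_eq_coord: "l2nth x m = coord x (inv word_code m)"
  using bij_word_code by (simp add: coord_def bij_is_surj surj_f_inv_f)

lemma coord_eqI: "(\<And>w. coord x w = coord y w) \<Longrightarrow> x = y"
  by (simp add: l2nth_inject[symmetric] fun_eq_iff l2nth_eq_coord)

lemma coord_add: "coord (x + y) w = coord x w + coord y w"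
  by (simp add: coord_def plus_l2seq.rep_eq)
lemma coord_zero [simp]: "coord 0 w = 0"
  by (simp add: coord_def zero_l2seq.rep_eq)
lemma coord_scaleC: "coord (c *\<^sub>C x) w = c *\<^sub>C coord x w"
  by (simp add: coord_def scaleC_l2seq.rep_eq)

lemma summable_on_word_code:
  "summable (\<lambda>m. (norm (\<phi> (inv word_code m)))\<^sup>2) \<longleftrightarrow> (\<lambda>w. (norm (\<phi> w))\<^sup>2) summable_on UNIV"
proof -
  have "bij_betw (inv word_code) UNIV UNIV" using bij_word_code by (rule bij_imp_bij_inv)
  then have "(\<lambda>m. (norm (\<phi> (inv word_code m)))\<^sup>2) summable_on UNIV \<longleftrightarrow> (\<lambda>w. (norm (\<phi> w))\<^sup>2) summable_on UNIV"
    by (rule summable_on_reindex_bij_betw)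
  then show ?thesis by (simp add: summable_on_UNIV_nonneg_real_iff)
qed

lemma coord_family:
  assumes "(\<lambda>w. (norm (\<phi> w))\<^sup>2) summable_on UNIV"
  shows "coord (family \<phi>) w = \<phi> w"
  using assms bij_word_code
  by (simp add: coord_def family_def Abs_l2seq_inverse summable_on_word_code bij_is_inj)

lemma has_sum_coord: "((\<lambda>w. (norm (coord x w))\<^sup>2) has_sum (norm x)\<^sup>2) UNIV"
proof -
  have "(\<lambda>m. (norm (l2nth x m))\<^sup>2) sums (norm x)\<^sup>2"
    unfolding norm_l2seq_sq by (rule summable_sums[OF summable_l2nth])
  then have "((\<lambda>m. (norm (coord x (inv word_code m)))\<^sup>2) has_sum (norm x)\<^sup>2) UNIV"
    by (intro norm_summable_imp_has_sum) (auto simp: sums_iff simp flip: l2nth_eq_coord)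
  then show ?thesis
    using has_sum_reindex_bij_betw[OF bij_imp_bij_inv[OF bij_word_code]] by blast
qed

lemma cinner_coord_cong:
  assumes "\<And>w. cinner (coord x w) (coord y w) = cinner (coord x' w) (coord y' w)"
  shows "cinner x y = cinner x' y'"
  by (simp add: cinner_l2seq_def l2nth_eq_coord assms)

lemma cinner_single_coord:
  assumes "\<And>w. w \<noteq> w0 \<Longrightarrow> cinner (coord x w) (coord y w) = 0"
  shows "cinner x y = cinner (coord x w0) (coord y w0)"
proof -
  have "cinner (l2nth x m) (l2nth y m) = 0" if "m \<noteq> word_code w0" for m
  proof -
    have "inv word_code m \<noteq> w0"
      using bij_word_code that by (metis bij_is_surj surj_f_inv_f)
    then show ?thesis by (simp add: l2nth_eq_coord assms)
  qed
  then have "(\<lambda>m. cinner (l2nth x m) (l2nth y m))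
      = (\<lambda>m. if m = word_code w0 then cinner (l2nth x m) (l2nth y m) else 0)" by auto
  then have "(\<lambda>m. cinner (l2nth x m) (l2nth y m)) sums cinner (l2nth x (word_code w0)) (l2nth y (word_code w0))"
    using sums_single[of "word_code w0" "\<lambda>m. cinner (l2nth x m) (l2nth y m)"] by simp
  then show ?thesis by (simp add: cinner_l2seq_def sums_iff coord_def)
qed

lemma closed_csubspace_coords:
  assumes M: "\<And>w. closed_csubspace (M w)"
  shows "closed_csubspace {x. \<forall>w. coord x w \<in> M w}"
proof -
  have "closed {x. \<forall>w. coord x w \<in> M w}"
    unfolding closed_sequential_limits
  proof (intro allI impI CollectI, goal_cases)
    case (1 u l w)
    have "(\<lambda>k. coord (u k) w) \<longlonglongrightarrow> coord l w"
    proof (rule LIM_zero_cancel, rule Lim_null_comparison)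
      show "(\<lambda>k. norm (u k - l)) \<longlonglongrightarrow> 0" using 1 by (simp add: LIM_zero tendsto_norm_zero)
      show "\<forall>\<^sub>F k in sequentially. norm (coord (u k) w - coord l w) \<le> norm (u k - l)"
        using norm_l2nth_le[of "u _ - l" "word_code w"] by (simp add: coord_def minus_l2seq.rep_eq)
    qed
    then show ?case using 1 closed_csubspace_limit[OF M, of "\<lambda>k. coord (u k) w"] by auto
  qed
  then show ?thesis
    using closed_csubspaceD(2-4)[OF M] unfolding closed_csubspace_def
    by (simp add: coord_add coord_scaleC)
qed

section \<open>The dilation\<close>

locale covariant_rep =
  fixes n :: nat and \<sigma> :: "nat \<Rightarrow> 'x::t2_space \<Rightarrow> 'x" and H :: "'h::chilbert set"
    and \<pi> :: "('x \<Rightarrow> complex) \<Rightarrow> 'h \<Rightarrow> 'h" and S :: "nat \<Rightarrow> 'h \<Rightarrow> 'h"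
  assumes dynamical: "dynamical_system n \<sigma>"
    and metrizable: "metrizable_space (euclidean :: 'x topology)"
    and H: "closed_csubspace H"
    and covariant: "isometric_covariant_rep n \<sigma> H \<pi> S"
begin

lemma C0_comp:
  assumes "i \<in> {1..n}" "f \<in> C0"
  shows "(\<lambda>x. f (\<sigma> i x)) \<in> C0"
  by (rule C0_comp_proper[OF assms(2)]) (use dynamical assms(1) in \<open>auto simp: dynamical_system_def\<close>)

lemma isometry_S: "i \<in> {1..n} \<Longrightarrow> isometry H H (S i)"
  using covariant by (auto simp: isometric_covariant_rep_def)

lemma S_mem: "i \<in> {1..n} \<Longrightarrow> h \<in> H \<Longrightarrow> S i h \<in> H"
  using isometry_S by (auto simp: isometry_def)

lemma covariant_S: "i \<in> {1..n} \<Longrightarrow> f \<in> C0 \<Longrightarrow> h \<in> H \<Longrightarrow> \<pi> f (S i h) = S i (\<pi> (\<lambda>x. f (\<sigma> i x)) h)"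
  using covariant by (auto simp: isometric_covariant_rep_def o_def)

sublocale \<pi>: c0_rep H \<pi>
  by (rule c0_rep_if_star_rep[OF H]) (use covariant in \<open>auto simp: isometric_covariant_rep_def\<close>)

lemma S_mem_sspace:
  assumes i: "i \<in> {1..n}" and h: "h \<in> H"
  shows "S i h \<in> \<pi>.sspace (range (\<sigma> i))"
  unfolding \<pi>.sspace_def
proof (intro CollectI conjI ballI impI)
  show "S i h \<in> H" by (rule S_mem[OF i h])
  fix f :: "'x \<Rightarrow> complex" assume f: "f \<in> C0" "\<forall>x\<in>range (\<sigma> i). f x = 0"
  then have "(\<lambda>x. f (\<sigma> i x)) = (\<lambda>x. 0)" by auto
  then have "\<pi> f (S i h) = S i 0" using covariant_S[OF i f(1) h] \<pi>.zero_fun[OF h] by simp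
  also have "S i 0 = 0" using isometry_S[OF i] \<pi>.HD(2) by (auto simp: isometry_def)
  finally show "\<pi> f (S i h) = 0" .
qed

text \<open>The part of the spectral subspace of \<open>\<sigma>\<^sub>i(X)\<close> that \<open>S\<^sub>i\<close> does not reach.\<close>
definition defect :: "nat \<Rightarrow> 'h set" where
  "defect i = ortho_diff (\<pi>.sspace (range (\<sigma> i))) (S i ` H)"

lemma reducing_defect:
  assumes i: "i \<in> {1..n}"
  shows "\<pi>.reducing (defect i)"
  unfolding \<pi>.reducing_def
proof (intro conjI ballI image_subsetI)
  show "closed_csubspace (defect i)"
    unfolding defect_def by (rule closed_csubspace_ortho_diff[OF \<pi>.closed_csubspace_sspace])
  show sub: "defect i \<subseteq> H" using \<pi>.sspace_subset by (auto simp: defect_def ortho_diff_def)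
  fix f :: "'x \<Rightarrow> complex" and h assume f: "f \<in> C0" and h: "h \<in> defect i"
  have hH: "h \<in> H" using h sub by auto
  have "cinner (\<pi> f h) (S i k) = 0" if k: "k \<in> H" for k
  proof -
    have "cinner (\<pi> f h) (S i k) = cinner h (S i (\<pi> (\<lambda>x. cnj (f (\<sigma> i x))) k))"
      using \<pi>.adj[OF f hH S_mem[OF i k]] covariant_S[OF i C0_cnj[OF f] k] by simp
    also have "\<dots> = 0"
      using h \<pi>.mem[OF C0_cnj[OF C0_comp[OF i f]] k] by (auto simp: defect_def ortho_diff_def)
    finally show ?thesis .
  qed
  then show "\<pi> f h \<in> defect i"
    using h \<pi>.centralD(5)[OF \<pi>.central_sspace f] by (auto simp: defect_def ortho_diff_def)
qed

text \<open>
  The letter \<open>(True, i)\<close> pushes a representation forward along \<open>\<sigma>\<^sub>i\<close>; the letter \<open>(False, i)\<close> lifts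
  along \<open>\<sigma>\<^sub>i\<close> the part carried by \<open>\<sigma>\<^sub>i(X)\<close>, or what \<open>S\<^sub>i\<close> leaves uncovered of it in the root space \<open>H\<close>.
  Words are read from the right, starting at the root.
\<close>
primrec node :: "word \<Rightarrow> 'h set \<times> (('x \<Rightarrow> complex) \<Rightarrow> 'h \<Rightarrow> 'h)" where
  "node [] = (H, \<pi>)"
| "node (l # w) =
    (let M = fst (node w); r = snd (node w); i = snd l;
         N = (if w = [] then defect i else c0_rep.sspace M r (range (\<sigma> i)))
     in if fst l then (M, \<lambda>f. r (\<lambda>x. f (\<sigma> i x)))
        else (N, SOME \<rho>. c0_rep N \<rho> \<and> (\<forall>f\<in>C0. \<forall>h\<in>N. \<rho> (\<lambda>x. f (\<sigma> i x)) h = r f h)))"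

abbreviation "node_space w \<equiv> fst (node w)"
abbreviation "node_rep w \<equiv> snd (node w)"

lemma lift_exists:
  assumes M: "c0_rep M r" and Q: "c0_rep.reducing M r N" and N: "N \<subseteq> c0_rep.sspace M r (range (\<sigma> i))"
    and i: "i \<in> {1..n}"
  shows "\<exists>\<rho>. c0_rep N \<rho> \<and> (\<forall>f\<in>C0. \<forall>h\<in>N. \<rho> (\<lambda>x. f (\<sigma> i x)) h = r f h)"
proof -
  interpret M: c0_rep M r by (rule M)
  interpret N: c0_rep N r by (rule M.restriction[OF Q])
  have "N.sspace (range (\<sigma> i)) = N" using N by (auto simp: N.sspace_def M.sspace_def)
  then show "\<exists>\<rho>. c0_rep N \<rho> \<and> (\<forall>f\<in>C0. \<forall>h\<in>N. \<rho> (\<lambda>x. f (\<sigma> i x)) h = r f h)"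
    using C0_comp[OF i] by (rule N.exists_lift)
qed

lemma
  assumes "snd ` set w \<subseteq> {1..n}"
  shows node_c0_rep: "c0_rep (node_space w) (node_rep w)"
    and node_lift: "i \<in> {1..n} \<Longrightarrow> f \<in> C0 \<Longrightarrow> h \<in> node_space ((False, i) # w) \<Longrightarrow>
      node_rep ((False, i) # w) (\<lambda>x. f (\<sigma> i x)) h = node_rep w f h"
proof -
  have step: "c0_rep (node_space ((False, i) # w)) (node_rep ((False, i) # w)) \<and>
      (\<forall>f\<in>C0. \<forall>h\<in>node_space ((False, i) # w).
        node_rep ((False, i) # w) (\<lambda>x. f (\<sigma> i x)) h = node_rep w f h)"
    if w: "c0_rep (node_space w) (node_rep w)" and i: "i \<in> {1..n}" for w i
  proof (cases "w = []")
    case True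
    have "defect i \<subseteq> \<pi>.sspace (range (\<sigma> i))" by (auto simp: defect_def ortho_diff_def)
    from someI_ex[OF lift_exists[OF \<pi>.c0_rep_axioms reducing_defect[OF i] this i]] show ?thesis
      by (simp add: True Let_def)
  next
    case False
    interpret w: c0_rep "node_space w" "node_rep w" by (rule w)
    from someI_ex[OF lift_exists[OF w w.centralD(3)[OF w.central_sspace] order.refl i]] show ?thesis
      by (simp add: False Let_def)
  qed
  show rep: "c0_rep (node_space w) (node_rep w)"
    using assms
  proof (induction w)
    case Nil
    show ?case by (simp add: \<pi>.c0_rep_axioms)
  next
    case (Cons l w)
    then have w: "c0_rep (node_space w) (node_rep w)" and i: "snd l \<in> {1..n}" by auto
    interpret w: c0_rep "node_space w" "node_rep w" by (rule w)
    show ?case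
    proof (cases "fst l")
      case True
      have "c0_rep (node_space w) (\<lambda>f. node_rep w (\<lambda>x. f (\<sigma> (snd l) x)))"
        using dynamical i metrizable by (intro w.pushforward) (auto simp: dynamical_system_def)
      then show ?thesis using True by (simp add: Let_def)
    next
      case False
      then have "l = (False, snd l)" by (cases l) auto
      then show ?thesis using step[OF w i] by metis
    qed
  qed
  show "i \<in> {1..n} \<Longrightarrow> f \<in> C0 \<Longrightarrow> h \<in> node_space ((False, i) # w) \<Longrightarrow>
      node_rep ((False, i) # w) (\<lambda>x. f (\<sigma> i x)) h = node_rep w f h"
    using step[OF rep, of i] by blast
qed

text \<open>
  Pushing forward after lifting along the same map, or the converse, leads back to a summand that is
  already there, so only reduced words are used.  The last letter is a lift, because \<open>S\<^sub>i\<close> maps the root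
  to itself and no pushed copy of the root is wanted.
\<close>
primrec reduced :: "word \<Rightarrow> bool" where
  "reduced [] = True"
| "reduced (l # w) \<longleftrightarrow> reduced w \<and> snd l \<in> {1..n} \<and> (fst l \<longrightarrow> w \<noteq> []) \<and>
     (w \<noteq> [] \<longrightarrow> hd w \<noteq> (\<not> fst l, snd l))"

lemma reduced_letters: "reduced w \<Longrightarrow> snd ` set w \<subseteq> {1..n}"
  by (induction w) auto

text \<open>
  Left multiplication by the \<open>i\<close>-th generator and its inverse, in the free group on \<open>n\<close> generators;
  \<open>(True, i)\<close> is the generator and \<open>(False, i)\<close> its inverse.
\<close>
definition mult_gen :: "nat \<Rightarrow> word \<Rightarrow> word" where
  "mult_gen i u = (if u \<noteq> [] \<and> hd u = (False, i) then tl u else (True, i) # u)"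

definition mult_gen_inv :: "nat \<Rightarrow> word \<Rightarrow> word" where
  "mult_gen_inv i v = (if v \<noteq> [] \<and> hd v = (True, i) then tl v else (False, i) # v)"

text \<open>
  The two words removed on the right account for the root: the generator takes \<open>[(False, i)]\<close> to the
  empty word, and would take the empty word to \<open>[(True, i)]\<close>, which ends in a push.
\<close>
lemma bij_mult_gen_inv:
  assumes i: "i \<in> {1..n}"
  shows "bij_betw (mult_gen_inv i) ({w. reduced w} - {[]}) ({w. reduced w} - {[], [(False, i)]})"
proof (rule bij_betw_byWitness[where f' = "mult_gen i"])
  show "\<forall>a\<in>{w. reduced w} - {[]}. mult_gen i (mult_gen_inv i a) = a"
  proof
    fix v assume "v \<in> {w. reduced w} - {[]}"
    then show "mult_gen i (mult_gen_inv i v) = v"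
      by (cases v) (auto simp: mult_gen_def mult_gen_inv_def)
  qed
  show "\<forall>a\<in>{w. reduced w} - {[], [(False, i)]}. mult_gen_inv i (mult_gen i a) = a"
  proof
    fix u assume "u \<in> {w. reduced w} - {[], [(False, i)]}"
    then show "mult_gen_inv i (mult_gen i u) = u"
      by (cases u) (auto simp: mult_gen_def mult_gen_inv_def)
  qed
  show "mult_gen_inv i ` ({w. reduced w} - {[]}) \<subseteq> {w. reduced w} - {[], [(False, i)]}"
  proof (rule image_subsetI)
    fix v assume "v \<in> {w. reduced w} - {[]}"
    then show "mult_gen_inv i v \<in> {w. reduced w} - {[], [(False, i)]}"
      using i by (cases v) (auto simp: mult_gen_inv_def)
  qed
  show "mult_gen i ` ({w. reduced w} - {[], [(False, i)]}) \<subseteq> {w. reduced w} - {[]}"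
  proof (rule image_subsetI)
    fix u assume "u \<in> {w. reduced w} - {[], [(False, i)]}"
    then show "mult_gen i u \<in> {w. reduced w} - {[]}"
      using i by (cases u) (auto simp: mult_gen_def)
  qed
qed

definition fiber :: "word \<Rightarrow> 'h set" where
  "fiber w = (if reduced w then node_space w else {0})"

definition K :: "'h l2seq set" where
  "K = {x. \<forall>w. coord x w \<in> fiber w}"

definition \<rho> :: "('x \<Rightarrow> complex) \<Rightarrow> 'h l2seq \<Rightarrow> 'h l2seq" where
  "\<rho> f x = family (\<lambda>w. if reduced w then node_rep w f (coord x w) else 0)"

definition V :: "'h \<Rightarrow> 'h l2seq" where
  "V h = family (\<lambda>w. if w = [] then h else 0)"

definition T :: "nat \<Rightarrow> 'h l2seq \<Rightarrow> 'h l2seq" where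
  "T i x = family (\<lambda>v. if v = [] then S i (coord x []) + coord x [(False, i)]
     else if reduced v then coord x (mult_gen_inv i v) else 0)"

lemma fiber_rep: "reduced w \<Longrightarrow> c0_rep (node_space w) (node_rep w)"
  by (rule node_c0_rep[OF reduced_letters])

lemma fiber_Nil: "fiber [] = H" by (simp add: fiber_def)

lemma closed_csubspace_fiber: "closed_csubspace (fiber w)"
  using c0_rep.H[OF fiber_rep] closed_csubspace_singleton_zero by (auto simp: fiber_def)

lemma closed_csubspace_K: "closed_csubspace K"
  unfolding K_def by (rule closed_csubspace_coords[OF closed_csubspace_fiber])

lemma K_coord: "x \<in> K \<Longrightarrow> coord x w \<in> fiber w" by (simp add: K_def)
lemma K_coord_reduced: "x \<in> K \<Longrightarrow> reduced w \<Longrightarrow> coord x w \<in> node_space w"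
  using K_coord[of x w] by (simp add: fiber_def)
lemma K_coord_not_reduced: "x \<in> K \<Longrightarrow> \<not> reduced w \<Longrightarrow> coord x w = 0"
  using K_coord[of x w] by (simp add: fiber_def)

lemma coord_\<rho>:
  assumes f: "f \<in> C0" and x: "x \<in> K"
  shows "coord (\<rho> f x) w = (if reduced w then node_rep w f (coord x w) else 0)"
proof -
  let ?r = "\<lambda>w. if reduced w then node_rep w f (coord x w) else 0"
  obtain B where B: "B \<ge> 0" "\<And>x. cmod (f x) \<le> B" using C0_bounded[OF f] by blast
  have "(\<lambda>w. B\<^sup>2 * (norm (coord x w))\<^sup>2) summable_on UNIV"
    by (intro summable_on_cmult_right has_sum_imp_summable[OF has_sum_coord])
  then have "(\<lambda>w. (norm (?r w))\<^sup>2) summable_on UNIV"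
  proof (rule summable_on_comparison_test)
    fix w
    show "(norm (?r w))\<^sup>2 \<le> B\<^sup>2 * (norm (coord x w))\<^sup>2"
    proof (cases "reduced w")
      case True
      have "norm (node_rep w f (coord x w)) \<le> B * norm (coord x w)"
        by (rule c0_rep.norm_le[OF fiber_rep[OF True] f K_coord_reduced[OF x True] B])
      then show ?thesis using True power_mono[of _ "B * norm (coord x w)" 2] by (simp add: power_mult_distrib)
    qed simp
  qed simp
  then show ?thesis unfolding \<rho>_def by (rule coord_family)
qed

sublocale \<rho>: c0_rep K \<rho>
proof
  show "closed_csubspace K" by (rule closed_csubspace_K)
  have K: "h + k \<in> K" "c *\<^sub>C h \<in> K" if "h \<in> K" "k \<in> K" for h k c
    using that closed_csubspaceD[OF closed_csubspace_K] by auto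
  note red = K_coord_reduced
  fix f g :: "'x \<Rightarrow> complex" and h k c assume f: "f \<in> C0" and h: "h \<in> K"
  show mem: "\<rho> f h \<in> K" if "f \<in> C0" "h \<in> K" for f h
    using that c0_rep.mem[OF fiber_rep] red by (auto simp: K_def coord_\<rho> fiber_def)
  show "\<rho> f (c *\<^sub>C h) = c *\<^sub>C \<rho> f h"
    using f h K red by (intro coord_eqI) (auto simp: coord_\<rho> coord_scaleC c0_rep.scale_vec[OF fiber_rep])
  show "\<rho> (\<lambda>x. c * f x) h = c *\<^sub>C \<rho> f h"
    using f h C0_scale[OF f, of c] red
    by (intro coord_eqI) (auto simp: coord_\<rho> coord_scaleC c0_rep.scale_fun[OF fiber_rep])
  {
    assume k: "k \<in> K"
    show "\<rho> f (h + k) = \<rho> f h + \<rho> f k"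
      using f h k K red by (intro coord_eqI) (auto simp: coord_\<rho> coord_add c0_rep.add_vec[OF fiber_rep])
    show "cinner (\<rho> f h) k = cinner h (\<rho> (\<lambda>x. cnj (f x)) k)"
      using f h k C0_cnj[OF f] red by (intro cinner_coord_cong) (auto simp: coord_\<rho> c0_rep.adj[OF fiber_rep] K_coord_not_reduced)
  next
    assume g: "g \<in> C0"
    show "\<rho> (\<lambda>x. f x + g x) h = \<rho> f h + \<rho> g h"
      using f g h C0_add[OF f g] red
      by (intro coord_eqI) (auto simp: coord_\<rho> coord_add c0_rep.add_fun[OF fiber_rep])
    show "\<rho> (\<lambda>x. f x * g x) h = \<rho> f (\<rho> g h)"
      using f g h C0_mult[OF f g] mem[OF g h] red
      by (intro coord_eqI) (auto simp: coord_\<rho> c0_rep.mult[OF fiber_rep])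
  }
next
  fix x assume x: "x \<in> K" and z: "\<And>f. f \<in> C0 \<Longrightarrow> \<rho> f x = 0"
  show "x = 0"
  proof (rule coord_eqI)
    fix w
    show "coord x w = coord 0 w"
    proof (cases "reduced w")
      case True
      have "node_rep w f (coord x w) = 0" if "f \<in> C0" for f
        using coord_\<rho>[OF that x, of w] z[OF that] True by simp
      then show ?thesis using c0_rep.nondeg[OF fiber_rep[OF True] K_coord_reduced[OF x True]] by simp
    qed (simp add: K_coord_not_reduced[OF x])
  qed
qed

sublocale \<rho>: metrizable_c0_rep K \<rho>
  by unfold_locales (rule metrizable)

lemma coord_V: "coord (V h) w = (if w = [] then h else 0)"
  unfolding V_def
proof (rule coord_family)
  have "(\<lambda>w. (norm (if w = [] then h else 0))\<^sup>2) summable_on {[]}" by simp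
  then show "(\<lambda>w::word. (norm (if w = [] then h else 0))\<^sup>2) summable_on UNIV"
    by (rule summable_on_cong_neutral[THEN iffD1, rotated -1]) auto
qed

lemma V_mem: "h \<in> H \<Longrightarrow> V h \<in> K"
  using closed_csubspaceD(2)[OF closed_csubspace_fiber] by (auto simp: K_def coord_V fiber_Nil)

lemma norm_V: "norm (V h) = norm h"
proof -
  have "complex_of_real ((norm (V h))\<^sup>2) = complex_of_real ((norm h)\<^sup>2)"
    unfolding cinner_self[symmetric] using cinner_single_coord[of "[]" "V h" "V h"] by (simp add: coord_V)
  then show ?thesis by (simp only: of_real_eq_iff) (simp add: power2_eq_iff_nonneg)
qed

lemma isometry_V: "isometry H K V"
  unfolding isometry_def clinear_on_def
  using V_mem by (auto simp: norm_V intro!: coord_eqI simp: coord_V coord_add coord_scaleC)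

lemma V_image: "V ` H = {x\<in>K. \<forall>w. w \<noteq> [] \<longrightarrow> coord x w = 0}"
proof
  show "V ` H \<subseteq> {x\<in>K. \<forall>w. w \<noteq> [] \<longrightarrow> coord x w = 0}" using V_mem by (auto simp: coord_V)
  show "{x\<in>K. \<forall>w. w \<noteq> [] \<longrightarrow> coord x w = 0} \<subseteq> V ` H"
  proof
    fix x assume x: "x \<in> {x\<in>K. \<forall>w. w \<noteq> [] \<longrightarrow> coord x w = 0}"
    then have "x = V (coord x [])" by (intro coord_eqI) (auto simp: coord_V)
    moreover have "coord x [] \<in> H" using x K_coord[of x "[]"] by (simp add: fiber_Nil)
    ultimately show "x \<in> V ` H" by blast
  qed
qed

lemma closed_csubspace_V: "closed_csubspace (V ` H)"
proof -
  have "V ` H = {x. \<forall>w. coord x w \<in> (if w = [] then H else {0})}"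
  proof -
    have "(coord x w \<in> fiber w \<and> (w \<noteq> [] \<longrightarrow> coord x w = 0)) \<longleftrightarrow> coord x w \<in> (if w = [] then H else {0})"
      for x :: "'h l2seq" and w
      using closed_csubspaceD(2)[OF closed_csubspace_fiber[of w]] fiber_Nil by auto
    then show ?thesis unfolding V_image K_def by blast
  qed
  moreover have "closed_csubspace {x. \<forall>w. coord x w \<in> (if w = [] then H else {0})}"
    by (rule closed_csubspace_coords) (simp add: H closed_csubspace_singleton_zero)
  ultimately show ?thesis by (simp only:)
qed

lemma \<rho>_V: "f \<in> C0 \<Longrightarrow> h \<in> H \<Longrightarrow> \<rho> f (V h) = V (\<pi> f h)"
  by (intro coord_eqI) (auto simp: coord_\<rho> V_mem coord_V c0_rep.zero_vec[OF fiber_rep])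

lemma reduces_V:
  assumes f: "f \<in> C0"
  shows "reduces K (\<rho> f) (V ` H)"
  unfolding reduces_def
proof (intro conjI image_subsetI)
  show "\<rho> f x \<in> V ` H" if "x \<in> V ` H" for x using that \<rho>_V[OF f] \<pi>.mem[OF f] by auto
  fix x assume "x \<in> ortho_diff K (V ` H)"
  then have x: "x \<in> K" "\<And>h. h \<in> H \<Longrightarrow> cinner x (V h) = 0" by (auto simp: ortho_diff_def)
  have "cinner (\<rho> f x) (V h) = 0" if "h \<in> H" for h
    using \<rho>.adj[OF f x(1) V_mem[OF that]] x(2) that \<pi>.mem[OF C0_cnj[OF f]] \<rho>_V[OF C0_cnj[OF f]] by simp
  then show "\<rho> f x \<in> ortho_diff K (V ` H)" using \<rho>.mem[OF f x(1)] by (auto simp: ortho_diff_def)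
qed

lemma reduced_singleton: "i \<in> {1..n} \<Longrightarrow> reduced [(False, i)]" by simp

lemma coord_defect: "i \<in> {1..n} \<Longrightarrow> x \<in> K \<Longrightarrow> coord x [(False, i)] \<in> defect i"
  using K_coord_reduced[of x "[(False, i)]"] by (simp add: Let_def)

text \<open>
  Summing over reduced words, left multiplication by a generator only moves the terms around,
  except that the words \<open>[]\<close> and \<open>[(False, i)]\<close> both end up in the root.
\<close>
lemma has_sum_shift:
  assumes i: "i \<in> {1..n}" and b: "\<And>w. \<not> reduced w \<Longrightarrow> b w = 0" and c: "\<And>w. \<not> reduced w \<Longrightarrow> c w = (0::real)"
    and cb: "\<And>v. reduced v \<Longrightarrow> v \<noteq> [] \<Longrightarrow> c v = b (mult_gen_inv i v)"
    and root: "c [] = b [] + b [(False, i)]"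
  shows "(b has_sum s) UNIV \<longleftrightarrow> (c has_sum s) UNIV"
proof -
  let ?W = "{w. reduced w}"
  let ?A = "?W - {[], [(False, i)]}"
  have A: "?W = {[], [(False, i)]} \<union> ?A" "?W = {[]} \<union> (?W - {[]})" using i by auto
  have fin: "(g has_sum s) UNIV \<longleftrightarrow> (g has_sum (s - (\<Sum>w\<in>F. g w))) (?W - F)"
    if g: "\<And>w. \<not> reduced w \<Longrightarrow> g w = 0" and F: "finite F" "F \<subseteq> ?W" for g :: "word \<Rightarrow> real" and F
  proof -
    have "(g has_sum s) UNIV \<longleftrightarrow> (g has_sum s) ?W"
      by (rule has_sum_cong_neutral) (use g in auto)
    also have "\<dots> \<longleftrightarrow> (g has_sum (s - (\<Sum>w\<in>F. g w))) (?W - F)"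
    proof
      assume "(g has_sum s) ?W"
      then show "(g has_sum (s - (\<Sum>w\<in>F. g w))) (?W - F)"
        by (rule has_sum_Diff) (use F in \<open>auto intro: has_sum_finite\<close>)
    next
      assume "(g has_sum (s - (\<Sum>w\<in>F. g w))) (?W - F)"
      from has_sum_Un_disjoint[OF has_sum_finite[OF F(1)] this]
      have "(g has_sum s) (F \<union> (?W - F))" by simp
      moreover have "F \<union> (?W - F) = ?W" using F by auto
      ultimately show "(g has_sum s) ?W" by simp
    qed
    finally show ?thesis .
  qed
  have "(b has_sum s) UNIV \<longleftrightarrow> (b has_sum (s - c [])) ?A"
    using fin[of b "{[], [(False, i)]}"] b reduced_singleton[OF i] by (simp add: root)
  also have "\<dots> \<longleftrightarrow> ((\<lambda>v. b (mult_gen_inv i v)) has_sum (s - c [])) (?W - {[]})"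
    using has_sum_reindex_bij_betw[OF bij_mult_gen_inv[OF i]] by blast
  also have "\<dots> \<longleftrightarrow> (c has_sum (s - c [])) (?W - {[]})"
    by (rule has_sum_cong) (use cb in auto)
  also have "\<dots> \<longleftrightarrow> (c has_sum s) UNIV" using fin[of c "{[]}"] c by simp
  finally show ?thesis .
qed

lemma norm_root_sq:
  assumes i: "i \<in> {1..n}" and x: "a \<in> H" "m \<in> defect i"
  shows "(norm (S i a + m))\<^sup>2 = (norm a)\<^sup>2 + (norm m)\<^sup>2"
proof -
  have "cinner m (S i a) = 0" using x by (auto simp: defect_def ortho_diff_def)
  then have "cinner (S i a) m = 0" using cinner_eq_0_sym by blast
  then show ?thesis using isometry_S[OF i] x(1) by (simp add: norm_add_orthogonal_sq isometry_def)
qed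

lemma
  assumes i: "i \<in> {1..n}" and x: "x \<in> K"
  shows coord_T: "coord (T i x) v = (if v = [] then S i (coord x []) + coord x [(False, i)]
      else if reduced v then coord x (mult_gen_inv i v) else 0)"
    and norm_T: "norm (T i x) = norm x"
proof -
  let ?t = "\<lambda>v. if v = [] then S i (coord x []) + coord x [(False, i)]
      else if reduced v then coord x (mult_gen_inv i v) else 0"
  have x0: "coord x [] \<in> H" using K_coord[OF x, of "[]"] by (simp add: fiber_Nil)
  have hs: "((\<lambda>v. (norm (?t v))\<^sup>2) has_sum (norm x)\<^sup>2) UNIV"
    using has_sum_coord[of x]
    by (subst (asm) has_sum_shift[OF i, of _ "\<lambda>v. (norm (?t v))\<^sup>2"])
      (auto simp: K_coord_not_reduced[OF x] norm_root_sq[OF i x0 coord_defect[OF i x]])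
  then have "(\<lambda>v. (norm (?t v))\<^sup>2) summable_on UNIV" by (rule has_sum_imp_summable)
  then have *: "coord (T i x) v = ?t v" for v unfolding T_def by (rule coord_family)
  then show "coord (T i x) v = ?t v" .
  have "((\<lambda>v. (norm (?t v))\<^sup>2) has_sum (norm (T i x))\<^sup>2) UNIV" using has_sum_coord[of "T i x"] by (simp only: *)
  then have "(norm (T i x))\<^sup>2 = (norm x)\<^sup>2" using hs by (rule has_sum_unique)
  then show "norm (T i x) = norm x" by (simp add: power2_eq_iff_nonneg)
qed

text \<open>
  Away from the root, \<open>T\<^sub>i\<close> identifies the summand at \<open>mult_gen_inv i v\<close> with the part of the summand
  at \<open>v\<close> carried by \<open>\<sigma>\<^sub>i(X)\<close>, in a covariant way: either the former was lifted from the latter, or the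
  latter was pushed forward from the former and is entirely carried by \<open>\<sigma>\<^sub>i(X)\<close>.
\<close>
lemma node_mult_gen_inv:
  assumes i: "i \<in> {1..n}" and v: "reduced v" "v \<noteq> []" and h: "h \<in> node_space (mult_gen_inv i v)"
  shows "h \<in> c0_rep.sspace (node_space v) (node_rep v) (range (\<sigma> i))"
    and "f \<in> C0 \<Longrightarrow> node_rep v f h = node_rep (mult_gen_inv i v) (\<lambda>x. f (\<sigma> i x)) h"
proof -
  interpret v: c0_rep "node_space v" "node_rep v" by (rule fiber_rep[OF v(1)])
  show eq: "node_rep v f h = node_rep (mult_gen_inv i v) (\<lambda>x. f (\<sigma> i x)) h" if "f \<in> C0" for f
  proof (cases "hd v = (True, i)")
    case True
    then obtain w where "v = (True, i) # w" using v(2) by (cases v) auto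
    then show ?thesis by (simp add: mult_gen_inv_def Let_def)
  next
    case False
    then have m: "mult_gen_inv i v = (False, i) # v" by (simp add: mult_gen_inv_def)
    show ?thesis using node_lift[OF reduced_letters[OF v(1)] i that] h by (simp only: m)
  qed
  show "h \<in> v.sspace (range (\<sigma> i))"
  proof (cases "hd v = (True, i)")
    case True
    then obtain w where w: "v = (True, i) # w" using v(2) by (cases v) auto
    interpret w: c0_rep "node_space w" "node_rep w" by (rule fiber_rep) (use v(1) w in auto)
    have h: "h \<in> node_space w" using h w by (simp add: mult_gen_inv_def)
    show ?thesis unfolding v.sspace_def
    proof (intro CollectI conjI ballI impI)
      show "h \<in> node_space v" using h by (simp add: w Let_def)
      fix f :: "'x \<Rightarrow> complex" assume "f \<in> C0" "\<forall>x\<in>range (\<sigma> i). f x = 0"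
      then have "(\<lambda>x. f (\<sigma> i x)) = (\<lambda>x. 0)" by auto
      then show "node_rep v f h = 0" using w.zero_fun[OF h] by (simp add: w Let_def)
    qed
  next
    case False
    then show ?thesis using h v(2) by (simp add: mult_gen_inv_def Let_def)
  qed
qed

lemma sspace_subset_node_mult_gen_inv:
  assumes i: "i \<in> {1..n}" and v: "reduced v" "v \<noteq> []"
  shows "c0_rep.sspace (node_space v) (node_rep v) (range (\<sigma> i)) \<subseteq> node_space (mult_gen_inv i v)"
proof (cases "hd v = (True, i)")
  case True
  then obtain w where "v = (True, i) # w" using v(2) by (cases v) auto
  then show ?thesis using c0_rep.sspace_subset[OF fiber_rep[OF v(1)]] by (simp add: mult_gen_inv_def Let_def)
next
  case False
  then show ?thesis using v(2) by (simp add: mult_gen_inv_def Let_def)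
qed

lemma reduced_mult_gen_inv: "i \<in> {1..n} \<Longrightarrow> reduced v \<Longrightarrow> v \<noteq> [] \<Longrightarrow> reduced (mult_gen_inv i v)"
  using bij_betwE[OF bij_mult_gen_inv] by blast

lemma T_mem:
  assumes i: "i \<in> {1..n}" and x: "x \<in> K"
  shows "T i x \<in> K"
proof -
  have "coord (T i x) v \<in> fiber v" for v
  proof (cases "v = [] \<or> \<not> reduced v")
    case True
    moreover have "S i (coord x []) + coord x [(False, i)] \<in> H"
      using K_coord[OF x, of "[]"] coord_defect[OF i x] reducing_defect[OF i]
      by (intro \<pi>.HD(3) S_mem[OF i]) (auto simp: fiber_Nil \<pi>.reducing_def)
    ultimately show ?thesis by (auto simp: coord_T[OF i x] fiber_Nil) (simp add: fiber_def)
  next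
    case False
    then have v: "reduced v" "v \<noteq> []" by auto
    have "coord x (mult_gen_inv i v) \<in> node_space (mult_gen_inv i v)"
      by (rule K_coord_reduced[OF x reduced_mult_gen_inv[OF i v]])
    from node_mult_gen_inv(1)[OF i v this] show ?thesis
      using v c0_rep.sspace_subset[OF fiber_rep[OF v(1)]] by (auto simp: coord_T[OF i x] fiber_def)
  qed
  then show ?thesis by (simp add: K_def)
qed

lemma isometry_T:
  assumes i: "i \<in> {1..n}"
  shows "isometry K K (T i)"
  unfolding isometry_def clinear_on_def
proof (intro conjI ballI allI image_subsetI)
  have S: "S i (a + b) = S i a + S i b" "S i (c *\<^sub>C a) = c *\<^sub>C S i a" if "a \<in> H" "b \<in> H" for a b c
    using isometry_S[OF i] that by (auto simp: isometry_def clinear_on_def)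
  fix x assume x: "x \<in> K"
  show "T i x \<in> K" by (rule T_mem[OF i x])
  show "norm (T i x) = norm x" by (rule norm_T[OF i x])
  have x0: "coord x [] \<in> H" using K_coord[OF x, of "[]"] by (simp add: fiber_Nil)
  show "T i (c *\<^sub>C x) = c *\<^sub>C T i x" for c
    using \<rho>.HD(4)[OF x, of c] x
    by (intro coord_eqI) (simp add: coord_T[OF i] coord_scaleC S[OF x0 x0] scaleC_add_right)
  fix y assume y: "y \<in> K"
  have y0: "coord y [] \<in> H" using K_coord[OF y, of "[]"] by (simp add: fiber_Nil)
  show "T i (x + y) = T i x + T i y"
    using \<rho>.HD(3)[OF x y] x y
    by (intro coord_eqI) (simp add: coord_T[OF i] coord_add S[OF x0 y0])
qed

lemma covariant_T:
  assumes i: "i \<in> {1..n}" and f: "f \<in> C0" and x: "x \<in> K"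
  shows "\<rho> f (T i x) = T i (\<rho> (\<lambda>x. f (\<sigma> i x)) x)"
proof (rule coord_eqI)
  fix v
  note fc = C0_comp[OF i f]
  have px: "\<rho> (\<lambda>x. f (\<sigma> i x)) x \<in> K" by (rule \<rho>.mem[OF fc x])
  show "coord (\<rho> f (T i x)) v = coord (T i (\<rho> (\<lambda>x. f (\<sigma> i x)) x)) v"
  proof (cases "v = [] \<or> \<not> reduced v")
    case True
    have a: "coord x [] \<in> H" using K_coord[OF x, of "[]"] by (simp add: fiber_Nil)
    have m: "coord x [(False, i)] \<in> node_space [(False, i)]" by (rule K_coord_reduced[OF x reduced_singleton[OF i]])
    have mH: "coord x [(False, i)] \<in> H"
      using coord_defect[OF i x] reducing_defect[OF i] by (auto simp: \<pi>.reducing_def)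
    have "\<pi> f (S i (coord x []) + coord x [(False, i)])
        = S i (\<pi> (\<lambda>x. f (\<sigma> i x)) (coord x [])) + node_rep [(False, i)] (\<lambda>x. f (\<sigma> i x)) (coord x [(False, i)])"
      using node_lift[of "[]" i f, OF _ i f m]
      by (simp add: \<pi>.add_vec[OF f S_mem[OF i a] mH] covariant_S[OF i f a] del: node.simps(2))
    then show ?thesis
      using True reduced_singleton[OF i]
      by (auto simp: coord_\<rho>[OF f T_mem[OF i x]] coord_T[OF i x] coord_T[OF i px] coord_\<rho>[OF fc x] simp del: node.simps(2) reduced.simps(2))
  next
    case False
    then have v: "reduced v" "v \<noteq> []" by auto
    note rv = reduced_mult_gen_inv[OF i v]
    have "node_rep v f (coord x (mult_gen_inv i v))
        = node_rep (mult_gen_inv i v) (\<lambda>x. f (\<sigma> i x)) (coord x (mult_gen_inv i v))"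
      by (rule node_mult_gen_inv(2)[OF i v K_coord_reduced[OF x rv] f])
    then show ?thesis
      using v rv by (simp add: coord_\<rho>[OF f T_mem[OF i x]] coord_T[OF i x] coord_T[OF i px] coord_\<rho>[OF fc x])
  qed
qed

text \<open>
  A vector \<open>y\<close> carried by \<open>\<sigma>\<^sub>i(X)\<close> is pulled back coordinate by coordinate along \<open>mult_gen i\<close>.  Its
  root coordinate splits as \<open>S\<^sub>i a + m\<close> where \<open>S\<^sub>i\<^sup>*\<close> maps it to \<open>a\<close> and \<open>m\<close> in the defect space.
\<close>
lemma T_image:
  assumes i: "i \<in> {1..n}"
  shows "T i ` K = \<rho>.sspace (range (\<sigma> i))"
proof
  show "T i ` K \<subseteq> \<rho>.sspace (range (\<sigma> i))"
  proof (intro image_subsetI)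
    fix x assume x: "x \<in> K"
    show "T i x \<in> \<rho>.sspace (range (\<sigma> i))"
      unfolding \<rho>.sspace_def
    proof (intro CollectI conjI ballI impI)
      show "T i x \<in> K" by (rule T_mem[OF i x])
      fix f :: "'x \<Rightarrow> complex" assume f: "f \<in> C0" "\<forall>x\<in>range (\<sigma> i). f x = 0"
      then have "(\<lambda>x. f (\<sigma> i x)) = (\<lambda>x. 0)" by auto
      then have "\<rho> f (T i x) = T i 0" using covariant_T[OF i f(1) x] \<rho>.zero_fun[OF x] by simp
      then show "\<rho> f (T i x) = 0" using norm_T[OF i \<rho>.HD(2)] by simp
    qed
  qed
  show "\<rho>.sspace (range (\<sigma> i)) \<subseteq> T i ` K"
  proof
    fix y assume y: "y \<in> \<rho>.sspace (range (\<sigma> i))"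
    then have yK: "y \<in> K" using \<rho>.sspace_subset by auto
    have ys: "coord y v \<in> c0_rep.sspace (node_space v) (node_rep v) (range (\<sigma> i))" if v: "reduced v" for v
    proof -
      interpret v: c0_rep "node_space v" "node_rep v" by (rule fiber_rep[OF v])
      have "node_rep v f (coord y v) = 0" if f: "f \<in> C0" "\<forall>x\<in>range (\<sigma> i). f x = 0" for f
      proof -
        have "\<rho> f y = 0" using y f by (auto simp: \<rho>.sspace_def)
        then show ?thesis using coord_\<rho>[OF f(1) yK, of v] v by simp
      qed
      then show ?thesis using K_coord_reduced[OF yK v] by (auto simp: v.sspace_def)
    qed
    define a where "a = adjoint_on H (S i) (coord y [])"
    define m where "m = coord y [] - S i a"
    have y0: "coord y [] \<in> \<pi>.sspace (range (\<sigma> i))" using ys[of "[]"] by simp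
    then have y0H: "coord y [] \<in> H" using \<pi>.sspace_subset by auto
    have aH: "a \<in> H" unfolding a_def
      by (rule adjoint_in[OF H isometry_imp_bounded_op[OF isometry_S[OF i]] y0H])
    have m: "m \<in> defect i"
      unfolding defect_def ortho_diff_def
    proof (intro CollectI conjI ballI)
      show "m \<in> \<pi>.sspace (range (\<sigma> i))"
        unfolding m_def by (intro closed_csubspaceD(7)[OF \<pi>.closed_csubspace_sspace] y0 S_mem_sspace[OF i aH])
      show "cinner m z = 0" if "z \<in> S i ` H" for z
        using that isometry_range_proj[OF H isometry_S[OF i] y0H] by (auto simp: m_def a_def)
    qed
    let ?\<phi> = "\<lambda>u. if u = [] then a else if u = [(False, i)] then m
      else if reduced u then coord y (mult_gen i u) else 0"
    have inv: "mult_gen i (mult_gen_inv i v) = v" "mult_gen_inv i v \<noteq> []" "mult_gen_inv i v \<noteq> [(False, i)]"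
      if "reduced v" "v \<noteq> []" for v
    proof -
      show "mult_gen i (mult_gen_inv i v) = v"
        using that by (cases v) (auto simp: mult_gen_def mult_gen_inv_def)
      show "mult_gen_inv i v \<noteq> []" "mult_gen_inv i v \<noteq> [(False, i)]"
        using bij_betwE[OF bij_mult_gen_inv[OF i]] that by auto
    qed
    have eq0: "coord y [] = S i a + m" by (simp add: m_def)
    have "((\<lambda>u. (norm (?\<phi> u))\<^sup>2) has_sum (norm y)\<^sup>2) UNIV"
      by (subst has_sum_shift[OF i, of _ "\<lambda>v. (norm (coord y v))\<^sup>2"])
        (use has_sum_coord[of y] inv reduced_mult_gen_inv[OF i] reduced_singleton[OF i] norm_root_sq[OF i aH m]
          in \<open>auto simp: K_coord_not_reduced[OF yK] eq0 simp del: reduced.simps(2)\<close>)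
    then have c: "coord (family ?\<phi>) u = ?\<phi> u" for u by (intro coord_family) (rule has_sum_imp_summable)
    define x where "x = family ?\<phi>"
    have "x \<in> K"
      unfolding K_def
    proof (intro CollectI allI)
      fix u
      consider "u = []" | "u = [(False, i)]" | "\<not> reduced u"
        | "u \<in> {w. reduced w} - {[], [(False, i)]}" by blast
      then show "coord x u \<in> fiber u"
      proof cases
        case 4
        then obtain v where v: "reduced v" "v \<noteq> []" "u = mult_gen_inv i v"
          using bij_betw_imp_surj_on[OF bij_mult_gen_inv[OF i]] by blast
        have "coord x u = coord y v" using 4 inv[OF v(1,2)] by (simp add: x_def c v(3))
        moreover have "coord y v \<in> node_space u"
          using sspace_subset_node_mult_gen_inv[OF i v(1,2)] ys[OF v(1)] v(3) by auto
        ultimately show ?thesis using 4 by (simp add: fiber_def)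
      qed (use aH m i in \<open>auto simp: x_def c fiber_def Let_def\<close>)
    qed
    moreover have "T i x = y"
    proof (rule coord_eqI)
      fix v
      have x: "coord x u = ?\<phi> u" for u by (simp only: x_def c)
      consider "v = []" | "\<not> reduced v" | "reduced v" "v \<noteq> []" by blast
      then show "coord (T i x) v = coord y v"
      proof cases
        case 1
        then show ?thesis by (simp add: coord_T[OF i \<open>x \<in> K\<close>] x eq0)
      next
        case 2
        then have "v \<noteq> []" by auto
        then show ?thesis using 2 by (simp add: coord_T[OF i \<open>x \<in> K\<close>] K_coord_not_reduced[OF yK])
      next
        case 3
        then show ?thesis
          using inv[OF 3] reduced_mult_gen_inv[OF i 3] by (simp add: coord_T[OF i \<open>x \<in> K\<close>] x)
      qed
    qed
    ultimately show "y \<in> T i ` K" by blast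
  qed
qed

lemma T_V: "i \<in> {1..n} \<Longrightarrow> h \<in> H \<Longrightarrow> T i (V h) = V (S i h)"
proof (rule coord_eqI)
  fix v assume i: "i \<in> {1..n}" and h: "h \<in> H"
  have "mult_gen_inv i v \<noteq> []" if "reduced v" "v \<noteq> []"
    using bij_betwE[OF bij_mult_gen_inv[OF i]] that by auto
  then show "coord (T i (V h)) v = coord (V (S i h)) v"
    by (auto simp: coord_T[OF i V_mem[OF h]] coord_V)
qed

text \<open>
  Both \<open>T\<^sub>i T\<^sub>i\<^sup>*\<close> and the spectral projection of the closed set \<open>\<sigma>\<^sub>i(X)\<close> project onto the range of \<open>T\<^sub>i\<close>.
\<close>
lemma full_T: "full_isometric_rep n \<sigma> K \<rho> T"
  unfolding full_isometric_rep_def isometric_covariant_rep_def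
proof (intro conjI exI[of _ \<rho>.E] ballI)
  show "star_rep K \<rho>" by (rule \<rho>.star_rep)
  show "spectral_measure_of_rep K \<rho> \<rho>.E" by (rule \<rho>.spectral_measure_of_rep_E)
  fix i assume i: "i \<in> {1..n}"
  show "isometry K K (T i)" by (rule isometry_T[OF i])
  show "\<rho> f (T i h) = T i (\<rho> (f \<circ> \<sigma> i) h)" if "f \<in> C0" "h \<in> K" for f h
    using covariant_T[OF i that] by (simp add: o_def)
  fix h assume h: "h \<in> K"
  have "closed (range (\<sigma> i))"
    using dynamical i unfolding dynamical_system_def
    by (metis UNIV_I closed_UNIV closed_closedin closed_map_def proper_imp_closed_map)
  then have esp: "\<rho>.espace (range (\<sigma> i)) = T i ` K" using \<rho>.espace_closed T_image[OF i] by simp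
  have "adjoint_on K (T i) h \<in> K"
    by (rule adjoint_in[OF closed_csubspace_K isometry_imp_bounded_op[OF isometry_T[OF i]] h])
  then have "\<rho>.E (range (\<sigma> i)) h = T i (adjoint_on K (T i) h)"
    using isometry_range_proj[OF closed_csubspace_K isometry_T[OF i] h]
    by (intro proj_unique[OF \<rho>.closed_csubspace_espace]) (auto simp: esp)
  then show "T i (adjoint_on K (T i) h) = \<rho>.E (range (\<sigma> i)) h" by simp
qed

lemma semi_invariant_V:
  assumes i: "i \<in> {1..n}"
  shows "semi_invariant K (T i) (V ` H)"
  unfolding semi_invariant_def
proof (intro exI conjI)
  show "closed_csubspace (V ` H)" by (rule closed_csubspace_V)
  show "closed_csubspace {0 :: 'h l2seq}" by (rule closed_csubspace_singleton_zero)
  show "{0} \<subseteq> V ` H" using closed_csubspaceD(2)[OF closed_csubspace_V] by simp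
  show "V ` H \<subseteq> K" using V_mem by auto
  show "T i ` V ` H \<subseteq> V ` H" using T_V[OF i] S_mem[OF i] by auto
  show "T i ` {0} \<subseteq> {0}" using norm_T[OF i \<rho>.HD(2)] by simp
  show "V ` H = ortho_diff (V ` H) {0}" by (auto simp: ortho_diff_def)
qed

end

theorem theorem2p16:
  fixes n :: nat
    and \<sigma> :: "nat \<Rightarrow> 'x::t2_space \<Rightarrow> 'x"
    and H :: "'h::chilbert set"
    and \<pi> :: "('x \<Rightarrow> complex) \<Rightarrow> 'h \<Rightarrow> 'h"
    and S :: "nat \<Rightarrow> 'h \<Rightarrow> 'h"
  assumes "dynamical_system n \<sigma>"
    and "metrizable_space (euclidean :: 'x topology)"
    and "closed_csubspace H"
    and "isometric_covariant_rep n \<sigma> H \<pi> S"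
  shows "\<exists>(K :: 'h l2seq set) (V :: 'h \<Rightarrow> 'h l2seq)
            (\<rho> :: ('x \<Rightarrow> complex) \<Rightarrow> 'h l2seq \<Rightarrow> 'h l2seq) (T :: nat \<Rightarrow> 'h l2seq \<Rightarrow> 'h l2seq).
      closed_csubspace K \<and> isometry H K V \<and>
      full_isometric_rep n \<sigma> K \<rho> T \<and>
      (\<forall>f\<in>C0. reduces K (\<rho> f) (V ` H) \<and> (\<forall>h\<in>H. \<rho> f (V h) = V (\<pi> f h))) \<and>
      (\<forall>i\<in>{1..n}. semi_invariant K (T i) (V ` H) \<and>
         (\<forall>h\<in>H. proj_onto (V ` H) (T i (V h)) = V (S i h)))"
proof -
  interpret covariant_rep n \<sigma> H \<pi> S by (rule covariant_rep.intro[OF assms])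
  have "proj_onto (V ` H) (T i (V h)) = V (S i h)" if "i \<in> {1..n}" "h \<in> H" for i h
    using T_V[OF that] S_mem[OF that] by (simp add: proj_id[OF closed_csubspace_V])
  then show ?thesis
    using closed_csubspace_K isometry_V full_T reduces_V \<rho>_V semi_invariant_V
    by (intro exI[of _ K] exI[of _ V] exI[of _ \<rho>] exI[of _ T]) blast
qed

end
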